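(* Let $T$ be any complete theory and work in $\mathbb{M}^{\mathrm{eq}}$ for a monster model $\mathbb{M}$. If $1 \to N \to G \to H \to 1$ is a short exact sequence of interpretable groups (with interpretable maps) and $N$ and $H$ have \textit{dfg}, then $G$ has \textit{dfg}.
   Context: An interpretable group $G$ has definable $f$-generics (\textit{dfg}) if there is a global type $p$ on $G$ and a small model $M_0$ such that every left translate of $p$ is definable over $M_0$. *)

theory Defs
  imports "HOL-Algebra.Exact_Sequence"
begin

unbundle cardinal_syntax

section \<open>Many-sorted first-order logic\<close>

text \<open>
  The logic is many-sorted because \<open>M\<^sup>e\<^sup>q\<close> is a many-sorted structure; an ordinary one-sorted
  language is the case in which \<open>sorts\<close> is a singleton.  Constants are functions of arity 0.
  Variables are de Bruijn indices into a context (a list of sorts), so a formula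
  \<open>\<phi>(x, y)\<close> with \<open>x\<close> of sorts \<open>\<Gamma>\<close> and \<open>y\<close> of sorts \<open>\<Delta>\<close> is a formula in the
  context \<open>\<Gamma> @ \<Delta>\<close>, and \<open>\<phi>(a, b)\<close> is its evaluation at \<open>a @ b\<close>.
\<close>

record ('s, 'f, 'r) lang =
  sorts :: "'s set"
  funs :: "'f set"
  fun_type :: "'f \<Rightarrow> 's list \<times> 's"
  rels :: "'r set"
  rel_type :: "'r \<Rightarrow> 's list"

definition wf_lang :: "('s, 'f, 'r) lang \<Rightarrow> bool" where
  "wf_lang L \<longleftrightarrow>
     (\<forall>f\<in>funs L. fst (fun_type L f) \<in> lists (sorts L) \<and> snd (fun_type L f) \<in> sorts L) \<and>
     (\<forall>r\<in>rels L. rel_type L r \<in> lists (sorts L))"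

datatype 'f tm = Var nat | Fun 'f "'f tm list"

datatype ('s, 'f, 'r) fm =
    Bot
  | Eq "'f tm" "'f tm"
  | Rel 'r "'f tm list"
  | Neg "('s, 'f, 'r) fm"
  | Conj "('s, 'f, 'r) fm" "('s, 'f, 'r) fm"
  | Ex 's "('s, 'f, 'r) fm"

inductive has_sort :: "('s, 'f, 'r) lang \<Rightarrow> 's list \<Rightarrow> 'f tm \<Rightarrow> 's \<Rightarrow> bool"
  for L :: "('s, 'f, 'r) lang" and \<Gamma> :: "'s list" where
  has_sort_Var: "i < length \<Gamma> \<Longrightarrow> has_sort L \<Gamma> (Var i) (\<Gamma> ! i)"
| has_sort_Fun: "f \<in> funs L \<Longrightarrow> list_all2 (has_sort L \<Gamma>) ts (fst (fun_type L f)) \<Longrightarrow>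
    has_sort L \<Gamma> (Fun f ts) (snd (fun_type L f))"

primrec wf_fm :: "('s, 'f, 'r) lang \<Rightarrow> 's list \<Rightarrow> ('s, 'f, 'r) fm \<Rightarrow> bool" where
  "wf_fm L \<Gamma> Bot \<longleftrightarrow> True"
| "wf_fm L \<Gamma> (Eq t u) \<longleftrightarrow> (\<exists>s\<in>sorts L. has_sort L \<Gamma> t s \<and> has_sort L \<Gamma> u s)"
| "wf_fm L \<Gamma> (Rel r ts) \<longleftrightarrow> r \<in> rels L \<and> list_all2 (has_sort L \<Gamma>) ts (rel_type L r)"
| "wf_fm L \<Gamma> (Neg \<phi>) \<longleftrightarrow> wf_fm L \<Gamma> \<phi>"
| "wf_fm L \<Gamma> (Conj \<phi> \<psi>) \<longleftrightarrow> wf_fm L \<Gamma> \<phi> \<and> wf_fm L \<Gamma> \<psi>"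
| "wf_fm L \<Gamma> (Ex s \<phi>) \<longleftrightarrow> s \<in> sorts L \<and> wf_fm L (s # \<Gamma>) \<phi>"

definition formulas :: "('s, 'f, 'r) lang \<Rightarrow> 's list \<Rightarrow> ('s, 'f, 'r) fm set" where
  "formulas L \<Gamma> = {\<phi>. wf_fm L \<Gamma> \<phi>}"

definition all_formulas :: "('s, 'f, 'r) lang \<Rightarrow> ('s, 'f, 'r) fm set" where
  "all_formulas L = (\<Union>\<Gamma>\<in>lists (sorts L). formulas L \<Gamma>)"

record ('s, 'f, 'r, 'a) struc =
  carr :: "'s \<Rightarrow> 'a set"
  fun_int :: "'f \<Rightarrow> 'a list \<Rightarrow> 'a"
  rel_int :: "'r \<Rightarrow> 'a list \<Rightarrow> bool"

definition tuples :: "('s \<Rightarrow> 'a set) \<Rightarrow> 's list \<Rightarrow> 'a list set" where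
  "tuples A \<Gamma> = {xs. list_all2 (\<lambda>x s. x \<in> A s) xs \<Gamma>}"

definition is_struc :: "('s, 'f, 'r) lang \<Rightarrow> ('s, 'f, 'r, 'a) struc \<Rightarrow> bool" where
  "is_struc L M \<longleftrightarrow>
     (\<forall>s\<in>sorts L. carr M s \<noteq> {}) \<and>
     (\<forall>f\<in>funs L. \<forall>xs\<in>tuples (carr M) (fst (fun_type L f)).
        fun_int M f xs \<in> carr M (snd (fun_type L f)))"

primrec eval :: "('s, 'f, 'r, 'a) struc \<Rightarrow> 'a list \<Rightarrow> 'f tm \<Rightarrow> 'a" where
  "eval M xs (Var i) = xs ! i"
| "eval M xs (Fun f ts) = fun_int M f (map (eval M xs) ts)"

primrec sat :: "('s, 'f, 'r, 'a) struc \<Rightarrow> 'a list \<Rightarrow> ('s, 'f, 'r) fm \<Rightarrow> bool" where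
  "sat M xs Bot \<longleftrightarrow> False"
| "sat M xs (Eq t u) \<longleftrightarrow> eval M xs t = eval M xs u"
| "sat M xs (Rel r ts) \<longleftrightarrow> rel_int M r (map (eval M xs) ts)"
| "sat M xs (Neg \<phi>) \<longleftrightarrow> \<not> sat M xs \<phi>"
| "sat M xs (Conj \<phi> \<psi>) \<longleftrightarrow> sat M xs \<phi> \<and> sat M xs \<psi>"
| "sat M xs (Ex s \<phi>) \<longleftrightarrow> (\<exists>x\<in>carr M s. sat M (x # xs) \<phi>)"

definition is_model ::
    "('s, 'f, 'r) lang \<Rightarrow> ('s, 'f, 'r) fm set \<Rightarrow> ('s, 'f, 'r, 'a) struc \<Rightarrow> bool" where
  "is_model L T M \<longleftrightarrow> is_struc L M \<and> (\<forall>\<phi>\<in>T. sat M [] \<phi>)"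

text \<open>
  Theories are identified with their deductive closures.  For a set of sentences that has a
  model, the following says that it is complete and deductively closed.
\<close>

definition complete_theory :: "('s, 'f, 'r) lang \<Rightarrow> ('s, 'f, 'r) fm set \<Rightarrow> bool" where
  "complete_theory L T \<longleftrightarrow>
     T \<subseteq> formulas L [] \<and> (\<forall>\<phi>\<in>formulas L []. \<phi> \<in> T \<longleftrightarrow> Neg \<phi> \<notin> T)"

definition elementary_substruc ::
    "('s, 'f, 'r) lang \<Rightarrow> ('s, 'f, 'r, 'a) struc \<Rightarrow> ('s, 'f, 'r, 'a) struc \<Rightarrow> bool" where
  "elementary_substruc L M\<^sub>0 M \<longleftrightarrow>
     is_struc L M\<^sub>0 \<and> (\<forall>s\<in>sorts L. carr M\<^sub>0 s \<subseteq> carr M s) \<and>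
     (\<forall>\<Gamma>\<in>lists (sorts L). \<forall>\<phi>\<in>formulas L \<Gamma>. \<forall>xs\<in>tuples (carr M\<^sub>0) \<Gamma>.
        sat M\<^sub>0 xs \<phi> \<longleftrightarrow> sat M xs \<phi>)"


section \<open>Definable sets and types\<close>

text \<open>
  A formula over a parameter set \<open>A\<close> (a subset \<open>A s\<close> of each sort \<open>s\<close>) is a pair
  \<open>(\<phi>, b)\<close>, standing for \<open>\<phi>(x, b)\<close>, with \<open>b\<close> a finite tuple from \<open>A\<close>.
\<close>

definition param_formulas ::
    "('s, 'f, 'r) lang \<Rightarrow> ('s \<Rightarrow> 'a set) \<Rightarrow> 's list \<Rightarrow> (('s, 'f, 'r) fm \<times> 'a list) set" where
  "param_formulas L A \<Gamma> =
     {(\<phi>, b). \<exists>\<Delta>\<in>lists (sorts L). \<phi> \<in> formulas L (\<Gamma> @ \<Delta>) \<and> b \<in> tuples A \<Delta>}"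

definition solutions ::
    "('s, 'f, 'r, 'a) struc \<Rightarrow> 's list \<Rightarrow> ('s, 'f, 'r) fm \<times> 'a list \<Rightarrow> 'a list set" where
  "solutions M \<Gamma> = (\<lambda>(\<phi>, b). {xs \<in> tuples (carr M) \<Gamma>. sat M (xs @ b) \<phi>})"

definition definable_over ::
    "('s, 'f, 'r) lang \<Rightarrow> ('s, 'f, 'r, 'a) struc \<Rightarrow> ('s \<Rightarrow> 'a set) \<Rightarrow> 's list \<Rightarrow> 'a list set \<Rightarrow> bool"
  where
  "definable_over L M A \<Gamma> X \<longleftrightarrow> (\<exists>\<theta>\<in>param_formulas L A \<Gamma>. X = solutions M \<Gamma> \<theta>)"

abbreviation definable ::
    "('s, 'f, 'r) lang \<Rightarrow> ('s, 'f, 'r, 'a) struc \<Rightarrow> 's list \<Rightarrow> 'a list set \<Rightarrow> bool" where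
  "definable L M \<equiv> definable_over L M (carr M)"

definition types_over ::
    "('s, 'f, 'r) lang \<Rightarrow> ('s, 'f, 'r, 'a) struc \<Rightarrow> ('s \<Rightarrow> 'a set) \<Rightarrow> 's list \<Rightarrow>
     (('s, 'f, 'r) fm \<times> 'a list) set set" where
  "types_over L M A \<Gamma> =
     {p. p \<subseteq> param_formulas L A \<Gamma> \<and>
         (\<forall>q\<subseteq>p. finite q \<longrightarrow> (\<exists>xs\<in>tuples (carr M) \<Gamma>. \<forall>\<theta>\<in>q. xs \<in> solutions M \<Gamma> \<theta>)) \<and>
         (\<forall>(\<phi>, b)\<in>param_formulas L A \<Gamma>. (\<phi>, b) \<in> p \<or> (Neg \<phi>, b) \<in> p)}"

abbreviation global_types ::
    "('s, 'f, 'r) lang \<Rightarrow> ('s, 'f, 'r, 'a) struc \<Rightarrow> 's list \<Rightarrow>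
     (('s, 'f, 'r) fm \<times> 'a list) set set" where
  "global_types L M \<equiv> types_over L M (carr M)"

definition definable_type ::
    "('s, 'f, 'r) lang \<Rightarrow> ('s, 'f, 'r, 'a) struc \<Rightarrow> ('s \<Rightarrow> 'a set) \<Rightarrow> 's list \<Rightarrow>
     (('s, 'f, 'r) fm \<times> 'a list) set \<Rightarrow> bool" where
  "definable_type L M A \<Gamma> p \<longleftrightarrow>
     (\<forall>\<Delta>\<in>lists (sorts L). \<forall>\<phi>\<in>formulas L (\<Gamma> @ \<Delta>).
        definable_over L M A \<Delta> {b \<in> tuples (carr M) \<Delta>. (\<phi>, b) \<in> p})"


section \<open>Monster models\<close>

definition small :: "'k rel \<Rightarrow> ('s, 'f, 'r) lang \<Rightarrow> ('s \<Rightarrow> 'a set) \<Rightarrow> bool" where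
  "small \<kappa> L A \<longleftrightarrow> |Sigma (sorts L) A| <o \<kappa>"

definition saturated ::
    "'k rel \<Rightarrow> ('s, 'f, 'r) lang \<Rightarrow> ('s, 'f, 'r, 'a) struc \<Rightarrow> bool" where
  "saturated \<kappa> L M \<longleftrightarrow>
     (\<forall>A. (\<forall>s\<in>sorts L. A s \<subseteq> carr M s) \<longrightarrow> small \<kappa> L A \<longrightarrow>
        (\<forall>\<Gamma>\<in>lists (sorts L). \<forall>p\<in>types_over L M A \<Gamma>.
           \<exists>xs\<in>tuples (carr M) \<Gamma>. \<forall>\<theta>\<in>p. xs \<in> solutions M \<Gamma> \<theta>))"

definition partial_elementary ::
    "('s, 'f, 'r) lang \<Rightarrow> ('s, 'f, 'r, 'a) struc \<Rightarrow> ('s \<Rightarrow> 'a set) \<Rightarrow> ('s \<Rightarrow> 'a \<Rightarrow> 'a) \<Rightarrow> bool" where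
  "partial_elementary L M A \<sigma> \<longleftrightarrow>
     (\<forall>s\<in>sorts L. \<sigma> s ` A s \<subseteq> carr M s) \<and>
     (\<forall>\<Gamma>\<in>lists (sorts L). \<forall>\<phi>\<in>formulas L \<Gamma>. \<forall>xs\<in>tuples A \<Gamma>.
        sat M xs \<phi> \<longleftrightarrow> sat M (map2 \<sigma> \<Gamma> xs) \<phi>)"

definition automorphism ::
    "('s, 'f, 'r) lang \<Rightarrow> ('s, 'f, 'r, 'a) struc \<Rightarrow> ('s \<Rightarrow> 'a \<Rightarrow> 'a) \<Rightarrow> bool" where
  "automorphism L M \<sigma> \<longleftrightarrow>
     (\<forall>s\<in>sorts L. bij_betw (\<sigma> s) (carr M s) (carr M s)) \<and>
     (\<forall>f\<in>funs L. \<forall>xs\<in>tuples (carr M) (fst (fun_type L f)).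
        \<sigma> (snd (fun_type L f)) (fun_int M f xs) =
          fun_int M f (map2 \<sigma> (fst (fun_type L f)) xs)) \<and>
     (\<forall>r\<in>rels L. \<forall>xs\<in>tuples (carr M) (rel_type L r).
        rel_int M r xs \<longleftrightarrow> rel_int M r (map2 \<sigma> (rel_type L r) xs))"

definition strongly_homogeneous ::
    "'k rel \<Rightarrow> ('s, 'f, 'r) lang \<Rightarrow> ('s, 'f, 'r, 'a) struc \<Rightarrow> bool" where
  "strongly_homogeneous \<kappa> L M \<longleftrightarrow>
     (\<forall>A \<sigma>. (\<forall>s\<in>sorts L. A s \<subseteq> carr M s) \<longrightarrow> small \<kappa> L A \<longrightarrow> partial_elementary L M A \<sigma> \<longrightarrow>
        (\<exists>\<tau>. automorphism L M \<tau> \<and> (\<forall>s\<in>sorts L. \<forall>a\<in>A s. \<tau> s a = \<sigma> s a)))"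

text \<open>
  The set of all formulas has cardinality \<open>|L| + \<aleph>\<^sub>0\<close>, so \<open>\<kappa>\<close> is uncountable.
\<close>

definition monster ::
    "'k rel \<Rightarrow> ('s, 'f, 'r) lang \<Rightarrow> ('s, 'f, 'r, 'a) struc \<Rightarrow> bool" where
  "monster \<kappa> L M \<longleftrightarrow>
     Card_order \<kappa> \<and> |all_formulas L| <o \<kappa> \<and> saturated \<kappa> L M \<and> strongly_homogeneous \<kappa> L M"


section \<open>The structure of imaginaries\<close>

datatype ('s, 'f, 'r) eq_sort = Home 's | Quot "'s list" "('s, 'f, 'r) fm"

datatype ('s, 'f, 'r) eq_fun = Base 'f | Proj "'s list" "('s, 'f, 'r) fm"

datatype 'a eq_elem = Real (un_Real: 'a) | Imag "'a list set"

definition fm_rel ::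
    "('s, 'f, 'r, 'a) struc \<Rightarrow> 's list \<Rightarrow> ('s, 'f, 'r) fm \<Rightarrow> ('a list \<times> 'a list) set" where
  "fm_rel M \<Gamma> \<epsilon> =
     {(x, y). x \<in> tuples (carr M) \<Gamma> \<and> y \<in> tuples (carr M) \<Gamma> \<and> sat M (x @ y) \<epsilon>}"

text \<open>
  The pairs \<open>(\<Gamma>, \<epsilon>)\<close> such that \<open>\<epsilon>\<close> defines, without parameters, an equivalence
  relation on the product of the sorts \<open>\<Gamma>\<close>.
\<close>

definition equiv_formulas ::
    "('s, 'f, 'r) lang \<Rightarrow> ('s, 'f, 'r, 'a) struc \<Rightarrow> ('s list \<times> ('s, 'f, 'r) fm) set" where
  "equiv_formulas L M =
     {(\<Gamma>, \<epsilon>). \<Gamma> \<in> lists (sorts L) \<and> \<epsilon> \<in> formulas L (\<Gamma> @ \<Gamma>) \<and>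
             equiv (tuples (carr M) \<Gamma>) (fm_rel M \<Gamma> \<epsilon>)}"

definition eq_lang ::
    "('s, 'f, 'r) lang \<Rightarrow> ('s, 'f, 'r, 'a) struc \<Rightarrow>
     (('s, 'f, 'r) eq_sort, ('s, 'f, 'r) eq_fun, 'r) lang" where
  "eq_lang L M = \<lparr>
     sorts = Home ` sorts L \<union> (\<lambda>(\<Gamma>, \<epsilon>). Quot \<Gamma> \<epsilon>) ` equiv_formulas L M,
     funs = Base ` funs L \<union> (\<lambda>(\<Gamma>, \<epsilon>). Proj \<Gamma> \<epsilon>) ` equiv_formulas L M,
     fun_type = (\<lambda>f. case f of
         Base g \<Rightarrow> (map Home (fst (fun_type L g)), Home (snd (fun_type L g)))
       | Proj \<Gamma> \<epsilon> \<Rightarrow> (map Home \<Gamma>, Quot \<Gamma> \<epsilon>)),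
     rels = rels L,
     rel_type = (\<lambda>r. map Home (rel_type L r)) \<rparr>"

definition eq_struc ::
    "('s, 'f, 'r, 'a) struc \<Rightarrow>
     (('s, 'f, 'r) eq_sort, ('s, 'f, 'r) eq_fun, 'r, 'a eq_elem) struc" where
  "eq_struc M = \<lparr>
     carr = (\<lambda>s. case s of
         Home t \<Rightarrow> Real ` carr M t
       | Quot \<Gamma> \<epsilon> \<Rightarrow> Imag ` (tuples (carr M) \<Gamma> // fm_rel M \<Gamma> \<epsilon>)),
     fun_int = (\<lambda>f xs. case f of
         Base g \<Rightarrow> Real (fun_int M g (map un_Real xs))
       | Proj \<Gamma> \<epsilon> \<Rightarrow> Imag (fm_rel M \<Gamma> \<epsilon> `` {map un_Real xs})),
     rel_int = (\<lambda>r xs. rel_int M r (map un_Real xs)) \<rparr>"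


section \<open>Definable groups and definable \<open>f\<close>-generics\<close>

definition definable_group ::
    "('s, 'f, 'r) lang \<Rightarrow> ('s, 'f, 'r, 'a) struc \<Rightarrow> 's list \<Rightarrow> 'a list monoid \<Rightarrow> bool" where
  "definable_group L M \<Gamma> G \<longleftrightarrow>
     \<Gamma> \<in> lists (sorts L) \<and> group G \<and> definable L M \<Gamma> (carrier G) \<and>
     definable L M (\<Gamma> @ \<Gamma> @ \<Gamma>) {x @ y @ (x \<otimes>\<^bsub>G\<^esub> y) | x y. x \<in> carrier G \<and> y \<in> carrier G}"

definition definable_map ::
    "('s, 'f, 'r) lang \<Rightarrow> ('s, 'f, 'r, 'a) struc \<Rightarrow> 's list \<Rightarrow> 's list \<Rightarrow> 'a list set \<Rightarrow>
     ('a list \<Rightarrow> 'a list) \<Rightarrow> bool" where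
  "definable_map L M \<Gamma> \<Delta> X f \<longleftrightarrow> definable L M (\<Gamma> @ \<Delta>) {x @ f x | x. x \<in> X}"

definition type_on :: "('s, 'f, 'r, 'a) struc \<Rightarrow> 's list \<Rightarrow> 'a list set \<Rightarrow>
     (('s, 'f, 'r) fm \<times> 'a list) set \<Rightarrow> bool" where
  "type_on M \<Gamma> X p \<longleftrightarrow> (\<exists>\<theta>\<in>p. solutions M \<Gamma> \<theta> = X)"

text \<open>
  The left translate \<open>g \<cdot> p\<close> of a global type \<open>p\<close> on \<open>G\<close> consists of the formulas
  \<open>\<theta>(x)\<close> such that \<open>p\<close> contains a formula expressing \<open>x \<in> G \<and> \<theta>(g x)\<close>.
\<close>

definition left_translate ::
    "('s, 'f, 'r) lang \<Rightarrow> ('s, 'f, 'r, 'a) struc \<Rightarrow> 's list \<Rightarrow> 'a list monoid \<Rightarrow> 'a list \<Rightarrow>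
     (('s, 'f, 'r) fm \<times> 'a list) set \<Rightarrow> (('s, 'f, 'r) fm \<times> 'a list) set" where
  "left_translate L M \<Gamma> G g p =
     {\<theta> \<in> param_formulas L (carr M) \<Gamma>.
        \<exists>\<eta>\<in>p. solutions M \<Gamma> \<eta> = {x \<in> carrier G. g \<otimes>\<^bsub>G\<^esub> x \<in> solutions M \<Gamma> \<theta>}}"

definition dfg ::
    "'k rel \<Rightarrow> ('s, 'f, 'r) lang \<Rightarrow> ('s, 'f, 'r, 'a) struc \<Rightarrow> 's list \<Rightarrow> 'a list monoid \<Rightarrow> bool" where
  "dfg \<kappa> L M \<Gamma> G \<longleftrightarrow>
     (\<exists>p\<in>global_types L M \<Gamma>. type_on M \<Gamma> (carrier G) p \<and>
        (\<exists>M\<^sub>0. elementary_substruc L M\<^sub>0 M \<and> small \<kappa> L (carr M\<^sub>0) \<and>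
           (\<forall>g\<in>carrier G. definable_type L M (carr M\<^sub>0) \<Gamma> (left_translate L M \<Gamma> G g p))))"

text \<open>
  Interpretable means definable, possibly with parameters, in \<open>M\<^sup>e\<^sup>q\<close>.
\<close>

definition interpretable_group ::
    "('s, 'f, 'r) lang \<Rightarrow> ('s, 'f, 'r, 'a) struc \<Rightarrow> ('s, 'f, 'r) eq_sort list \<Rightarrow>
     'a eq_elem list monoid \<Rightarrow> bool" where
  "interpretable_group L M = definable_group (eq_lang L M) (eq_struc M)"

definition interpretable_map ::
    "('s, 'f, 'r) lang \<Rightarrow> ('s, 'f, 'r, 'a) struc \<Rightarrow>
     ('s, 'f, 'r) eq_sort list \<Rightarrow> ('s, 'f, 'r) eq_sort list \<Rightarrow> 'a eq_elem list set \<Rightarrow>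
     ('a eq_elem list \<Rightarrow> 'a eq_elem list) \<Rightarrow> bool" where
  "interpretable_map L M = definable_map (eq_lang L M) (eq_struc M)"

definition has_dfg ::
    "'k rel \<Rightarrow> ('s, 'f, 'r) lang \<Rightarrow> ('s, 'f, 'r, 'a) struc \<Rightarrow> ('s, 'f, 'r) eq_sort list \<Rightarrow>
     'a eq_elem list monoid \<Rightarrow> bool" where
  "has_dfg \<kappa> L M = dfg \<kappa> (eq_lang L M) (eq_struc M)"

end

theory Submission
  imports Defs "HOL-Library.Nat_Bijection"
begin

text \<open>
  A global type is an ultrafilter, and a definable type on a group \<open>G\<close> is dfg if and only if, for each
  formula \<open>\<phi>(x, y)\<close>, its translates have only finitely many \<open>\<phi>\<close>-definition schemes: by saturation a
  small number of schemes is a finite one, and conversely the parameters of all these schemes lie in a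
  small model.

  Let \<open>V\<close> and \<open>R\<close> be such ultrafilters for \<open>N\<close> and \<open>H\<close>, let \<open>W\<close> be any ultrafilter on \<open>G\<close> that \<open>\<pi>\<close> maps
  to \<open>R\<close>, and multiply a \<open>W\<close>-generic \<open>g\<close> by a \<open>V\<close>-generic \<open>n\<close>.  For a fixed formula, \<open>g V\<close> takes a
  bounded number of values while \<open>g\<close> runs through a fibre of \<open>\<pi>\<close>, because \<open>V\<close> has finitely many
  translates.  So \<open>g V\<close> is algebraic over \<open>\<pi>(g)\<close>: although \<open>W\<close> is not definable, finitely many parameters
  single out its behaviour on the relevant sets, which is therefore definable from \<open>R\<close>.  Many
  translates with the same trace on \<open>H\<close> would give too many values on a single fibre.
\<close>


section \<open>Renaming variables\<close>

text \<open>There is in general no definable section of \<pi>, and no definable type on G over R is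
  given to begin with; this is why W is taken from Zorn's lemma, and why V is integrated before W.
  For fixed g, definability of V turns X(g n, b) into a definable relation Y(g, b), and W is applied
  to such relations only. The bound on the values along a fibre is uniform because moving g within
  its fibre amounts to translating V by an element of N: the base point of the fibre enters only as
  a further parameter of one fixed formula, and schemes are counted uniformly in the parameters.
  Algebraicity is thus replaced by a count for each formula, and no element outside M occurs: a
  realization of one type over a realization of another is an iterated limit. The passage to
  imaginaries transports one consequence of saturation, the existence of finite subcovers for covers
  by sets definable over a small set; covers can be pulled back along the quotient maps, so no type
  has to be lifted.\<close>

primrec ren_tm :: "(nat \<Rightarrow> nat) \<Rightarrow> 'f tm \<Rightarrow> 'f tm" where
  "ren_tm \<rho> (Var i) = Var (\<rho> i)"
| "ren_tm \<rho> (Fun f ts) = Fun f (map (ren_tm \<rho>) ts)"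

primrec ren :: "(nat \<Rightarrow> nat) \<Rightarrow> ('s, 'f, 'r) fm \<Rightarrow> ('s, 'f, 'r) fm" where
  "ren \<rho> Bot = Bot"
| "ren \<rho> (Eq t u) = Eq (ren_tm \<rho> t) (ren_tm \<rho> u)"
| "ren \<rho> (Rel r ts) = Rel r (map (ren_tm \<rho>) ts)"
| "ren \<rho> (Neg \<phi>) = Neg (ren \<rho> \<phi>)"
| "ren \<rho> (Conj \<phi> \<psi>) = Conj (ren \<rho> \<phi>) (ren \<rho> \<psi>)"
| "ren \<rho> (Ex s \<phi>) = Ex s (ren (case_nat 0 (\<lambda>i. Suc (\<rho> i))) \<phi>)"

lemma has_sort_ren:
  assumes "has_sort L \<Gamma> t s" "\<And>i. i < length \<Gamma> \<Longrightarrow> \<rho> i < length \<Gamma>' \<and> \<Gamma>' ! \<rho> i = \<Gamma> ! i"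
  shows "has_sort L \<Gamma>' (ren_tm \<rho> t) s"
  using assms(1)
proof (induction rule: has_sort.induct)
  case (has_sort_Var i)
  then show ?case using assms(2)[of i] has_sort.has_sort_Var[of "\<rho> i" \<Gamma>' L] by simp
next
  case (has_sort_Fun f ts)
  have "list_all2 (has_sort L \<Gamma>') (map (ren_tm \<rho>) ts) (fst (fun_type L f))"
    using has_sort_Fun(2) by (auto simp: list_all2_conv_all_nth)
  then show ?case using has_sort_Fun(1) by (auto intro: has_sort.has_sort_Fun)
qed

lemma eval_ren:
  assumes "has_sort L \<Gamma> t s" "\<And>i. i < length \<Gamma> \<Longrightarrow> ys ! \<rho> i = xs ! i"
  shows "eval M ys (ren_tm \<rho> t) = eval M xs t"
  using assms(1)
proof (induction rule: has_sort.induct)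
  case (has_sort_Var i)
  then show ?case using assms(2)[of i] by simp
next
  case (has_sort_Fun f ts)
  have "map (\<lambda>t. eval M ys (ren_tm \<rho> t)) ts = map (eval M xs) ts"
    using has_sort_Fun(2) by (auto simp: list_all2_conv_all_nth in_set_conv_nth)
  then show ?case by (simp add: o_def del: map_eq_conv)
qed

lemma wf_fm_ren:
  assumes "wf_fm L \<Gamma> \<phi>" "\<And>i. i < length \<Gamma> \<Longrightarrow> \<rho> i < length \<Gamma>' \<and> \<Gamma>' ! \<rho> i = \<Gamma> ! i"
  shows "wf_fm L \<Gamma>' (ren \<rho> \<phi>)"
  using assms
proof (induction \<phi> arbitrary: \<Gamma> \<Gamma>' \<rho>)
  case (Eq t u)
  then show ?case by (auto intro: has_sort_ren)
next
  case (Rel r ts)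
  then show ?case by (auto simp: list_all2_conv_all_nth intro!: has_sort_ren)
next
  case (Ex s \<phi>)
  have "wf_fm L (s # \<Gamma>') (ren (case_nat 0 (\<lambda>i. Suc (\<rho> i))) \<phi>)"
    by (rule Ex.IH[of "s # \<Gamma>"]) (use Ex.prems in \<open>auto split: nat.split\<close>)
  then show ?case using Ex.prems by simp
qed auto

text \<open>Well-formedness confines the free variables to the context \<Gamma>, so \<rho> has to be
  correct there only; \<open>ys\<close> may be longer and in any order. This lets one formula be
  reused in every larger context.\<close>

lemma sat_ren:
  assumes "wf_fm L \<Gamma> \<phi>" "\<And>i. i < length \<Gamma> \<Longrightarrow> ys ! \<rho> i = xs ! i"
  shows "sat M ys (ren \<rho> \<phi>) \<longleftrightarrow> sat M xs \<phi>"
  using assms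
proof (induction \<phi> arbitrary: \<Gamma> ys xs \<rho>)
  case (Eq t u)
  then show ?case by (auto simp: eval_ren)
next
  case (Rel r ts)
  have "eval M ys (ren_tm \<rho> t) = eval M xs t" if "t \<in> set ts" for t
    using that Rel(1) eval_ren[of L \<Gamma> t _ ys \<rho> xs M, OF _ Rel(2)]
    by (auto simp: list_all2_conv_all_nth in_set_conv_nth)
  then show ?case by (simp add: o_def cong: map_cong)
next
  case (Neg \<phi>)
  then show ?case by (metis ren.simps(4) sat.simps(4) wf_fm.simps(4))
next
  case (Conj \<phi> \<psi>)
  then show ?case by (metis ren.simps(5) sat.simps(5) wf_fm.simps(5))
next
  case (Ex s \<phi>)
  have "sat M (x # ys) (ren (case_nat 0 (\<lambda>i. Suc (\<rho> i))) \<phi>) \<longleftrightarrow> sat M (x # xs) \<phi>" for x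
    by (rule Ex.IH[of "s # \<Gamma>"]) (use Ex.prems in \<open>auto split: nat.split\<close>)
  then show ?case by simp
qed auto

lemma tuples_iff:
  "xs \<in> tuples A \<Gamma> \<longleftrightarrow> length xs = length \<Gamma> \<and> (\<forall>i<length \<Gamma>. xs ! i \<in> A (\<Gamma> ! i))"
  by (auto simp: tuples_def list_all2_conv_all_nth)

lemma tuples_length: "xs \<in> tuples A \<Gamma> \<Longrightarrow> length xs = length \<Gamma>"
  by (simp add: tuples_iff)

lemma tuples_Nil [simp]: "xs \<in> tuples A [] \<longleftrightarrow> xs = []"
  by (auto simp: tuples_def)

lemma tuples_Cons [simp]: "x # xs \<in> tuples A (s # \<Gamma>) \<longleftrightarrow> x \<in> A s \<and> xs \<in> tuples A \<Gamma>"
  by (auto simp: tuples_def)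

lemma tuples_append:
  assumes "length xs = length \<Gamma> \<or> length ys = length \<Delta>"
  shows "xs @ ys \<in> tuples A (\<Gamma> @ \<Delta>) \<longleftrightarrow> xs \<in> tuples A \<Gamma> \<and> ys \<in> tuples A \<Delta>"
proof (cases "length xs = length \<Gamma>")
  case True
  then show ?thesis by (simp add: tuples_def list_all2_append)
next
  case False
  with assms show ?thesis by (auto simp: tuples_def dest: list_all2_lengthD)
qed

lemma tuples_appendI: "xs \<in> tuples A \<Gamma> \<Longrightarrow> ys \<in> tuples A \<Delta> \<Longrightarrow> xs @ ys \<in> tuples A (\<Gamma> @ \<Delta>)"
  by (simp add: tuples_append tuples_length[of xs A \<Gamma>])

lemma tuples_appendE:
  assumes "zs \<in> tuples A (\<Gamma> @ \<Delta>)"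
  obtains xs ys where "zs = xs @ ys" "xs \<in> tuples A \<Gamma>" "ys \<in> tuples A \<Delta>"
proof
  show "zs = take (length \<Gamma>) zs @ drop (length \<Gamma>) zs" by simp
  then have "take (length \<Gamma>) zs @ drop (length \<Gamma>) zs \<in> tuples A (\<Gamma> @ \<Delta>)" using assms by simp
  moreover have "length (take (length \<Gamma>) zs) = length \<Gamma>" using assms by (auto dest: tuples_length)
  ultimately show "take (length \<Gamma>) zs \<in> tuples A \<Gamma>" "drop (length \<Gamma>) zs \<in> tuples A \<Delta>"
    by (simp_all only: tuples_append simp_thms)
qed

lemma tuples_append_eq_iff:
  assumes "xs \<in> tuples A \<Gamma>" "xs' \<in> tuples A \<Gamma>"
  shows "xs @ ys = xs' @ ys' \<longleftrightarrow> xs = xs' \<and> ys = ys'"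
  using assms[THEN tuples_length] by simp

lemma tuples_mono: "xs \<in> tuples A \<Gamma> \<Longrightarrow> \<Gamma> \<in> lists S \<Longrightarrow> (\<And>s. s \<in> S \<Longrightarrow> A s \<subseteq> B s) \<Longrightarrow> xs \<in> tuples B \<Gamma>"
  by (fastforce simp: tuples_iff lists_eq_set set_conv_nth)


section \<open>Definable sets\<close>

locale fo_structure =
  fixes L :: "('s, 'f, 'r) lang" and M :: "('s, 'f, 'r, 'a) struc"
  assumes struc: "is_struc L M"
begin

lemma definable_overE:
  assumes "definable_over L M A \<Gamma> X"
  obtains \<phi> b \<Theta> where "\<Theta> \<in> lists (sorts L)" "wf_fm L (\<Gamma> @ \<Theta>) \<phi>" "b \<in> tuples A \<Theta>"
    "X = {xs \<in> tuples (carr M) \<Gamma>. sat M (xs @ b) \<phi>}"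
  using assms by (auto simp: definable_over_def param_formulas_def formulas_def solutions_def)

lemma definable_overI:
  assumes "\<Theta> \<in> lists (sorts L)" "wf_fm L (\<Gamma> @ \<Theta>) \<phi>" "b \<in> tuples A \<Theta>"
    "X = {xs \<in> tuples (carr M) \<Gamma>. sat M (xs @ b) \<phi>}"
  shows "definable_over L M A \<Gamma> X"
  using assms
  by (force simp: definable_over_def param_formulas_def formulas_def solutions_def
      intro!: bexI[of _ "(\<phi>, b)"])

lemma definable_over_subset: "definable_over L M A \<Gamma> X \<Longrightarrow> X \<subseteq> tuples (carr M) \<Gamma>"
  by (auto simp: definable_over_def solutions_def)

lemma definable_over_compl:
  assumes "definable_over L M A \<Gamma> X"
  shows "definable_over L M A \<Gamma> (tuples (carr M) \<Gamma> - X)"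
proof -
  obtain \<phi> b \<Theta> where 1: "\<Theta> \<in> lists (sorts L)" "wf_fm L (\<Gamma> @ \<Theta>) \<phi>" "b \<in> tuples A \<Theta>"
    "X = {xs \<in> tuples (carr M) \<Gamma>. sat M (xs @ b) \<phi>}"
    using definable_overE[OF assms] .
  show ?thesis by (rule definable_overI[where \<phi> = "Neg \<phi>"]) (use 1 in auto)
qed

lemma definable_over_Int:
  assumes "definable_over L M A \<Gamma> X" "definable_over L M A \<Gamma> Y"
  shows "definable_over L M A \<Gamma> (X \<inter> Y)"
proof -
  obtain \<phi> b \<Theta> where 1: "\<Theta> \<in> lists (sorts L)" "wf_fm L (\<Gamma> @ \<Theta>) \<phi>" "b \<in> tuples A \<Theta>"
    "X = {xs \<in> tuples (carr M) \<Gamma>. sat M (xs @ b) \<phi>}"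
    using definable_overE[OF assms(1)] .
  obtain \<psi> c \<Xi> where 2: "\<Xi> \<in> lists (sorts L)" "wf_fm L (\<Gamma> @ \<Xi>) \<psi>" "c \<in> tuples A \<Xi>"
    "Y = {xs \<in> tuples (carr M) \<Gamma>. sat M (xs @ c) \<psi>}"
    using definable_overE[OF assms(2)] .
  \<comment> \<open>The parameters \<open>c\<close> of \<psi> come to stand behind \<open>b\<close>,
    hence the shift by the length of \<Theta>.\<close>
  define \<rho> where "\<rho> i = (if i < length \<Gamma> then i else i + length \<Theta>)" for i
  show ?thesis
  proof (rule definable_overI[where \<phi> = "Conj (ren id \<phi>) (ren \<rho> \<psi>)" and b = "b @ c"])
    have "wf_fm L (\<Gamma> @ \<Theta> @ \<Xi>) (ren id \<phi>)"
      by (rule wf_fm_ren[OF 1(2)]) (auto simp: nth_append)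
    moreover have "wf_fm L (\<Gamma> @ \<Theta> @ \<Xi>) (ren \<rho> \<psi>)"
      by (rule wf_fm_ren[OF 2(2)]) (auto simp: nth_append \<rho>_def)
    ultimately show "wf_fm L (\<Gamma> @ \<Theta> @ \<Xi>) (Conj (ren id \<phi>) (ren \<rho> \<psi>))" by simp
    have "sat M (xs @ b @ c) (ren id \<phi>) \<longleftrightarrow> sat M (xs @ b) \<phi>" 
      if "xs \<in> tuples (carr M) \<Gamma>" for xs
      by (rule sat_ren[OF 1(2)])
        (use that in \<open>auto simp: nth_append tuples_length[OF that] tuples_length[OF 1(3)]\<close>)
    moreover have "sat M (xs @ b @ c) (ren \<rho> \<psi>) \<longleftrightarrow> sat M (xs @ c) \<psi>"
      if "xs \<in> tuples (carr M) \<Gamma>" for xs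
      by (rule sat_ren[OF 2(2)])
        (use that in \<open>auto simp: nth_append \<rho>_def tuples_length[OF that] tuples_length[OF 1(3)]\<close>)
    ultimately show "X \<inter> Y = {xs \<in> tuples (carr M) \<Gamma>. sat M (xs @ b @ c) (Conj (ren id \<phi>) (ren \<rho> \<psi>))}"
      using 1(4) 2(4) by auto
  qed (use 1 2 in \<open>auto intro: tuples_appendI\<close>)
qed

text \<open>Permuting, repeating and adding coordinates are all instances: \<open>ps\<close> says
  which coordinates of the longer tuple are fed to X. Later reorderings of variables go back to
  this.\<close>

lemma definable_over_ren:
  assumes "definable_over L M A (map ((!) \<Gamma>) ps) X" "set ps \<subseteq> {..<length \<Gamma>}"
  shows "definable_over L M A \<Gamma> {ys \<in> tuples (carr M) \<Gamma>. map ((!) ys) ps \<in> X}"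
proof -
  obtain \<phi> b \<Theta> where 1: "\<Theta> \<in> lists (sorts L)" "wf_fm L (map ((!) \<Gamma>) ps @ \<Theta>) \<phi>" "b \<in> tuples A \<Theta>"
    "X = {xs \<in> tuples (carr M) (map ((!) \<Gamma>) ps). sat M (xs @ b) \<phi>}"
    using definable_overE[OF assms(1)] .
  \<comment> \<open>Indices past \<open>ps\<close> are parameter positions; they move from behind
    \<open>ps\<close> to behind \<Gamma>.\<close>
  define \<rho> where "\<rho> i = (if i < length ps then ps ! i else length \<Gamma> + (i - length ps))" for i
  have ps: "ps ! i < length \<Gamma>" if "i < length ps" for i
    using assms(2) nth_mem that by blast
  show ?thesis
  proof (rule definable_overI[where \<phi> = "ren \<rho> \<phi>" and b = b])
    show "wf_fm L (\<Gamma> @ \<Theta>) (ren \<rho> \<phi>)"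
    proof (rule wf_fm_ren[OF 1(2)])
      fix i assume "i < length (map ((!) \<Gamma>) ps @ \<Theta>)"
      then show "\<rho> i < length (\<Gamma> @ \<Theta>) \<and> (\<Gamma> @ \<Theta>) ! \<rho> i = (map ((!) \<Gamma>) ps @ \<Theta>) ! i"
        using ps[of i] by (cases "i < length ps") (auto simp: nth_append \<rho>_def)
    qed
    have "sat M (ys @ b) (ren \<rho> \<phi>) \<longleftrightarrow> sat M (map ((!) ys) ps @ b) \<phi>"
      if "ys \<in> tuples (carr M) \<Gamma>" for ys
    proof (rule sat_ren[OF 1(2)])
      fix i assume "i < length (map ((!) \<Gamma>) ps @ \<Theta>)"
      then show "(ys @ b) ! \<rho> i = (map ((!) ys) ps @ b) ! i"
        using ps[of i] tuples_length[OF that]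
        by (cases "i < length ps") (auto simp: nth_append \<rho>_def)
    qed
    moreover have "map ((!) ys) ps \<in> tuples (carr M) (map ((!) \<Gamma>) ps)"
      if "ys \<in> tuples (carr M) \<Gamma>" for ys
      using that ps by (auto simp: tuples_iff)
    ultimately show "{ys \<in> tuples (carr M) \<Gamma>. map ((!) ys) ps \<in> X} =
      {xs \<in> tuples (carr M) \<Gamma>. sat M (xs @ b) (ren \<rho> \<phi>)}"
      using 1(4) by auto
  qed (use 1 in auto)
qed

text \<open>\<open>Ex\<close> binds index 0, so the block to be projected away stands in front; each
  quantifier removes its first coordinate, and the parameters stay the same.\<close>

lemma definable_over_Ex:
  assumes "definable_over L M A (\<Gamma> @ \<Delta>) X" "\<Gamma> \<in> lists (sorts L)"
  shows "definable_over L M A \<Delta> {ys \<in> tuples (carr M) \<Delta>. \<exists>xs\<in>tuples (carr M) \<Gamma>. xs @ ys \<in> X}"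
  using assms
proof (induction \<Gamma> arbitrary: X)
  case Nil
  have "{ys \<in> tuples (carr M) \<Delta>. \<exists>xs\<in>tuples (carr M) []. xs @ ys \<in> X} = X"
    using definable_over_subset[OF Nil(1)] by auto
  then show ?case using Nil(1) by simp
next
  case (Cons s \<Gamma>)
  then have "definable_over L M A (s # \<Gamma> @ \<Delta>) X" by simp
  then obtain \<phi> b \<Theta> where 1: "\<Theta> \<in> lists (sorts L)" "wf_fm L ((s # \<Gamma> @ \<Delta>) @ \<Theta>) \<phi>" "b \<in> tuples A \<Theta>"
    "X = {xs \<in> tuples (carr M) (s # \<Gamma> @ \<Delta>). sat M (xs @ b) \<phi>}"
    by (rule definable_overE)
  define Y where "Y = {xs \<in> tuples (carr M) (\<Gamma> @ \<Delta>). sat M (xs @ b) (Ex s \<phi>)}"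
  have "definable_over L M A (\<Gamma> @ \<Delta>) Y"
    by (rule definable_overI[where \<phi> = "Ex s \<phi>"]) (use 1 Y_def Cons.prems(2) in auto)
  from Cons.IH[OF this] Cons.prems(2)
  have "definable_over L M A \<Delta> {ys \<in> tuples (carr M) \<Delta>. \<exists>xs\<in>tuples (carr M) \<Gamma>. xs @ ys \<in> Y}"
    by simp
  moreover have "(\<exists>xs\<in>tuples (carr M) \<Gamma>. xs @ ys \<in> Y) \<longleftrightarrow> (\<exists>xs\<in>tuples (carr M) (s # \<Gamma>). xs @ ys \<in> X)"
    if ys: "ys \<in> tuples (carr M) \<Delta>" for ys
  proof -
    have "(\<exists>xs\<in>tuples (carr M) \<Gamma>. xs @ ys \<in> Y) \<longleftrightarrow>
       (\<exists>xs\<in>tuples (carr M) \<Gamma>. \<exists>x\<in>carr M s. x # xs @ ys \<in> X)"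
      using ys by (auto simp: Y_def 1(4) tuples_appendI)
    also have "\<dots> \<longleftrightarrow> (\<exists>xs\<in>tuples (carr M) (s # \<Gamma>). xs @ ys \<in> X)"
      by (force simp: tuples_def list_all2_Cons2)
    finally show ?thesis .
  qed
  ultimately show ?case by (simp cong: conj_cong)
qed

text \<open>The formula is unchanged: its last block of variables is reread as parameters. It has to
  be the last block, which is why \<open>dpred_const\<close> swaps blocks beforehand.\<close>

lemma definable_over_const:
  assumes "definable_over L M A (\<Gamma> @ \<Delta>) X" "c \<in> tuples A \<Delta>" "c \<in> tuples (carr M) \<Delta>"
    "\<Delta> \<in> lists (sorts L)"
  shows "definable_over L M A \<Gamma> {xs \<in> tuples (carr M) \<Gamma>. xs @ c \<in> X}"
proof -
  obtain \<phi> b \<Theta> where 1: "\<Theta> \<in> lists (sorts L)" "wf_fm L ((\<Gamma> @ \<Delta>) @ \<Theta>) \<phi>" "b \<in> tuples A \<Theta>"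
    "X = {xs \<in> tuples (carr M) (\<Gamma> @ \<Delta>). sat M (xs @ b) \<phi>}"
    using definable_overE[OF assms(1)] .
  show ?thesis
    by (rule definable_overI[where \<phi> = \<phi> and b = "c @ b" and \<Theta> = "\<Delta> @ \<Theta>"])
      (use 1 assms in \<open>auto intro: tuples_appendI\<close>)
qed

lemma definable_over_mono:
  assumes "definable_over L M A \<Gamma> X" "\<And>s. s \<in> sorts L \<Longrightarrow> A s \<subseteq> B s"
  shows "definable_over L M B \<Gamma> X"
proof -
  obtain \<phi> b \<Theta> where 1: "\<Theta> \<in> lists (sorts L)" "wf_fm L (\<Gamma> @ \<Theta>) \<phi>" "b \<in> tuples A \<Theta>"
    "X = {xs \<in> tuples (carr M) \<Gamma>. sat M (xs @ b) \<phi>}"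
    using definable_overE[OF assms(1)] .
  have "b \<in> tuples B \<Theta>"
    using 1(3) by (rule tuples_mono[where S = "sorts L"]) (use 1(1) assms(2) in auto)
  with 1 show ?thesis by (intro definable_overI[where \<phi> = \<phi> and b = b and \<Theta> = \<Theta>])
qed

end

section \<open>Named variables and predicates of valuations\<close>

primrec pos :: "('s list \<times> nat) list \<Rightarrow> 's list \<times> nat \<Rightarrow> nat list" where
  "pos [] i = []"
| "pos (k # ks) i = (if k = i then [0..<length (fst i)] else map ((+) (length (fst k))) (pos ks i))"

text \<open>A variable may occur several times in \<open>ks\<close>; \<open>pos\<close> points to
  its first occurrence, which suffices because all occurrences have the same value.\<close>

lemma pos_nth:
  assumes "i \<in> set ks" "\<And>k. k \<in> set ks \<Longrightarrow> length (v k) = length (fst k)"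
  shows "map ((!) (concat (map v ks))) (pos ks i) = v i"
  using assms
proof (induction ks)
  case (Cons k ks)
  show ?case
  proof (cases "k = i")
    case True
    then have "length (v i) = length (fst i)" using Cons.prems(2)[of i] by simp
    then show ?thesis using True by (auto intro!: nth_equalityI simp: nth_append)
  next
    case False
    have "map ((!) (concat (map v ks))) (pos ks i) = v i"
      using Cons.IH Cons.prems False by auto
    moreover have "length (v k) = length (fst k)" using Cons.prems(2) by simp
    ultimately show ?thesis using False by (simp add: o_def nth_append)
  qed
qed simp

lemma pos_less: "i \<in> set ks \<Longrightarrow> set (pos ks i) \<subseteq> {..<length (concat (map fst ks))}"
  by (induction ks) auto

context fo_structure
begin

text \<open>
  Definable relations are handled as predicates of valuations of named variables.  A variable
  \<open>(\<Gamma>, n)\<close> ranges over the tuples of sorts \<open>\<Gamma>\<close>, and \<open>n\<close> keeps apart variables of the same sorts;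
  there is no context to maintain, and atomic predicates can be stated with any variables.
\<close>

definition env :: "('s list \<times> nat \<Rightarrow> 'a list) \<Rightarrow> bool" where
  "env v \<longleftrightarrow> (\<forall>k\<in>lists (sorts L) \<times> UNIV. v k \<in> tuples (carr M) (fst k))"

abbreviation vars :: "('s list \<times> nat) set" where
  "vars \<equiv> lists (sorts L) \<times> UNIV"

definition ctx :: "('s list \<times> nat) list \<Rightarrow> 's list" where
  "ctx ks = concat (map fst ks)"

definition val :: "('s list \<times> nat \<Rightarrow> 'a list) \<Rightarrow> ('s list \<times> nat) list \<Rightarrow> 'a list" where
  "val v ks = concat (map v ks)"

text \<open>P may be any function of the whole valuation; the condition is that on valuations of the
  right sorts it depends on finitely many variables, through a set definable over A. The list
  \<open>ks\<close> may contain repetitions and variables that do not matter.\<close>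

definition dpred :: "('s \<Rightarrow> 'a set) \<Rightarrow> (('s list \<times> nat \<Rightarrow> 'a list) \<Rightarrow> bool) \<Rightarrow> bool" where
  "dpred A P \<longleftrightarrow> (\<exists>ks X. set ks \<subseteq> vars \<and> definable_over L M A (ctx ks) X \<and>
     (\<forall>v. env v \<longrightarrow> (P v \<longleftrightarrow> val v ks \<in> X)))"

lemma envD: "env v \<Longrightarrow> \<Gamma> \<in> lists (sorts L) \<Longrightarrow> v (\<Gamma>, n) \<in> tuples (carr M) \<Gamma>"
  by (auto simp: env_def)

lemma env_upd: "env v \<Longrightarrow> x \<in> tuples (carr M) \<Gamma> \<Longrightarrow> env (v((\<Gamma>, n) := x))"
  by (auto simp: env_def)

lemma tuples_nonempty:
  assumes "\<Gamma> \<in> lists (sorts L)" shows "\<exists>x. x \<in> tuples (carr M) \<Gamma>"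
  using assms
proof (induction \<Gamma>)
  case (Cons s \<Gamma>)
  then obtain x y where "x \<in> tuples (carr M) \<Gamma>" "y \<in> carr M s"
    using struc by (fastforce simp: is_struc_def)
  then have "y # x \<in> tuples (carr M) (s # \<Gamma>)" by simp
  then show ?case by blast
qed simp

lemma env_exists: "\<exists>v. env v"
proof
  show "env (\<lambda>k. SOME x. x \<in> tuples (carr M) (fst k))"
    unfolding env_def using someI_ex[OF tuples_nonempty] by auto
qed

lemma val_append: "val v (ks @ js) = val v ks @ val v js"
  and ctx_append: "ctx (ks @ js) = ctx ks @ ctx js"
  by (simp_all add: val_def ctx_def)

lemma val_Cons: "val v (k # ks) = v k @ val v ks"
  and ctx_Cons: "ctx (k # ks) = fst k @ ctx ks"
  and val_Nil: "val v [] = []"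
  and ctx_Nil: "ctx [] = []"
  by (simp_all add: val_def ctx_def)

lemmas val_ctx = val_append ctx_append val_Cons ctx_Cons val_Nil ctx_Nil

lemma val_upd: "k \<notin> set ks \<Longrightarrow> val (v(k := x)) ks = val v ks"
  by (induction ks) (auto simp: val_ctx)

lemma ctx_sorts: "set ks \<subseteq> vars \<Longrightarrow> ctx ks \<in> lists (sorts L)"
  by (induction ks) (auto simp: val_ctx)

lemma val_tuples: "env v \<Longrightarrow> set ks \<subseteq> vars \<Longrightarrow> val v ks \<in> tuples (carr M) (ctx ks)"
proof (induction ks)
  case (Cons k ks)
  then have "k \<in> vars" by simp
  then have "v k \<in> tuples (carr M) (fst k)" using Cons.prems(1) unfolding env_def by blast
  then show ?case using Cons by (simp add: val_ctx tuples_appendI)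
qed (simp add: val_ctx)

lemma val_surj:
  assumes "distinct ks" "z \<in> tuples (carr M) (ctx ks)"
  shows "\<exists>v. env v \<and> val v ks = z"
  using assms
proof (induction ks arbitrary: z)
  case Nil
  then show ?case using env_exists by (simp add: val_ctx)
next
  case (Cons k ks)
  from Cons.prems(2) obtain x z' where z: "z = x @ z'" "x \<in> tuples (carr M) (fst k)"
    "z' \<in> tuples (carr M) (ctx ks)"
    unfolding val_ctx by (rule tuples_appendE)
  then obtain v where "env v" "val v ks = z'" using Cons by auto
  then have "env (v(k := x)) \<and> val (v(k := x)) (k # ks) = z"
    using z env_upd[of v x "fst k" "snd k"] Cons.prems by (simp add: val_ctx val_upd)
  then show ?case by blast
qed

lemma definable_over_vars:
  assumes "definable_over L M A (ctx js) X" "set js \<subseteq> set ks" "set ks \<subseteq> vars"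
  obtains Y where "definable_over L M A (ctx ks) Y"
    "\<And>v. env v \<Longrightarrow> val v ks \<in> Y \<longleftrightarrow> val v js \<in> X"
proof
  define ps where "ps = concat (map (pos ks) js)"
  \<comment> \<open>Stated for lists over an arbitrary type: \<open>v = fst\<close> turns it into
    the claim about contexts, a valuation into the claim about values.\<close>
  have val: "map ((!) (concat (map v ks))) ps = concat (map v js)"
    if "\<And>k. k \<in> set ks \<Longrightarrow> length (v k) = length (fst k)" for v :: "'s list \<times> nat \<Rightarrow> 'x list"
  proof -
    have "map ((!) (concat (map v ks))) (pos ks i) = v i" if "i \<in> set js" for i
      using pos_nth[of i ks v] assms(2) \<open>\<And>k. k \<in> set ks \<Longrightarrow> length (v k) = length (fst k)\<close> that
      by blast
    then have "map (\<lambda>i. map ((!) (concat (map v ks))) (pos ks i)) js = map v js" by simp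
    then show ?thesis by (simp add: ps_def map_concat o_def del: map_eq_conv)
  qed
  have ctx: "map ((!) (ctx ks)) ps = ctx js" using val[of fst] by (simp add: ctx_def)
  have ps: "set ps \<subseteq> {..<length (ctx ks)}"
    using pos_less assms(2) unfolding ps_def ctx_def by fastforce
  let ?Y = "{ys \<in> tuples (carr M) (ctx ks). map ((!) ys) ps \<in> X}"
  show "definable_over L M A (ctx ks) ?Y"
    by (rule definable_over_ren) (use assms(1) ctx ps in simp_all)
  show "val v ks \<in> ?Y \<longleftrightarrow> val v js \<in> X" if "env v" for v
  proof -
    have "length (v k) = length (fst k)" if "k \<in> set ks" for k
      using that assms(3) \<open>env v\<close> unfolding env_def by (blast dest: tuples_length)
    then have "map ((!) (val v ks)) ps = val v js" unfolding val_def by (rule val)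
    then show ?thesis using val_tuples[OF that assms(3)] by simp
  qed
qed

lemma dpred_I:
  "set ks \<subseteq> vars \<Longrightarrow> definable_over L M A (ctx ks) X \<Longrightarrow>
    (\<And>v. env v \<Longrightarrow> P v \<longleftrightarrow> val v ks \<in> X) \<Longrightarrow> dpred A P"
  by (auto simp: dpred_def)

lemma dpred_E:
  assumes "dpred A P"
  obtains js X where "set js \<subseteq> vars" "definable_over L M A (ctx js) X"
    "\<And>v. env v \<Longrightarrow> P v \<longleftrightarrow> val v js \<in> X"
  using assms by (auto simp: dpred_def)

lemma dpred_cong: "dpred A P \<Longrightarrow> (\<And>v. env v \<Longrightarrow> P v \<longleftrightarrow> Q v) \<Longrightarrow> dpred A Q"
  by (auto simp: dpred_def)

lemma dpred_neg:
  assumes "dpred A P" shows "dpred A (\<lambda>v. \<not> P v)"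
proof -
  obtain ks X where 1: "set ks \<subseteq> vars" "definable_over L M A (ctx ks) X"
    "\<And>v. env v \<Longrightarrow> P v \<longleftrightarrow> val v ks \<in> X" by (rule dpred_E[OF assms]) (rule that)
  show ?thesis
    by (rule dpred_I[OF 1(1) definable_over_compl[OF 1(2)]]) (use 1 val_tuples in auto)
qed

lemma dpred_conj:
  assumes "dpred A P" "dpred A Q" shows "dpred A (\<lambda>v. P v \<and> Q v)"
proof -
  obtain ks X where 1: "set ks \<subseteq> vars" "definable_over L M A (ctx ks) X"
    "\<And>v. env v \<Longrightarrow> P v \<longleftrightarrow> val v ks \<in> X" by (rule dpred_E[OF assms(1)]) (rule that)
  obtain js Y where 2: "set js \<subseteq> vars" "definable_over L M A (ctx js) Y"
    "\<And>v. env v \<Longrightarrow> Q v \<longleftrightarrow> val v js \<in> Y" by (rule dpred_E[OF assms(2)]) (rule that)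
  have kj: "set ks \<subseteq> set (ks @ js)" "set js \<subseteq> set (ks @ js)" "set (ks @ js) \<subseteq> vars"
    using 1(1) 2(1) by auto
  obtain X' where 3: "definable_over L M A (ctx (ks @ js)) X'"
    "\<And>v. env v \<Longrightarrow> val v (ks @ js) \<in> X' \<longleftrightarrow> val v ks \<in> X"
    by (rule definable_over_vars[OF 1(2) kj(1,3)]) (rule that)
  obtain Y' where 4: "definable_over L M A (ctx (ks @ js)) Y'"
    "\<And>v. env v \<Longrightarrow> val v (ks @ js) \<in> Y' \<longleftrightarrow> val v js \<in> Y"
    by (rule definable_over_vars[OF 2(2) kj(2,3)]) (rule that)
  show ?thesis
    by (rule dpred_I[OF _ definable_over_Int[OF 3(1) 4(1)]]) (use 1 2 3 4 in auto)
qed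

lemma dpred_True: "dpred A (\<lambda>v. True)"
  by (rule dpred_I[of "[]" A "{[]}"])
    (auto simp: val_ctx intro!: definable_overI[where \<phi> = "Neg Bot" and \<Theta> = "[]" and b = "[]"])

lemma dpred_const_prop: "dpred A (\<lambda>v. B)"
  using dpred_True dpred_neg[OF dpred_True] by (cases B) auto

lemma dpred_imp: "dpred A P \<Longrightarrow> dpred A Q \<Longrightarrow> dpred A (\<lambda>v. P v \<longrightarrow> Q v)"
  using dpred_neg[OF dpred_conj[OF _ dpred_neg]] by (rule dpred_cong) auto

lemma dpred_iff: "dpred A P \<Longrightarrow> dpred A Q \<Longrightarrow> dpred A (\<lambda>v. P v \<longleftrightarrow> Q v)"
  using dpred_conj[OF dpred_imp dpred_imp, of A P Q Q P] by (rule dpred_cong) auto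

lemma dpred_ball_finite:
  assumes "finite I" "\<And>i. i \<in> I \<Longrightarrow> dpred A (P i)"
  shows "dpred A (\<lambda>v. \<forall>i\<in>I. P i v)"
  using assms
proof (induction I)
  case empty
  then show ?case using dpred_True by simp
next
  case (insert i I)
  then show ?case using dpred_conj[of A "P i" "\<lambda>v. \<forall>i\<in>I. P i v"] by simp
qed

text \<open>Normal form for everything that binds a variable: (\<Gamma>, n) is brought to the front
  and removed from the rest, so that updating it leaves \<open>val v js\<close> alone.\<close>

lemma dpred_front:
  assumes "dpred A P" "\<Gamma> \<in> lists (sorts L)"
  obtains js Y where "set js \<subseteq> vars" "definable_over L M A (\<Gamma> @ ctx js) Y"
    "\<And>v x. env v \<Longrightarrow> x \<in> tuples (carr M) \<Gamma> \<Longrightarrow> P (v((\<Gamma>, n) := x)) \<longleftrightarrow> x @ val v js \<in> Y"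
proof -
  obtain ks X where 1: "set ks \<subseteq> vars" "definable_over L M A (ctx ks) X"
    "\<And>v. env v \<Longrightarrow> P v \<longleftrightarrow> val v ks \<in> X" by (rule dpred_E[OF assms(1)]) (rule that)
  define js where "js = filter (\<lambda>k. k \<noteq> (\<Gamma>, n)) ks"
  have "set ks \<subseteq> set ((\<Gamma>, n) # js)" "set ((\<Gamma>, n) # js) \<subseteq> vars"
    using 1(1) assms(2) by (auto simp: js_def)
  then obtain Y where 2: "definable_over L M A (ctx ((\<Gamma>, n) # js)) Y"
    "\<And>v. env v \<Longrightarrow> val v ((\<Gamma>, n) # js) \<in> Y \<longleftrightarrow> val v ks \<in> X"
    by (rule definable_over_vars[OF 1(2)]) (rule that)
  show thesis
  proof
    show "set js \<subseteq> vars" using 1(1) by (auto simp: js_def)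
    show "definable_over L M A (\<Gamma> @ ctx js) Y" using 2(1) by (simp add: val_ctx)
    show "P (v((\<Gamma>, n) := x)) \<longleftrightarrow> x @ val v js \<in> Y" if "env v" "x \<in> tuples (carr M) \<Gamma>" for v x
    proof -
      have "val (v((\<Gamma>, n) := x)) ((\<Gamma>, n) # js) = x @ val v js"
        by (simp add: val_ctx val_upd js_def)
      then show ?thesis using 2(2)[OF env_upd[OF that, of n]] 1(3)[OF env_upd[OF that, of n]] by simp
    qed
  qed
qed

lemma dpred_ex:
  assumes "dpred A P" "\<Gamma> \<in> lists (sorts L)"
  shows "dpred A (\<lambda>v. \<exists>x\<in>tuples (carr M) \<Gamma>. P (v((\<Gamma>, n) := x)))"
proof -
  obtain js Y where 1: "set js \<subseteq> vars" "definable_over L M A (\<Gamma> @ ctx js) Y"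
    "\<And>v x. env v \<Longrightarrow> x \<in> tuples (carr M) \<Gamma> \<Longrightarrow> P (v((\<Gamma>, n) := x)) \<longleftrightarrow> x @ val v js \<in> Y"
    by (rule dpred_front[OF assms]) (rule that)
  show ?thesis
    by (rule dpred_I[OF 1(1) definable_over_Ex[OF 1(2) assms(2)]]) (use 1 val_tuples in auto)
qed

lemma dpred_all:
  assumes "dpred A P" "\<Gamma> \<in> lists (sorts L)"
  shows "dpred A (\<lambda>v. \<forall>x\<in>tuples (carr M) \<Gamma>. P (v((\<Gamma>, n) := x)))"
  using dpred_neg[OF dpred_ex[OF dpred_neg[OF assms(1)] assms(2)]] by (rule dpred_cong) auto

lemma definable_over_swap:
  assumes "definable_over L M A (\<Gamma> @ \<Delta>) X"
  obtains Y where "definable_over L M A (\<Delta> @ \<Gamma>) Y"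
    "\<And>x y. x \<in> tuples (carr M) \<Gamma> \<Longrightarrow> y \<in> tuples (carr M) \<Delta> \<Longrightarrow> y @ x \<in> Y \<longleftrightarrow> x @ y \<in> X"
proof
  define ps where "ps = [length \<Delta>..<length \<Delta> + length \<Gamma>] @ [0..<length \<Delta>]"
  have ps: "map ((!) (y @ x)) ps = x @ y"
    if "length x = length \<Gamma>" "length y = length \<Delta>" for x y :: "'x list"
    using that by (intro nth_equalityI) (auto simp: ps_def nth_append)
  let ?Y = "{ys \<in> tuples (carr M) (\<Delta> @ \<Gamma>). map ((!) ys) ps \<in> X}"
  show "definable_over L M A (\<Delta> @ \<Gamma>) ?Y"
    by (rule definable_over_ren) (use assms ps[of \<Gamma> \<Delta>] in \<open>auto simp: ps_def\<close>)
  show "y @ x \<in> ?Y \<longleftrightarrow> x @ y \<in> X" if "x \<in> tuples (carr M) \<Gamma>" "y \<in> tuples (carr M) \<Delta>" for x y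
    using that ps[of x y] by (auto intro: tuples_appendI simp: that[THEN tuples_length])
qed

lemma dpred_const:
  assumes "dpred A P" "\<Gamma> \<in> lists (sorts L)" "c \<in> tuples A \<Gamma>" "c \<in> tuples (carr M) \<Gamma>"
  shows "dpred A (\<lambda>v. P (v((\<Gamma>, n) := c)))"
proof -
  obtain js Y where 1: "set js \<subseteq> vars" "definable_over L M A (\<Gamma> @ ctx js) Y"
    "\<And>v x. env v \<Longrightarrow> x \<in> tuples (carr M) \<Gamma> \<Longrightarrow> P (v((\<Gamma>, n) := x)) \<longleftrightarrow> x @ val v js \<in> Y"
    by (rule dpred_front[OF assms(1,2)]) (rule that)
  obtain Z where 2: "definable_over L M A (ctx js @ \<Gamma>) Z"
    "\<And>x y. x \<in> tuples (carr M) \<Gamma> \<Longrightarrow> y \<in> tuples (carr M) (ctx js) \<Longrightarrow> y @ x \<in> Z \<longleftrightarrow> x @ y \<in> Y"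
    by (rule definable_over_swap[OF 1(2)]) (rule that)
  show ?thesis
    by (rule dpred_I[OF 1(1) definable_over_const[OF 2(1) assms(3,4,2)]])
      (use 1 2(2)[OF assms(4)] assms(4) val_tuples in auto)
qed

lemma dpred_atom:
  assumes "definable_over L M A (concat (map fst ks)) X" "set ks \<subseteq> vars"
  shows "dpred A (\<lambda>v. concat (map v ks) \<in> X)"
  using assms by (intro dpred_I[of ks A X]) (auto simp: ctx_def val_def)

lemma dpred_atom1:
  "definable_over L M A \<Gamma> X \<Longrightarrow> \<Gamma> \<in> lists (sorts L) \<Longrightarrow> dpred A (\<lambda>v. v (\<Gamma>, i) \<in> X)"
  using dpred_atom[of A "[(\<Gamma>, i)]" X] by simp

lemma dpred_atom2:
  "definable_over L M A (\<Gamma> @ \<Delta>) X \<Longrightarrow> \<Gamma> \<in> lists (sorts L) \<Longrightarrow> \<Delta> \<in> lists (sorts L) \<Longrightarrow>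
    dpred A (\<lambda>v. v (\<Gamma>, i) @ v (\<Delta>, j) \<in> X)"
  using dpred_atom[of A "[(\<Gamma>, i), (\<Delta>, j)]" X] by simp

text \<open>The way back from predicates to sets. A description of P may involve variables outside
  \<open>ks\<close> although its truth does not depend on them; they are quantified away, which
  changes nothing because every sort is nonempty, and brings in no parameters.\<close>

lemma dpred_extract:
  assumes "dpred A P" "distinct ks" "set ks \<subseteq> vars" "X \<subseteq> tuples (carr M) (ctx ks)"
    "\<And>v. env v \<Longrightarrow> P v \<longleftrightarrow> val v ks \<in> X"
  shows "definable_over L M A (ctx ks) X"
proof -
  obtain ks' X' where 1: "set ks' \<subseteq> vars" "definable_over L M A (ctx ks') X'"
    "\<And>v. env v \<Longrightarrow> P v \<longleftrightarrow> val v ks' \<in> X'" by (rule dpred_E[OF assms(1)]) (rule that)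
  define js where "js = remdups (filter (\<lambda>k. k \<notin> set ks) ks')"
  have js: "set js \<subseteq> vars" "distinct (js @ ks)" using 1(1) assms(2) by (auto simp: js_def)
  have "set ks' \<subseteq> set (js @ ks)" "set (js @ ks) \<subseteq> vars"
    using js assms(3) by (auto simp: js_def)
  then obtain Y where Y: "definable_over L M A (ctx (js @ ks)) Y"
    and 2: "\<And>v. env v \<Longrightarrow> val v (js @ ks) \<in> Y \<longleftrightarrow> val v ks' \<in> X'"
    by (rule definable_over_vars[OF 1(2)]) (rule that)
  have "X = {z \<in> tuples (carr M) (ctx ks). \<exists>y\<in>tuples (carr M) (ctx js). y @ z \<in> Y}"
  proof (intro equalityI subsetI CollectI conjI)
    fix z assume z: "z \<in> X"
    then show "z \<in> tuples (carr M) (ctx ks)" using assms(4) by auto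
    then obtain v where "env v" "val v ks = z" using val_surj[OF assms(2)] by auto
    then show "\<exists>y\<in>tuples (carr M) (ctx js). y @ z \<in> Y"
      using z 1(3) 2 assms(5) val_tuples[OF _ js(1)] by (auto simp: val_ctx intro!: bexI[of _ "val v js"])
  next
    fix z assume "z \<in> {z \<in> tuples (carr M) (ctx ks). \<exists>y\<in>tuples (carr M) (ctx js). y @ z \<in> Y}"
    then obtain y where y: "z \<in> tuples (carr M) (ctx ks)" "y \<in> tuples (carr M) (ctx js)" "y @ z \<in> Y"
      by auto
    then obtain v where v: "env v" "val v (js @ ks) = y @ z"
      using val_surj[OF js(2), of "y @ z"] by (auto simp: val_ctx intro: tuples_appendI)
    then have "val v ks = z"
      using tuples_append_eq_iff[OF val_tuples[OF v(1) js(1)] y(2)] by (simp add: val_ctx)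
    then show "z \<in> X" using v y(3) 2[OF v(1)] 1(3)[OF v(1)] assms(5)[OF v(1)] by simp
  qed
  then show ?thesis using definable_over_Ex[OF Y[unfolded ctx_append] ctx_sorts[OF js(1)]] by simp
qed

lemma dpred_extract1:
  assumes "dpred A (\<lambda>v. P (v (\<Gamma>, i)))" "\<Gamma> \<in> lists (sorts L)"
  shows "definable_over L M A \<Gamma> {x \<in> tuples (carr M) \<Gamma>. P x}"
  using dpred_extract[OF assms(1), of "[(\<Gamma>, i)]" "{x \<in> tuples (carr M) \<Gamma>. P x}"] assms(2)
  by (auto simp: val_ctx envD)

lemma dpred_extract2:
  assumes "dpred A (\<lambda>v. P (v (\<Gamma>, i)) (v (\<Delta>, j)))" "i \<noteq> j" "\<Gamma> \<in> lists (sorts L)" "\<Delta> \<in> lists (sorts L)"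
  shows "definable_over L M A (\<Gamma> @ \<Delta>)
    {x @ y | x y. x \<in> tuples (carr M) \<Gamma> \<and> y \<in> tuples (carr M) \<Delta> \<and> P x y}"
proof -
  have "definable_over L M A (ctx [(\<Gamma>, i), (\<Delta>, j)])
    {x @ y | x y. x \<in> tuples (carr M) \<Gamma> \<and> y \<in> tuples (carr M) \<Delta> \<and> P x y}"
  proof (rule dpred_extract[OF assms(1)])
    fix v assume "env v"
    then have v: "v (\<Gamma>, i) \<in> tuples (carr M) \<Gamma>" "v (\<Delta>, j) \<in> tuples (carr M) \<Delta>"
      using assms(3,4) by (auto intro: envD)
    show "P (v (\<Gamma>, i)) (v (\<Delta>, j)) \<longleftrightarrow> val v [(\<Gamma>, i), (\<Delta>, j)] \<in>
       {x @ y | x y. x \<in> tuples (carr M) \<Gamma> \<and> y \<in> tuples (carr M) \<Delta> \<and> P x y}"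
      using v by (auto simp: val_ctx tuples_append_eq_iff[OF v(1)])
  qed (use assms in \<open>auto simp: val_ctx intro: tuples_appendI\<close>)
  then show ?thesis by (simp add: val_ctx)
qed

text \<open>In contrast to \<open>definable_type\<close>, X may have parameters and no base is
  recorded, so that integration over U can be nested freely with the other operations on
  predicates.\<close>

definition definable_filter :: "'s list \<Rightarrow> 'a list filter \<Rightarrow> bool" where
  "definable_filter \<Gamma> U \<longleftrightarrow> (\<forall>\<Delta>\<in>lists (sorts L). \<forall>X. definable L M (\<Gamma> @ \<Delta>) X \<longrightarrow>
     definable L M \<Delta> {b \<in> tuples (carr M) \<Delta>. \<forall>\<^sub>F x in U. x @ b \<in> X})"

text \<open>A definable type is a quantifier that can be eliminated: "for generic x" preserves
  definability just as \<open>dpred_ex\<close> and \<open>dpred_all\<close> do.\<close>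

lemma dpred_eventually:
  assumes "dpred (carr M) P" "\<Gamma> \<in> lists (sorts L)" "definable_filter \<Gamma> U"
    "\<forall>\<^sub>F x in U. x \<in> tuples (carr M) \<Gamma>"
  shows "dpred (carr M) (\<lambda>v. \<forall>\<^sub>F x in U. P (v((\<Gamma>, n) := x)))"
proof -
  obtain js Y where 1: "set js \<subseteq> vars" "definable L M (\<Gamma> @ ctx js) Y"
    "\<And>v x. env v \<Longrightarrow> x \<in> tuples (carr M) \<Gamma> \<Longrightarrow> P (v((\<Gamma>, n) := x)) \<longleftrightarrow> x @ val v js \<in> Y"
    by (rule dpred_front[OF assms(1,2)]) (rule that)
  have "definable L M (ctx js) {b \<in> tuples (carr M) (ctx js). \<forall>\<^sub>F x in U. x @ b \<in> Y}"
    using assms(3) 1(2) ctx_sorts[OF 1(1)] by (auto simp: definable_filter_def)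
  then show ?thesis
  proof (rule dpred_I[OF 1(1)])
    fix v assume v: "env v"
    have "(\<forall>\<^sub>F x in U. P (v((\<Gamma>, n) := x))) \<longleftrightarrow> (\<forall>\<^sub>F x in U. x @ val v js \<in> Y)"
      by (rule eventually_cong[OF assms(4)]) (use 1(3) v in auto)
    then show "(\<forall>\<^sub>F x in U. P (v((\<Gamma>, n) := x))) \<longleftrightarrow>
        val v js \<in> {b \<in> tuples (carr M) (ctx js). \<forall>\<^sub>F x in U. x @ b \<in> Y}"
      using val_tuples[OF v 1(1)] by simp
  qed
qed

end

section \<open>Ultrafilters\<close>

definition ultra :: "'a filter \<Rightarrow> bool" where
  "ultra U \<longleftrightarrow> U \<noteq> bot \<and> (\<forall>P. eventually P U \<or> eventually (\<lambda>x. \<not> P x) U)"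

lemma ultra_not_bot: "ultra U \<Longrightarrow> U \<noteq> bot"
  by (simp add: ultra_def)

lemma ultra_not_iff:
  assumes "ultra U" shows "(\<not> eventually P U) \<longleftrightarrow> eventually (\<lambda>x. \<not> P x) U"
proof -
  have "\<not> (eventually P U \<and> eventually (\<lambda>x. \<not> P x) U)"
    using ultra_not_bot[OF assms] by (simp flip: eventually_conj_iff add: trivial_limit_def)
  then show ?thesis using assms by (auto simp: ultra_def)
qed

text \<open>Zorn's lemma for the reversed order: a minimal proper filter below F is an
  ultrafilter.\<close>

lemma ultra_exists:
  assumes "F \<noteq> bot"
  obtains U where "U \<le> F" "ultra U"
proof -
  define A where "A = {G. G \<noteq> bot \<and> G \<le> F}"
  have "\<exists>m\<in>A. \<forall>a\<in>A. a \<le> m \<longrightarrow> a = m"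
  proof (rule predicate_Zorn[where P = "\<lambda>G G'. G' \<le> G"])
    show "partial_order_on A (relation_of (\<lambda>G G'. G' \<le> G) A)"
      by (rule partial_order_on_relation_ofI) auto
    fix C assume C: "C \<in> Chains (relation_of (\<lambda>G G'. G' \<le> G) A)"
    then have CA: "C \<subseteq> A" by (auto simp: Chains_def relation_of_def)
    show "\<exists>u\<in>A. \<forall>a\<in>C. u \<le> a"
    proof (cases "C = {}")
      case True
      then show ?thesis using assms by (auto simp: A_def)
    next
      case False
      \<comment> \<open>Along a chain a property holds eventually for the infimum if and only if it
        does so for some member; hence the infimum is proper.\<close>
      have "eventually P (Inf C) \<longleftrightarrow> (\<exists>b\<in>C. eventually P b)" for P
      proof (rule eventually_Inf_base[OF False])
        fix F G assume "F \<in> C" "G \<in> C"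
        then have "F \<le> G \<or> G \<le> F" using C by (auto simp: Chains_def relation_of_def)
        then show "\<exists>x\<in>C. x \<le> inf F G" using \<open>F \<in> C\<close> \<open>G \<in> C\<close> by auto
      qed
      from this[of "\<lambda>_. False"] have "Inf C \<noteq> bot"
        using CA by (auto simp: A_def eventually_False)
      moreover have "Inf C \<le> F" using False CA by (auto simp: A_def intro: Inf_lower2)
      ultimately show ?thesis by (auto simp: A_def intro!: bexI[of _ "Inf C"] Inf_lower)
    qed
  qed
  then obtain U where "U \<in> A" and max: "\<And>G. G \<in> A \<Longrightarrow> G \<le> U \<Longrightarrow> G = U" by blast
  then have U: "U \<noteq> bot" "U \<le> F" by (auto simp: A_def)
  have "eventually (\<lambda>x. \<not> P x) U" if "\<not> eventually P U" for P
  proof -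
    \<comment> \<open>If P is not eventual, U can be cut down to the complement of P and stays
      proper; by minimality it was concentrated there already.\<close>
    have "inf U (principal {x. \<not> P x}) \<noteq> bot"
      using that by (simp add: trivial_limit_def eventually_inf_principal)
    then have "inf U (principal {x. \<not> P x}) = U"
      using max[of "inf U (principal {x. \<not> P x})"] U(2) by (simp add: A_def le_infI1)
    then have "U \<le> principal {x. \<not> P x}" by (metis inf.cobounded2)
    then show ?thesis by (simp add: le_principal)
  qed
  then show thesis using that U by (auto simp: ultra_def)
qed

text \<open>The image under f of the product of W and V. In terms of types, x realizes W and y
  realizes V over x; the two limits do not commute in general, and the outer one belongs to
  W.\<close>

lemma ultra_bind:
  assumes "ultra W" "ultra V"
  obtains U where "ultra U" "\<And>P. eventually P U \<longleftrightarrow> (\<forall>\<^sub>F x in W. \<forall>\<^sub>F y in V. P (f x y))"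
proof -
  define U where "U = Abs_filter (\<lambda>P. \<forall>\<^sub>F x in W. \<forall>\<^sub>F y in V. P (f x y))"
  have ev: "eventually P U \<longleftrightarrow> (\<forall>\<^sub>F x in W. \<forall>\<^sub>F y in V. P (f x y))" for P
    unfolding U_def
  proof (rule eventually_Abs_filter, rule is_filter.intro)
    fix P Q
    assume PQ: "\<forall>x. P x \<longrightarrow> Q x" "\<forall>\<^sub>F x in W. \<forall>\<^sub>F y in V. P (f x y)"
    show "\<forall>\<^sub>F x in W. \<forall>\<^sub>F y in V. Q (f x y)"
      using PQ(2) by (rule eventually_mono) (use PQ(1) in \<open>auto elim: eventually_mono\<close>)
  qed (auto simp: eventually_conj_iff)
  have "ultra U"
    unfolding ultra_def trivial_limit_def ev
    using assms ultra_not_iff[OF assms(1)] ultra_not_iff[OF assms(2)]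
    by (auto simp: eventually_False ultra_not_bot)
  then show thesis using that ev by blast
qed

lemma card_image_less:
  assumes "finite A" "x \<in> A" "y \<in> A" "x \<noteq> y" "f x = f y"
  shows "card (f ` A) < card A"
  by (metis assms card_image_le inj_on_contraD inj_on_iff_eq_card le_neq_implies_less)


section \<open>Ultrafilters with finitely many definable translates\<close>

context fo_structure
begin

text \<open>
  The finiteness of the set of definition schemes of translates, one family \<open>X\<close> at a time, makes
  no mention of a small model; in a saturated structure it is equivalent to the definability
  of all translates over one small model.
\<close>

definition dfg_filter :: "'s list \<Rightarrow> 'a list monoid \<Rightarrow> 'a list filter \<Rightarrow> bool" where
  "dfg_filter \<Gamma> G U \<longleftrightarrow> ultra U \<and> (\<forall>\<^sub>F x in U. x \<in> carrier G) \<and> definable_filter \<Gamma> U \<and>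
     (\<forall>\<Delta>\<in>lists (sorts L). \<forall>X. definable L M (\<Gamma> @ \<Delta>) X \<longrightarrow>
        finite ((\<lambda>g. {b \<in> tuples (carr M) \<Delta>. \<forall>\<^sub>F x in U. (g \<otimes>\<^bsub>G\<^esub> x) @ b \<in> X}) ` carrier G))"

lemma definable_group_sorts: "definable_group L M \<Gamma> G \<Longrightarrow> \<Gamma> \<in> lists (sorts L)"
  and definable_group_group: "definable_group L M \<Gamma> G \<Longrightarrow> group G"
  and definable_group_carrier: "definable_group L M \<Gamma> G \<Longrightarrow> carrier G \<subseteq> tuples (carr M) \<Gamma>"
  using definable_over_subset by (auto simp: definable_group_def)

lemma dpred_carrier:
  "definable_group L M \<Gamma> G \<Longrightarrow> dpred (carr M) (\<lambda>v. v (\<Gamma>, i) \<in> carrier G)"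
  by (rule dpred_atom1) (auto simp: definable_group_def)

lemma dpred_mult:
  assumes "definable_group L M \<Gamma> G"
  shows "dpred (carr M) (\<lambda>v. v (\<Gamma>, i) \<in> carrier G \<and> v (\<Gamma>, j) \<in> carrier G \<and>
    v (\<Gamma>, k) = v (\<Gamma>, i) \<otimes>\<^bsub>G\<^esub> v (\<Gamma>, j))"
proof -
  let ?X = "{x @ y @ (x \<otimes>\<^bsub>G\<^esub> y) | x y. x \<in> carrier G \<and> y \<in> carrier G}"
  have "dpred (carr M) (\<lambda>v. concat (map v [(\<Gamma>, i), (\<Gamma>, j), (\<Gamma>, k)]) \<in> ?X)"
    by (rule dpred_atom) (use assms in \<open>auto simp: definable_group_def\<close>)
  then show ?thesis
  proof (rule dpred_cong)
    fix v assume v: "env v"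
    have "v (\<Gamma>, i) \<in> tuples (carr M) \<Gamma>" "v (\<Gamma>, j) \<in> tuples (carr M) \<Gamma>"
      using envD[OF v definable_group_sorts[OF assms]] by auto
    note len = this[THEN tuples_length] 
    have "length x = length \<Gamma>" if "x \<in> carrier G" for x
      using definable_group_carrier[OF assms] that by (auto dest: tuples_length)
    then show "concat (map v [(\<Gamma>, i), (\<Gamma>, j), (\<Gamma>, k)]) \<in> ?X \<longleftrightarrow>
       v (\<Gamma>, i) \<in> carrier G \<and> v (\<Gamma>, j) \<in> carrier G \<and> v (\<Gamma>, k) = v (\<Gamma>, i) \<otimes>\<^bsub>G\<^esub> v (\<Gamma>, j)"
      using len by (auto; blast)
  qed
qed

lemma dpred_map:
  assumes "definable_map L M \<Gamma> \<Delta> X f" "\<Gamma> \<in> lists (sorts L)" "\<Delta> \<in> lists (sorts L)"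
    "X \<subseteq> tuples (carr M) \<Gamma>"
  shows "dpred (carr M) (\<lambda>v. v (\<Gamma>, i) \<in> X \<and> v (\<Delta>, j) = f (v (\<Gamma>, i)))"
proof -
  have "dpred (carr M) (\<lambda>v. v (\<Gamma>, i) @ v (\<Delta>, j) \<in> {x @ f x | x. x \<in> X})"
    by (rule dpred_atom2) (use assms in \<open>auto simp: definable_map_def\<close>)
  then show ?thesis
  proof (rule dpred_cong)
    fix v assume v: "env v"
    have "length (v (\<Gamma>, i)) = length \<Gamma>"
      using envD[OF v assms(2)] by (rule tuples_length)
    moreover have "length x = length \<Gamma>" if "x \<in> X" for x
      using assms(4) that by (auto dest: tuples_length)
    ultimately show "v (\<Gamma>, i) @ v (\<Delta>, j) \<in> {x @ f x | x. x \<in> X} \<longleftrightarrow>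
        v (\<Gamma>, i) \<in> X \<and> v (\<Delta>, j) = f (v (\<Gamma>, i))"
      by auto
  qed
qed

text \<open>Under each translate, membership of v depends only on whether \<open>val v js\<close>
  lies in the scheme of one fixed family Y, so the finiteness carries over from families to
  predicates of valuations.\<close>

lemma dfg_filter_finite:
  assumes "dfg_filter \<Gamma> G U" "definable_group L M \<Gamma> G" "dpred (carr M) P"
  shows "finite ((\<lambda>g. {v. env v \<and> (\<forall>\<^sub>F x in U. P (v((\<Gamma>, n) := g \<otimes>\<^bsub>G\<^esub> x)))}) ` carrier G)"
proof -
  obtain js Y where 1: "set js \<subseteq> vars" "definable L M (\<Gamma> @ ctx js) Y"
    "\<And>v x. env v \<Longrightarrow> x \<in> tuples (carr M) \<Gamma> \<Longrightarrow> P (v((\<Gamma>, n) := x)) \<longleftrightarrow> x @ val v js \<in> Y"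
    by (rule dpred_front[OF assms(3) definable_group_sorts[OF assms(2)]]) (rule that)
  define F where "F g = {b \<in> tuples (carr M) (ctx js). \<forall>\<^sub>F x in U. (g \<otimes>\<^bsub>G\<^esub> x) @ b \<in> Y}" for g
  have fin: "finite (F ` carrier G)"
    using assms(1) 1(2) ctx_sorts[OF 1(1)] unfolding dfg_filter_def F_def by blast
  have "{v. env v \<and> (\<forall>\<^sub>F x in U. P (v((\<Gamma>, n) := g \<otimes>\<^bsub>G\<^esub> x)))} = {v. env v \<and> val v js \<in> F g}"
    if g: "g \<in> carrier G" for g
  proof -
    have "(\<forall>\<^sub>F x in U. P (v((\<Gamma>, n) := g \<otimes>\<^bsub>G\<^esub> x))) \<longleftrightarrow> val v js \<in> F g" if v: "env v" for v
    proof -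
      have "(\<forall>\<^sub>F x in U. P (v((\<Gamma>, n) := g \<otimes>\<^bsub>G\<^esub> x))) \<longleftrightarrow> (\<forall>\<^sub>F x in U. (g \<otimes>\<^bsub>G\<^esub> x) @ val v js \<in> Y)"
      proof (rule eventually_cong)
        show "\<forall>\<^sub>F x in U. x \<in> carrier G" using assms(1) by (simp add: dfg_filter_def)
        fix x assume "x \<in> carrier G"
        then have "g \<otimes>\<^bsub>G\<^esub> x \<in> tuples (carr M) \<Gamma>"
          using g definable_group_carrier[OF assms(2)] group.is_monoid[OF definable_group_group[OF assms(2)]]
          by (blast intro: monoid.m_closed)
        then show "P (v((\<Gamma>, n) := g \<otimes>\<^bsub>G\<^esub> x)) \<longleftrightarrow> (g \<otimes>\<^bsub>G\<^esub> x) @ val v js \<in> Y"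
          by (rule 1(3)[OF v])
      qed
      then show ?thesis using val_tuples[OF v 1(1)] by (simp add: F_def)
    qed
    then show ?thesis by auto
  qed
  then have "(\<lambda>g. {v. env v \<and> (\<forall>\<^sub>F x in U. P (v((\<Gamma>, n) := g \<otimes>\<^bsub>G\<^esub> x)))}) ` carrier G =
    (\<lambda>S. {v. env v \<and> val v js \<in> S}) ` F ` carrier G"
    by (simp add: image_image)
  then show ?thesis using fin by simp
qed

end


section \<open>Group extensions\<close>

text \<open>\<open>W_R\<close> says that \<pi> maps W to R. Beyond this, W is just an ultrafilter on
  G; definability and finiteness of schemes are available for V and R only.\<close>

locale dfg_extension = fo_structure L M
  for L :: "('s, 'f, 'r) lang" and M :: "('s, 'f, 'r, 'a) struc" +
  fixes \<Gamma>N \<Gamma>G \<Gamma>H :: "'s list" and N G H :: "'a list monoid" and \<iota> \<pi> :: "'a list \<Rightarrow> 'a list"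
    and V R W :: "'a list filter"
  assumes defN: "definable_group L M \<Gamma>N N"
    and defG: "definable_group L M \<Gamma>G G"
    and defH: "definable_group L M \<Gamma>H H"
    and def\<iota>: "definable_map L M \<Gamma>N \<Gamma>G (carrier N) \<iota>"
    and def\<pi>: "definable_map L M \<Gamma>G \<Gamma>H (carrier G) \<pi>"
    and \<iota>_hom: "\<iota> \<in> hom N G"
    and \<pi>_hom: "\<pi> \<in> hom G H"
    and \<pi>_surj: "\<pi> ` carrier G = carrier H"
    and ker: "kernel G H \<pi> = \<iota> ` carrier N"
    and V: "dfg_filter \<Gamma>N N V"
    and R: "dfg_filter \<Gamma>H H R"
    and W: "ultra W" "\<forall>\<^sub>F g in W. g \<in> carrier G"
    and W_R: "\<And>Q. \<forall>\<^sub>F h in R. Q h \<Longrightarrow> \<forall>\<^sub>F g in W. Q (\<pi> g)"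
begin

sublocale N: group N by (rule definable_group_group[OF defN])
sublocale G: group G by (rule definable_group_group[OF defG])
sublocale H: group H by (rule definable_group_group[OF defH])

lemmas sorts = definable_group_sorts[OF defN] definable_group_sorts[OF defG] definable_group_sorts[OF defH]
lemmas carriers = definable_group_carrier[OF defN, THEN subsetD]
  definable_group_carrier[OF defG, THEN subsetD] definable_group_carrier[OF defH, THEN subsetD]

lemma \<iota>_closed: "n \<in> carrier N \<Longrightarrow> \<iota> n \<in> carrier G"
  using \<iota>_hom by (auto simp: hom_def)

lemma \<pi>_closed: "g \<in> carrier G \<Longrightarrow> \<pi> g \<in> carrier H"
  using \<pi>_hom by (auto simp: hom_def)

lemma V_ev: "ultra V" "\<forall>\<^sub>F n in V. n \<in> carrier N" "\<forall>\<^sub>F n in V. n \<in> tuples (carr M) \<Gamma>N"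
  "definable_filter \<Gamma>N V"
  using V carriers(1) by (auto simp: dfg_filter_def elim: eventually_mono)

lemma R_ev: "ultra R" "\<forall>\<^sub>F h in R. h \<in> carrier H" "\<forall>\<^sub>F h in R. h \<in> tuples (carr M) \<Gamma>H"
  "definable_filter \<Gamma>H R"
  using R carriers(3) by (auto simp: dfg_filter_def elim: eventually_mono)

text \<open>The image of W under \<pi> contains the ultrafilter R and is proper, hence equals
  R.\<close>

lemma R_W: "\<forall>\<^sub>F g in W. Q (\<pi> g) \<Longrightarrow> \<forall>\<^sub>F h in R. Q h"
  using W_R[of "\<lambda>h. \<not> Q h"] ultra_not_iff[OF R_ev(1)] ultra_not_iff[OF W(1)] by metis

lemma fibre_coset:
  assumes "g \<in> carrier G" "g0 \<in> carrier G" "\<pi> g = \<pi> g0"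
  obtains n where "n \<in> carrier N" "g = g0 \<otimes>\<^bsub>G\<^esub> \<iota> n"
proof -
  interpret \<pi>: group_hom G H \<pi>
    using \<pi>_hom by (simp add: group_hom_def group_hom_axioms_def G.is_group H.is_group)
  have "inv\<^bsub>G\<^esub> g0 \<otimes>\<^bsub>G\<^esub> g \<in> kernel G H \<pi>"
    using assms by (simp add: kernel_def)
  then obtain n where n: "n \<in> carrier N" "inv\<^bsub>G\<^esub> g0 \<otimes>\<^bsub>G\<^esub> g = \<iota> n" using ker by auto
  then have "g = g0 \<otimes>\<^bsub>G\<^esub> \<iota> n"
    using assms by (metis G.inv_solve_left' G.m_closed \<iota>_closed)
  then show thesis using that n by blast
qed

text \<open>Variable numbers in the extension argument: 0 is an element g of G, 1 a product in G, 2
  an element of N, 3 an element of H, 4 a parameter from \<Delta>, and 9 an auxiliary value of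
  \<iota>. They are kept different because the lists of sorts may coincide.\<close>

lemma dpred_coset_mult:
  "dpred (carr M) (\<lambda>v. v (\<Gamma>G, 0) \<in> carrier G \<and> v (\<Gamma>N, 2) \<in> carrier N \<and>
     v (\<Gamma>G, 1) = v (\<Gamma>G, 0) \<otimes>\<^bsub>G\<^esub> \<iota> (v (\<Gamma>N, 2)))"
proof -
  have "dpred (carr M) (\<lambda>v. (v (\<Gamma>N, 2) \<in> carrier N \<and> v (\<Gamma>G, 9) = \<iota> (v (\<Gamma>N, 2))) \<and>
    v (\<Gamma>G, 0) \<in> carrier G \<and> v (\<Gamma>G, 9) \<in> carrier G \<and> v (\<Gamma>G, 1) = v (\<Gamma>G, 0) \<otimes>\<^bsub>G\<^esub> v (\<Gamma>G, 9))"
    by (intro dpred_conj[OF dpred_map[OF def\<iota>] dpred_mult[OF defG]] sorts definable_group_carrier[OF defN])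
  from dpred_ex[OF this sorts(2), of 9] show ?thesis
    by (rule dpred_cong) (use \<iota>_closed carriers(2) in auto)
qed

end

section \<open>A single definable family on the extension\<close>

locale dfg_extension_family = dfg_extension L M \<Gamma>N \<Gamma>G \<Gamma>H N G H \<iota> \<pi> V R W
  for L :: "('s, 'f, 'r) lang" and M :: "('s, 'f, 'r, 'a) struc" and \<Gamma>N \<Gamma>G \<Gamma>H N G H \<iota> \<pi> V R W +
  fixes \<Delta> :: "'s list" and X :: "'a list set"
  assumes \<Delta>: "\<Delta> \<in> lists (sorts L)" and X: "definable L M (\<Gamma>G @ \<Delta>) X"
begin

text \<open>
  Write \<open>X(g, b)\<close> for the given family.  A realization of the type on \<open>G\<close> is a product \<open>g n\<close> with
  \<open>g\<close> generic for \<open>W\<close> and \<open>n\<close> generic for \<open>V\<close> over \<open>g\<close>, and \<open>Y\<close> is the relation obtained from \<open>X\<close> by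
  integrating out \<open>n\<close>.
\<close>

definition Y :: "'a list \<Rightarrow> 'a list \<Rightarrow> bool" where
  "Y g b \<longleftrightarrow> g \<in> carrier G \<and> (\<forall>\<^sub>F n in V. (g \<otimes>\<^bsub>G\<^esub> \<iota> n) @ b \<in> X)"

definition Yset :: "'a list \<Rightarrow> 'a list set" where
  "Yset g = {b \<in> tuples (carr M) \<Delta>. Y g b}"

definition fibre :: "'a list \<Rightarrow> 'a list set" where
  "fibre h = {g \<in> carrier G. \<pi> g = h}"

text \<open>The integrand of \<open>Y\<close> as a predicate of g, n and b. The product is bound as
  z because multiplication is available only through its graph.\<close>

definition coset_fm :: "('s list \<times> nat \<Rightarrow> 'a list) \<Rightarrow> bool" where
  "coset_fm v \<longleftrightarrow> (\<exists>z\<in>tuples (carr M) \<Gamma>G. (v (\<Gamma>G, 0) \<in> carrier G \<and> v (\<Gamma>N, 2) \<in> carrier N \<and>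
     z = v (\<Gamma>G, 0) \<otimes>\<^bsub>G\<^esub> \<iota> (v (\<Gamma>N, 2))) \<and> z @ v (\<Delta>, 4) \<in> X)"

lemma dpred_coset_fm: "dpred (carr M) coset_fm"
  using dpred_ex[OF dpred_conj[OF dpred_coset_mult dpred_atom2[OF X sorts(2) \<Delta>, of 1 4]] sorts(2), of 1]
  by (rule dpred_cong) (simp add: coset_fm_def)

lemma coset_fm_iff:
  assumes "v (\<Gamma>G, 0) \<in> carrier G" "n \<in> carrier N"
  shows "coset_fm (v((\<Gamma>N, 2) := n)) \<longleftrightarrow> (v (\<Gamma>G, 0) \<otimes>\<^bsub>G\<^esub> \<iota> n) @ v (\<Delta>, 4) \<in> X"
  using assms carriers(2)[OF G.m_closed[OF assms(1) \<iota>_closed[OF assms(2)]]] by (auto simp: coset_fm_def)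

lemma dpred_Y: "dpred (carr M) (\<lambda>v. Y (v (\<Gamma>G, i)) (v (\<Delta>, j)))"
proof -
  have "dpred (carr M) (\<lambda>v. v (\<Gamma>G, 0) \<in> carrier G \<and> (\<forall>\<^sub>F n in V. coset_fm (v((\<Gamma>N, 2) := n))))"
    by (intro dpred_conj dpred_carrier[OF defG] dpred_eventually[OF dpred_coset_fm sorts(1) V_ev(4,3)])
  then have "dpred (carr M) (\<lambda>v. Y (v (\<Gamma>G, 0)) (v (\<Delta>, 4)))"
  proof (rule dpred_cong)
    fix v
    have "(\<forall>\<^sub>F n in V. coset_fm (v((\<Gamma>N, 2) := n))) \<longleftrightarrow>
        (\<forall>\<^sub>F n in V. (v (\<Gamma>G, 0) \<otimes>\<^bsub>G\<^esub> \<iota> n) @ v (\<Delta>, 4) \<in> X)" if "v (\<Gamma>G, 0) \<in> carrier G"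
      by (rule eventually_cong[OF V_ev(2)]) (rule coset_fm_iff[of v, OF that])
    then show "(v (\<Gamma>G, 0) \<in> carrier G \<and> (\<forall>\<^sub>F n in V. coset_fm (v((\<Gamma>N, 2) := n)))) \<longleftrightarrow>
        Y (v (\<Gamma>G, 0)) (v (\<Delta>, 4))"
      by (auto simp: Y_def)
  qed
  \<comment> \<open>From the numbers 0 and 4 to arbitrary i and j, possibly equal: the definable set
    is extracted and inserted again with other variables.\<close>
  from dpred_atom2[OF dpred_extract2[OF this _ sorts(2) \<Delta>] sorts(2) \<Delta>, of i j] 
  have "dpred (carr M) (\<lambda>v. v (\<Gamma>G, i) @ v (\<Delta>, j) \<in>
      {x @ y |x y. x \<in> tuples (carr M) \<Gamma>G \<and> y \<in> tuples (carr M) \<Delta> \<and> Y x y})" by simp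
  then show ?thesis
  proof (rule dpred_cong)
    fix v assume v: "env v"
    note vt = envD[OF v sorts(2), of i] envD[OF v \<Delta>, of j]
    show "(v (\<Gamma>G, i) @ v (\<Delta>, j) \<in>
      {x @ y |x y. x \<in> tuples (carr M) \<Gamma>G \<and> y \<in> tuples (carr M) \<Delta> \<and> Y x y}) \<longleftrightarrow>
      Y (v (\<Gamma>G, i)) (v (\<Delta>, j))"
      using vt by (auto simp: tuples_append_eq_iff[OF vt(1)])
  qed
qed

lemma dpred_Y_const: "b \<in> tuples (carr M) \<Delta> \<Longrightarrow> dpred (carr M) (\<lambda>v. Y (v (\<Gamma>G, i)) b)"
  using dpred_const[OF dpred_Y[of i "Suc i"] \<Delta>, of b "Suc i"] by simp

text \<open>
  Along a fibre \<open>g\<^sub>0 N\<close> of \<open>\<pi>\<close> the set \<open>Yset (g\<^sub>0 n)\<close> is determined by the translate of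
  \<open>V\<close> by \<open>n\<close>, restricted to a single formula.
\<close>

lemma fibre_bound:
  obtains k where "\<And>h. finite (Yset ` fibre h)" "\<And>h. card (Yset ` fibre h) \<le> k"
proof -
  \<comment> \<open>The base point of the fibre is still a variable of \<open>coset_fm\<close> here
    (number 0), so one finite set of values of F serves all fibres.\<close>
  define F where "F n = {v. env v \<and> (\<forall>\<^sub>F x in V. coset_fm (v((\<Gamma>N, 2) := n \<otimes>\<^bsub>N\<^esub> x)))}" for n
  have fin: "finite (F ` carrier N)"
    unfolding F_def by (rule dfg_filter_finite[OF V defN dpred_coset_fm])
  obtain v0 where v0: "env v0" using env_exists by blast
  have "\<exists>f. Yset ` fibre h \<subseteq> f ` F ` carrier N" for h
  proof (cases "fibre h = {}")
    case False
    then obtain g0 where g0: "g0 \<in> carrier G" "\<pi> g0 = h" by (auto simp: fibre_def)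
    \<comment> \<open>The slice of S at the base point g0, as a set of parameters b.\<close>
    define f where "f S = {b \<in> tuples (carr M) \<Delta>. v0((\<Gamma>G, 0) := g0, (\<Delta>, 4) := b) \<in> S}" for S
    have "Yset (g0 \<otimes>\<^bsub>G\<^esub> \<iota> n) = f (F n)" if n: "n \<in> carrier N" for n
    proof -
      have "Y (g0 \<otimes>\<^bsub>G\<^esub> \<iota> n) b \<longleftrightarrow> v0((\<Gamma>G, 0) := g0, (\<Delta>, 4) := b) \<in> F n"
        if b: "b \<in> tuples (carr M) \<Delta>" for b
      proof -
        let ?v = "v0((\<Gamma>G, 0) := g0, (\<Delta>, 4) := b)"
        have "env ?v" using v0 b carriers(2)[OF g0(1)] by (intro env_upd)
        moreover have "(\<forall>\<^sub>F x in V. coset_fm (?v((\<Gamma>N, 2) := n \<otimes>\<^bsub>N\<^esub> x))) \<longleftrightarrow>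
          (\<forall>\<^sub>F x in V. (g0 \<otimes>\<^bsub>G\<^esub> \<iota> n \<otimes>\<^bsub>G\<^esub> \<iota> x) @ b \<in> X)"
        proof (rule eventually_cong[OF V_ev(2)])
          fix x assume x: "x \<in> carrier N"
          have "g0 \<otimes>\<^bsub>G\<^esub> \<iota> (n \<otimes>\<^bsub>N\<^esub> x) = g0 \<otimes>\<^bsub>G\<^esub> \<iota> n \<otimes>\<^bsub>G\<^esub> \<iota> x"
            using hom_mult[OF \<iota>_hom n x] g0(1) n x \<iota>_closed by (simp add: G.m_assoc)
          then show "coset_fm (?v((\<Gamma>N, 2) := n \<otimes>\<^bsub>N\<^esub> x)) \<longleftrightarrow> (g0 \<otimes>\<^bsub>G\<^esub> \<iota> n \<otimes>\<^bsub>G\<^esub> \<iota> x) @ b \<in> X"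
            using coset_fm_iff[of ?v "n \<otimes>\<^bsub>N\<^esub> x"] g0(1) n x by simp
        qed
        ultimately show ?thesis
          using g0(1) n \<iota>_closed by (simp add: F_def Y_def)
      qed
      then show ?thesis by (auto simp: Yset_def f_def)
    qed
    moreover have "\<exists>n\<in>carrier N. g = g0 \<otimes>\<^bsub>G\<^esub> \<iota> n" if "g \<in> fibre h" for g
      using that fibre_coset[of g g0] g0 by (auto simp: fibre_def)
    ultimately have "Yset ` fibre h \<subseteq> f ` F ` carrier N" by force
    then show ?thesis by blast
  qed auto
  then obtain f where f: "\<And>h. Yset ` fibre h \<subseteq> f h ` F ` carrier N" by metis
  show thesis
  proof
    show "finite (Yset ` fibre h)" for h using f fin by (meson finite_imageI finite_subset)
    show "card (Yset ` fibre h) \<le> card (F ` carrier N)" for h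
      using f fin by (meson card_image_le card_mono finite_imageI le_trans)
  qed
qed

text \<open>A finite form of algebraicity: on almost every fibre the trace on B decides
  \<open>Y g b\<close>. The set of good fibres may depend on b, so no uniformity in b is
  claimed.\<close>

definition separates :: "'a list set \<Rightarrow> bool" where
  "separates B \<longleftrightarrow> (\<forall>b\<in>tuples (carr M) \<Delta>. \<forall>\<^sub>F h in R. \<forall>g1\<in>fibre h. \<forall>g2\<in>fibre h.
     (\<forall>b'\<in>B. Y g1 b' \<longleftrightarrow> Y g2 b') \<longrightarrow> (Y g1 b \<longleftrightarrow> Y g2 b))"

text \<open>
  Each failure of separation adds a trace in almost every fibre, and the number of traces
  is bounded.
\<close>

lemma separates_exists:
  obtains B where "finite B" "B \<subseteq> tuples (carr M) \<Delta>" "separates B"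
proof (rule ccontr)
  assume "\<not> thesis"
  with that have non: "\<not> separates B" if "finite B" "B \<subseteq> tuples (carr M) \<Delta>" for B
    using that by blast
  obtain k where k: "\<And>h. finite (Yset ` fibre h)" "\<And>h. card (Yset ` fibre h) \<le> k"
    by (rule fibre_bound) (rule that)
  have trace: "(\<lambda>g. Yset g \<inter> B) ` fibre h = (\<lambda>S. S \<inter> B) ` Yset ` fibre h" for B h
    by auto
  have "\<exists>B. finite B \<and> B \<subseteq> tuples (carr M) \<Delta> \<and>
      (\<forall>\<^sub>F h in R. r < card ((\<lambda>g. Yset g \<inter> B) ` fibre h))" for r
  proof (induction r)
    case 0
    have "\<forall>\<^sub>F h in R. 0 < card ((\<lambda>g. Yset g \<inter> {}) ` fibre h)"
      using R_ev(2)
    proof (rule eventually_mono)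
      fix h assume "h \<in> carrier H"
      then have "h \<in> \<pi> ` carrier G" using \<pi>_surj by simp
      then have "fibre h \<noteq> {}" by (auto simp: fibre_def)
      then show "0 < card ((\<lambda>g. Yset g \<inter> {}) ` fibre h)" by (simp add: image_constant_conv)
    qed
    then show ?case by blast
  next
    case (Suc r)
    then obtain B where B: "finite B" "B \<subseteq> tuples (carr M) \<Delta>"
      "\<forall>\<^sub>F h in R. r < card ((\<lambda>g. Yset g \<inter> B) ` fibre h)" by blast
    then obtain b where b: "b \<in> tuples (carr M) \<Delta>"
      "\<not> (\<forall>\<^sub>F h in R. \<forall>g1\<in>fibre h. \<forall>g2\<in>fibre h.
         (\<forall>b'\<in>B. Y g1 b' \<longleftrightarrow> Y g2 b') \<longrightarrow> (Y g1 b \<longleftrightarrow> Y g2 b))"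
      using non[OF B(1,2)] unfolding separates_def by blast
    \<comment> \<open>As R is an ultrafilter, the failure for b occurs on almost every fibre: two of
      its points have the same trace on B but disagree at b.\<close>
    have "\<forall>\<^sub>F h in R. Suc r < card ((\<lambda>g. Yset g \<inter> insert b B) ` fibre h)"
      using B(3) b(2)[unfolded ultra_not_iff[OF R_ev(1)]]
    proof eventually_elim
      fix h
      assume r: "r < card ((\<lambda>g. Yset g \<inter> B) ` fibre h)"
        and "\<not> (\<forall>g1\<in>fibre h. \<forall>g2\<in>fibre h.
         (\<forall>b'\<in>B. Y g1 b' \<longleftrightarrow> Y g2 b') \<longrightarrow> (Y g1 b \<longleftrightarrow> Y g2 b))"
      then obtain g1 g2 where g: "g1 \<in> fibre h" "g2 \<in> fibre h"
        "\<forall>b'\<in>B. Y g1 b' \<longleftrightarrow> Y g2 b'" "\<not> (Y g1 b \<longleftrightarrow> Y g2 b)" by blast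
      \<comment> \<open>Forgetting b maps the traces on \<open>insert b B\<close> onto those on B
        and identifies two different ones.\<close>
      have "card ((\<lambda>S. S \<inter> B) ` (\<lambda>g. Yset g \<inter> insert b B) ` fibre h)
          < card ((\<lambda>g. Yset g \<inter> insert b B) ` fibre h)"
      proof (rule card_image_less[of _ "Yset g1 \<inter> insert b B" "Yset g2 \<inter> insert b B"])
        show "finite ((\<lambda>g. Yset g \<inter> insert b B) ` fibre h)"
          unfolding trace using k(1) by simp
      qed (use g b(1) in \<open>auto simp: Yset_def\<close>)
      moreover have "(\<lambda>S. S \<inter> B) ` (\<lambda>g. Yset g \<inter> insert b B) ` fibre h = (\<lambda>g. Yset g \<inter> B) ` fibre h"
        unfolding image_image by (rule image_cong) auto
      ultimately show "Suc r < card ((\<lambda>g. Yset g \<inter> insert b B) ` fibre h)" using r by simp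
    qed
    then show ?case using B(1,2) b(1) by (intro exI[of _ "insert b B"]) simp
  qed
  from this[of k] obtain B where "\<forall>\<^sub>F h in R. k < card ((\<lambda>g. Yset g \<inter> B) ` fibre h)" by blast
  then obtain h where h: "k < card ((\<lambda>g. Yset g \<inter> B) ` fibre h)"
    using eventually_happens'[OF ultra_not_bot[OF R_ev(1)]] by blast
  have "card ((\<lambda>g. Yset g \<inter> B) ` fibre h) \<le> card (Yset ` fibre h)"
    unfolding trace using k(1) by (rule card_image_le)
  then show False using h k(2)[of h] by simp
qed

text \<open>Let e be the W-generic trace on the finite separating set B. In a generic fibre all
  points with trace e agree at b, so W can be replaced by a quantifier over these points, and what
  remains is an integral over the definable R.\<close>

lemma definable_Y: "definable L M \<Delta> {b \<in> tuples (carr M) \<Delta>. \<forall>\<^sub>F g in W. Y g b}"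
proof -
  obtain B where B: "finite B" "B \<subseteq> tuples (carr M) \<Delta>" "separates B"
    by (rule separates_exists) (rule that)
  define e where "e = {b \<in> B. \<forall>\<^sub>F g in W. Y g b}"
  have We: "\<forall>\<^sub>F g in W. \<forall>b\<in>B. Y g b \<longleftrightarrow> b \<in> e"
  proof (intro eventually_ball_finite B(1) ballI)
    fix b assume "b \<in> B"
    then show "\<forall>\<^sub>F g in W. Y g b \<longleftrightarrow> b \<in> e"
      using ultra_not_iff[OF W(1), of "\<lambda>g. Y g b"] by (cases "b \<in> e") (auto simp: e_def)
  qed
  \<comment> \<open>The universal form makes the step from R to W immediate; the converse needs a
    point with trace e in the fibre, and separation.\<close>
  define Z where "Z b h \<longleftrightarrow> (\<forall>g\<in>tuples (carr M) \<Gamma>G. (g \<in> carrier G \<and> h = \<pi> g) \<longrightarrow>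
      (\<forall>b'\<in>B. Y g b' \<longleftrightarrow> b' \<in> e) \<longrightarrow> Y g b)" for b h
  have "dpred (carr M) (\<lambda>v. (v (\<Gamma>G, 0) \<in> carrier G \<and> v (\<Gamma>H, 3) = \<pi> (v (\<Gamma>G, 0))) \<longrightarrow>
      (\<forall>b'\<in>B. Y (v (\<Gamma>G, 0)) b' \<longleftrightarrow> b' \<in> e) \<longrightarrow> Y (v (\<Gamma>G, 0)) (v (\<Delta>, 4)))"
    using B(2) by (intro dpred_imp dpred_map[OF def\<pi>] dpred_ball_finite[OF B(1)] dpred_iff dpred_Y dpred_Y_const
      dpred_const_prop sorts definable_group_carrier[OF defG]) auto
  from dpred_all[OF this sorts(2), of 0]
  have "dpred (carr M) (\<lambda>v. Z (v (\<Delta>, 4)) (v (\<Gamma>H, 3)))"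
    by (rule dpred_cong) (simp add: Z_def)
  from dpred_eventually[OF this sorts(3) R_ev(4,3), of 3]
  have "definable L M \<Delta> {b \<in> tuples (carr M) \<Delta>. \<forall>\<^sub>F h in R. Z b h}"
    by (intro dpred_extract1[of _ _ _ 4] \<Delta>) simp
  moreover have "(\<forall>\<^sub>F h in R. Z b h) \<longleftrightarrow> (\<forall>\<^sub>F g in W. Y g b)" if b: "b \<in> tuples (carr M) \<Delta>" for b
  proof
    assume "\<forall>\<^sub>F h in R. Z b h"
    from W_R[OF this] show "\<forall>\<^sub>F g in W. Y g b"
      using W(2) We by eventually_elim (use carriers(2) in \<open>auto simp: Z_def\<close>)
  next
    assume Yb: "\<forall>\<^sub>F g in W. Y g b"
    \<comment> \<open>Stated for some point of the fibre rather than for g itself, so that it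
      depends on \<pi>(g) only and can be pushed down to R.\<close>
    have "\<forall>\<^sub>F g in W. \<exists>g'\<in>fibre (\<pi> g). (\<forall>b'\<in>B. Y g' b' \<longleftrightarrow> b' \<in> e) \<and> Y g' b"
      using W(2) We Yb
    proof eventually_elim
      fix g assume "g \<in> carrier G" "\<forall>b'\<in>B. Y g b' \<longleftrightarrow> b' \<in> e" "Y g b"
      then show "\<exists>g'\<in>fibre (\<pi> g). (\<forall>b'\<in>B. Y g' b' \<longleftrightarrow> b' \<in> e) \<and> Y g' b"
        by (intro bexI[of _ g] conjI) (simp_all add: fibre_def)
    qed
    from R_W[OF this] show "\<forall>\<^sub>F h in R. Z b h"
      using B(3)[unfolded separates_def, rule_format, OF b]
    proof eventually_elim
      fix h
      assume "\<exists>g\<in>fibre h. (\<forall>b'\<in>B. Y g b' \<longleftrightarrow> b' \<in> e) \<and> Y g b"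
        and sep: "\<forall>g1\<in>fibre h. \<forall>g2\<in>fibre h.
           (\<forall>b'\<in>B. Y g1 b' \<longleftrightarrow> Y g2 b') \<longrightarrow> (Y g1 b \<longleftrightarrow> Y g2 b)"
      then obtain g where g: "g \<in> fibre h" "\<forall>b'\<in>B. Y g b' \<longleftrightarrow> b' \<in> e" "Y g b" by blast
      show "Z b h"
        unfolding Z_def
      proof (intro ballI impI)
        fix g' assume "g' \<in> carrier G \<and> h = \<pi> g'" "\<forall>b'\<in>B. Y g' b' \<longleftrightarrow> b' \<in> e"
        then show "Y g' b" using sep[rule_format, of g g'] g by (simp add: fibre_def)
      qed
    qed
  qed
  ultimately show ?thesis by (simp cong: conj_cong)
qed

section \<open>Finiteness of the schemes of translates on the extension\<close>

definition W_scheme :: "'a list \<Rightarrow> 'a list set" where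
  "W_scheme g = {b \<in> tuples (carr M) \<Delta>. \<forall>\<^sub>F x in W. Y (g \<otimes>\<^bsub>G\<^esub> x) b}"

text \<open>Carries information on traces from W-generic points down to H, as it sees a point only
  through its fibre. The parameters remain variables because the schemes of R are counted uniformly
  in them; the offset 10 keeps clear of the numbers with a fixed meaning.\<close>

definition trace_fm :: "(nat \<times> nat) set \<Rightarrow> (nat \<times> nat) set \<Rightarrow> ('s list \<times> nat \<Rightarrow> 'a list) \<Rightarrow> bool" where
  "trace_fm I S v \<longleftrightarrow> (\<exists>g\<in>tuples (carr M) \<Gamma>G. (g \<in> carrier G \<and> v (\<Gamma>H, 3) = \<pi> g) \<and>
     (\<forall>ij\<in>I. Y g (v (\<Delta>, 10 + prod_encode ij)) \<longleftrightarrow> ij \<in> S))"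

lemma dpred_trace_fm:
  assumes "finite I" shows "dpred (carr M) (trace_fm I S)"
proof -
  have "dpred (carr M) (\<lambda>v. (v (\<Gamma>G, 0) \<in> carrier G \<and> v (\<Gamma>H, 3) = \<pi> (v (\<Gamma>G, 0))) \<and>
      (\<forall>ij\<in>I. Y (v (\<Gamma>G, 0)) (v (\<Delta>, 10 + prod_encode ij)) \<longleftrightarrow> ij \<in> S))"
    by (intro dpred_conj dpred_map[OF def\<pi>] dpred_ball_finite[OF assms] dpred_iff dpred_Y
      dpred_const_prop sorts definable_group_carrier[OF defG])
  from dpred_ex[OF this sorts(2), of 0] show ?thesis
    by (rule dpred_cong) (simp add: trace_fm_def)
qed

text \<open>
  Many translates \<open>W_scheme g\<close> with the same data on \<open>H\<close> would be distinguished by the traces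
  of one fibre on finitely many parameters.
\<close>

lemma finite_W_scheme: "finite (W_scheme ` carrier G)"
proof -
  obtain k where k: "\<And>h. finite (Yset ` fibre h)" "\<And>h. card (Yset ` fibre h) \<le> k"
    by (rule fibre_bound) (rule that)
  \<comment> \<open>k + 1 translates will be compared, with one parameter for each pair of them; k
    is the bound on the traces in a fibre.\<close>
  define I where "I = {..k} \<times> {..k}"
  have I: "finite I" by (simp add: I_def)
  define FH where "FH S h = {v. env v \<and> (\<forall>\<^sub>F x in R. trace_fm I S (v((\<Gamma>H, 3) := h \<otimes>\<^bsub>H\<^esub> x)))}" for S h
  have FH: "finite (FH S ` carrier H)" for S
    unfolding FH_def by (rule dfg_filter_finite[OF R defH dpred_trace_fm[OF I]])
  \<comment> \<open>The data on H: for each possible trace S, the scheme of R translated by \<pi>(g)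
    for \<open>trace_fm I S\<close>. Finitely many S and finitely many schemes for each leave
    finitely many values of \<Phi>.\<close>
  define \<Phi> where "\<Phi> g = restrict (\<lambda>S. FH S (\<pi> g)) (Pow I)" for g
  have "\<Phi> ` carrier G \<subseteq> (\<Pi>\<^sub>E S\<in>Pow I. FH S ` carrier H)"
    unfolding \<Phi>_def using \<pi>_closed by (intro image_subsetI) (simp add: restrict_PiE_iff)
  then have fin\<Phi>: "finite (\<Phi> ` carrier G)"
    by (rule finite_subset) (use I FH in \<open>auto intro!: finite_PiE\<close>)
  have "finite (W_scheme ` {g \<in> carrier G. \<Phi> g = \<Phi> g0})" if g0: "g0 \<in> carrier G" for g0
  proof (rule ccontr)
    assume "infinite (W_scheme ` {g \<in> carrier G. \<Phi> g = \<Phi> g0})"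
    then obtain T where T: "finite T" "card T = Suc k" "T \<subseteq> W_scheme ` {g \<in> carrier G. \<Phi> g = \<Phi> g0}"
      by (meson infinite_arbitrarily_large)
    obtain t where "bij_betw t {0..<card T} T" using ex_bij_betw_nat_finite[OF T(1)] by blast
    then have t: "bij_betw t {..k} T" by (simp add: T(2) atLeast0LessThan lessThan_Suc_atMost)
    have "\<forall>i\<in>{..k}. \<exists>g. g \<in> carrier G \<and> \<Phi> g = \<Phi> g0 \<and> W_scheme g = t i"
    proof
      fix i assume "i \<in> {..k}"
      then have "t i \<in> W_scheme ` {g \<in> carrier G. \<Phi> g = \<Phi> g0}"
        using T(3) t by (auto dest: bij_betwE)
      then obtain g where "g \<in> {g \<in> carrier G. \<Phi> g = \<Phi> g0}" "t i = W_scheme g" by (rule imageE)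
      then show "\<exists>g. g \<in> carrier G \<and> \<Phi> g = \<Phi> g0 \<and> W_scheme g = t i" by auto
    qed
    from bchoice[OF this]
    obtain a where a: "\<And>i. i \<le> k \<Longrightarrow> a i \<in> carrier G \<and> \<Phi> (a i) = \<Phi> g0 \<and> W_scheme (a i) = t i"
      by auto
    have "\<exists>b\<in>tuples (carr M) \<Delta>. i \<le> k \<longrightarrow> j \<le> k \<longrightarrow> i \<noteq> j \<longrightarrow> (b \<in> W_scheme (a i)) \<noteq> (b \<in> W_scheme (a j))" for i j
    proof (cases "i \<le> k \<and> j \<le> k \<and> i \<noteq> j")
      case True
      then have "W_scheme (a i) \<noteq> W_scheme (a j)" using a t by (metis atMost_iff bij_betw_def inj_onD)
      then show ?thesis by (auto simp: W_scheme_def)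
    next
      case False
      then show ?thesis using tuples_nonempty[OF \<Delta>] by blast
    qed
    \<comment> \<open>For different i and j up to k, \<open>\<beta> i j\<close> distinguishes two of
      the translates; elsewhere it is an arbitrary tuple.\<close>
    then obtain \<beta> where \<beta>: "\<And>i j. \<beta> i j \<in> tuples (carr M) \<Delta>"
      "\<And>i j. i \<le> k \<Longrightarrow> j \<le> k \<Longrightarrow> i \<noteq> j \<Longrightarrow> (\<beta> i j \<in> W_scheme (a i)) \<noteq> (\<beta> i j \<in> W_scheme (a j))"
      by metis
    obtain v0 where v0: "env v0" using env_exists by blast
    \<comment> \<open>Stores \<open>\<beta> i j\<close> in the variable numbered 10 plus the code of
      (i, j); \<open>v0\<close> supplies values of the right sorts for all other variables.\<close>
    define v where "v x = (if fst x = \<Delta> \<and> 10 \<le> snd x then case_prod \<beta> (prod_decode (snd x - 10)) else v0 x)" for x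
    have v: "env v" using v0 \<beta>(1) unfolding env_def v_def by (auto split: prod.split)
    have v\<beta>: "v (\<Delta>, 10 + prod_encode ij) = case_prod \<beta> ij" for ij by (simp add: v_def)
    \<comment> \<open>The trace that \<open>a i\<close> times a W-generic point has on the chosen
      parameters.\<close>
    define S where "S i = {ij\<in>I. case_prod \<beta> ij \<in> W_scheme (a i)}" for i
    have "v \<in> FH (S i) (\<pi> (a i))" if i: "i \<le> k" for i
    proof -
      have "\<forall>\<^sub>F x in W. \<forall>ij\<in>I. Y (a i \<otimes>\<^bsub>G\<^esub> x) (case_prod \<beta> ij) \<longleftrightarrow> ij \<in> S i"
      proof (intro eventually_ball_finite I ballI)
        fix ij assume "ij \<in> I"
        then show "\<forall>\<^sub>F x in W. Y (a i \<otimes>\<^bsub>G\<^esub> x) (case_prod \<beta> ij) \<longleftrightarrow> ij \<in> S i"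
          using ultra_not_iff[OF W(1), of "\<lambda>x. Y (a i \<otimes>\<^bsub>G\<^esub> x) (case_prod \<beta> ij)"] \<beta>(1)
          by (cases "ij \<in> S i") (auto simp: S_def W_scheme_def split: prod.splits)
      qed
      then have "\<forall>\<^sub>F x in W. trace_fm I (S i) (v((\<Gamma>H, 3) := \<pi> (a i) \<otimes>\<^bsub>H\<^esub> \<pi> x))"
        using W(2)
      proof eventually_elim
        fix x assume x: "\<forall>ij\<in>I. Y (a i \<otimes>\<^bsub>G\<^esub> x) (case_prod \<beta> ij) \<longleftrightarrow> ij \<in> S i" "x \<in> carrier G"
        then have "a i \<otimes>\<^bsub>G\<^esub> x \<in> carrier G" using a i by simp
        then show "trace_fm I (S i) (v((\<Gamma>H, 3) := \<pi> (a i) \<otimes>\<^bsub>H\<^esub> \<pi> x))"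
          unfolding trace_fm_def using x a[OF i] hom_mult[OF \<pi>_hom] carriers(2)
          by (intro bexI[of _ "a i \<otimes>\<^bsub>G\<^esub> x"]) (auto simp: v\<beta>)
      qed
      \<comment> \<open>The condition involves x only through \<pi>(x), since the point of the fibre
        is bound inside \<open>trace_fm\<close>.\<close>
      then have "\<forall>\<^sub>F x in R. trace_fm I (S i) (v((\<Gamma>H, 3) := \<pi> (a i) \<otimes>\<^bsub>H\<^esub> x))" by (rule R_W)
      then show ?thesis using v by (simp add: FH_def)
    qed
    \<comment> \<open>Here equality of the data on H enters: \<open>a i\<close> may be replaced by
      g0, so that all indices refer to the same translate of R.\<close>
    moreover have "FH (S i) (\<pi> (a i)) = FH (S i) (\<pi> g0)" if "i \<le> k" for i
    proof -
      have "S i \<in> Pow I" by (auto simp: S_def)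
      then show ?thesis using a[OF that] unfolding \<Phi>_def by (metis restrict_apply')
    qed
    ultimately have "v \<in> FH (S i) (\<pi> g0)" if "i \<le> k" for i
      using that by blast
    then have "\<forall>\<^sub>F x in R. trace_fm I (S i) (v((\<Gamma>H, 3) := \<pi> g0 \<otimes>\<^bsub>H\<^esub> x))" if "i \<le> k" for i
      using that by (simp add: FH_def)
    \<comment> \<open>One x works for all of the finitely many i, so a single fibre contains points
      with all k + 1 traces, and the parameters \<beta> keep these apart.\<close>
    then have "\<forall>\<^sub>F x in R. \<forall>i\<in>{..k}. trace_fm I (S i) (v((\<Gamma>H, 3) := \<pi> g0 \<otimes>\<^bsub>H\<^esub> x))"
      by (intro eventually_ball_finite) auto
    then obtain x where x: "\<And>i. i \<le> k \<Longrightarrow> trace_fm I (S i) (v((\<Gamma>H, 3) := \<pi> g0 \<otimes>\<^bsub>H\<^esub> x))"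
      using eventually_happens'[OF ultra_not_bot[OF R_ev(1)]] by blast
    define h where "h = \<pi> g0 \<otimes>\<^bsub>H\<^esub> x"
    have "\<forall>i\<in>{..k}. \<exists>y. y \<in> fibre h \<and> (\<forall>ij\<in>I. Y y (case_prod \<beta> ij) \<longleftrightarrow> ij \<in> S i)"
    proof
      fix i assume "i \<in> {..k}"
      then have "trace_fm I (S i) (v((\<Gamma>H, 3) := h))" using x by (simp add: h_def)
      then show "\<exists>y. y \<in> fibre h \<and> (\<forall>ij\<in>I. Y y (case_prod \<beta> ij) \<longleftrightarrow> ij \<in> S i)"
        by (auto simp: trace_fm_def v\<beta> fibre_def)
    qed
    from bchoice[OF this] obtain y where
      "\<forall>i\<in>{..k}. y i \<in> fibre h \<and> (\<forall>ij\<in>I. Y (y i) (case_prod \<beta> ij) \<longleftrightarrow> ij \<in> S i)" ..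
    then have y: "\<And>i. i \<le> k \<Longrightarrow> y i \<in> fibre h"
      "\<And>i ij. i \<le> k \<Longrightarrow> ij \<in> I \<Longrightarrow> Y (y i) (case_prod \<beta> ij) \<longleftrightarrow> ij \<in> S i"
      by blast+
    have "inj_on (Yset \<circ> y) {..k}"
    proof (rule inj_onI, rule ccontr)
      fix i j assume ij: "i \<in> {..k}" "j \<in> {..k}" "(Yset \<circ> y) i = (Yset \<circ> y) j" "i \<noteq> j"
      then have "Y (y i) (\<beta> i j) \<longleftrightarrow> Y (y j) (\<beta> i j)" using \<beta>(1)[of i j] by (auto simp: Yset_def)
      then show False
        using ij \<beta>(2)[of i j] y(2)[of i "(i, j)"] y(2)[of j "(i, j)"] by (auto simp: I_def S_def)
    qed
    from card_image[OF this] have "Suc k = card ((Yset \<circ> y) ` {..k})" by simp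
    also have "\<dots> \<le> card (Yset ` fibre h)"
      by (rule card_mono[OF k(1)]) (use y(1) in auto)
    finally show False using k(2)[of h] by simp
  qed
  then have "finite (\<Union>c\<in>\<Phi> ` carrier G. W_scheme ` {g \<in> carrier G. \<Phi> g = c})"
    by (intro finite_UN_I fin\<Phi>) auto
  then show ?thesis by (rule finite_subset[rotated]) auto
qed

end

context dfg_extension
begin

text \<open>U is the distribution of g \<iota>(n). By associativity a left translation acts on the
  factor g alone, so the schemes of translates of U are exactly the sets counted by
  \<open>finite_W_scheme\<close>.\<close>

theorem dfg_filter_extension: "\<exists>U. dfg_filter \<Gamma>G G U"
proof -
  obtain U where U: "ultra U" "\<And>P. eventually P U \<longleftrightarrow> (\<forall>\<^sub>F g in W. \<forall>\<^sub>F n in V. P (g \<otimes>\<^bsub>G\<^esub> \<iota> n))"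
    by (rule ultra_bind[OF W(1) V_ev(1), where f = "\<lambda>g n. g \<otimes>\<^bsub>G\<^esub> \<iota> n"]) (rule that)
  have "dfg_filter \<Gamma>G G U"
    unfolding dfg_filter_def definable_filter_def
  proof (intro conjI ballI allI impI)
    show "ultra U" by (rule U(1))
    show "\<forall>\<^sub>F x in U. x \<in> carrier G"
      unfolding U(2) using W(2)
      by (rule eventually_mono) (use V_ev(2) \<iota>_closed in \<open>auto elim: eventually_mono\<close>)
  next
    fix \<Delta> X assume \<Delta>: "\<Delta> \<in> lists (sorts L)" and X: "definable L M (\<Gamma>G @ \<Delta>) X"
    interpret fam: dfg_extension_family L M \<Gamma>N \<Gamma>G \<Gamma>H N G H \<iota> \<pi> V R W \<Delta> X
      by unfold_locales (use \<Delta> X in auto)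
    have ev: "(\<forall>\<^sub>F x in U. (g \<otimes>\<^bsub>G\<^esub> x) @ b \<in> X) \<longleftrightarrow> (\<forall>\<^sub>F x in W. fam.Y (g \<otimes>\<^bsub>G\<^esub> x) b)"
      if g: "g \<in> carrier G" for g b
    proof -
      have "(\<forall>\<^sub>F n in V. (g \<otimes>\<^bsub>G\<^esub> (x \<otimes>\<^bsub>G\<^esub> \<iota> n)) @ b \<in> X) \<longleftrightarrow> fam.Y (g \<otimes>\<^bsub>G\<^esub> x) b"
        if x: "x \<in> carrier G" for x
      proof -
        have "(\<forall>\<^sub>F n in V. (g \<otimes>\<^bsub>G\<^esub> (x \<otimes>\<^bsub>G\<^esub> \<iota> n)) @ b \<in> X) \<longleftrightarrow>
            (\<forall>\<^sub>F n in V. (g \<otimes>\<^bsub>G\<^esub> x \<otimes>\<^bsub>G\<^esub> \<iota> n) @ b \<in> X)"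
          by (rule eventually_cong[OF V_ev(2)]) (use g x \<iota>_closed in \<open>simp add: G.m_assoc\<close>)
        then show ?thesis using g x by (simp add: fam.Y_def)
      qed
      then show ?thesis unfolding U(2) by (rule eventually_cong[OF W(2)])
    qed
    have "(\<forall>\<^sub>F x in U. x @ b \<in> X) \<longleftrightarrow> (\<forall>\<^sub>F x in W. fam.Y x b)" for b
      unfolding U(2) by (rule eventually_cong[OF W(2)]) (simp add: fam.Y_def)
    then show "definable L M \<Delta> {b \<in> tuples (carr M) \<Delta>. \<forall>\<^sub>F x in U. x @ b \<in> X}"
      using fam.definable_Y by simp
    show "finite ((\<lambda>g. {b \<in> tuples (carr M) \<Delta>. \<forall>\<^sub>F x in U. (g \<otimes>\<^bsub>G\<^esub> x) @ b \<in> X}) ` carrier G)"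
      using fam.finite_W_scheme unfolding fam.W_scheme_def by (simp add: ev cong: image_cong_simp)
  qed
  then show ?thesis by blast
qed

end

section \<open>Definable f-generics in terms of ultrafilters\<close>

context fo_structure
begin

definition represents :: "'s list \<Rightarrow> 'a list filter \<Rightarrow> (('s, 'f, 'r) fm \<times> 'a list) set \<Rightarrow> bool" where
  "represents \<Gamma> U p \<longleftrightarrow>
     p = {\<theta> \<in> param_formulas L (carr M) \<Gamma>. \<forall>\<^sub>F x in U. x \<in> solutions M \<Gamma> \<theta>}"

definition solset :: "'s list \<Rightarrow> ('s, 'f, 'r) fm \<Rightarrow> 'a list set" where
  "solset \<Gamma> \<phi> = {x \<in> tuples (carr M) \<Gamma>. sat M x \<phi>}"

lemma definable_solset: "\<phi> \<in> formulas L \<Gamma> \<Longrightarrow> definable_over L M A \<Gamma> (solset \<Gamma> \<phi>)"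
  by (rule definable_overI[where \<Theta> = "[]" and b = "[]" and \<phi> = \<phi>])
    (auto simp: solset_def formulas_def)

text \<open>The solution sets of p generate a proper filter by finite satisfiability. Completeness
  of p leaves an ultrafilter refining it no choice on definable sets; elsewhere U is
  arbitrary.\<close>

lemma type_ultrafilter:
  assumes p: "p \<in> global_types L M \<Gamma>"
  obtains U where "ultra U" "represents \<Gamma> U p"
proof -
  have p_sub: "p \<subseteq> param_formulas L (carr M) \<Gamma>"
    and p_fin: "\<And>q. q \<subseteq> p \<Longrightarrow> finite q \<Longrightarrow> \<exists>xs\<in>tuples (carr M) \<Gamma>. \<forall>\<theta>\<in>q. xs \<in> solutions M \<Gamma> \<theta>"
    and p_compl: "\<And>\<phi> b. (\<phi>, b) \<in> param_formulas L (carr M) \<Gamma> \<Longrightarrow> (\<phi>, b) \<in> p \<or> (Neg \<phi>, b) \<in> p"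
    using p by (auto simp: types_over_def)
  have "(INF \<theta>\<in>p. principal (solutions M \<Gamma> \<theta>)) \<noteq> bot"
  proof (rule INF_filter_not_bot)
    fix q assume q: "q \<subseteq> p" "finite q"
    show "(INF \<theta>\<in>q. principal (solutions M \<Gamma> \<theta>)) \<noteq> bot"
      using p_fin[OF q] q(2) by (auto simp: INF_principal_finite principal_eq_bot_iff)
  qed
  then obtain U where U: "U \<le> (INF \<theta>\<in>p. principal (solutions M \<Gamma> \<theta>))" "ultra U"
    by (rule ultra_exists)
  have 1: "\<forall>\<^sub>F x in U. x \<in> solutions M \<Gamma> \<theta>" if "\<theta> \<in> p" for \<theta>
    using U(1) that by (simp add: le_INF_iff le_principal)
  have 2: "\<theta> \<in> p" if \<theta>: "\<theta> \<in> param_formulas L (carr M) \<Gamma>" "\<forall>\<^sub>F x in U. x \<in> solutions M \<Gamma> \<theta>" for \<theta>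
  proof (rule ccontr)
    assume "\<theta> \<notin> p"
    moreover obtain \<phi> b where \<phi>: "\<theta> = (\<phi>, b)" by (cases \<theta>)
    ultimately have "\<forall>\<^sub>F x in U. x \<in> solutions M \<Gamma> (Neg \<phi>, b)"
      using 1 p_compl \<theta>(1) by blast
    with \<theta>(2) have "\<forall>\<^sub>F x in U. False"
      by eventually_elim (auto simp: \<phi> solutions_def)
    then show False using ultra_not_bot[OF U(2)] by (simp add: trivial_limit_def)
  qed
  have "represents \<Gamma> U p" unfolding represents_def using 1 2 p_sub by blast
  then show thesis using that U(2) by blast
qed

lemma ultrafilter_type:
  assumes "ultra U" "\<forall>\<^sub>F x in U. x \<in> tuples (carr M) \<Gamma>"
  shows "{\<theta> \<in> param_formulas L A \<Gamma>. \<forall>\<^sub>F x in U. x \<in> solutions M \<Gamma> \<theta>} \<in> types_over L M A \<Gamma>"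
    (is "?p \<in> _")
  unfolding types_over_def
proof (intro CollectI conjI allI impI)
  fix q assume q: "q \<subseteq> ?p" "finite q"
  then have "\<forall>\<^sub>F x in U. \<forall>\<theta>\<in>q. x \<in> solutions M \<Gamma> \<theta>"
    by (intro eventually_ball_finite) auto
  with assms(2) have "\<forall>\<^sub>F x in U. x \<in> tuples (carr M) \<Gamma> \<and> (\<forall>\<theta>\<in>q. x \<in> solutions M \<Gamma> \<theta>)"
    by (rule eventually_conj)
  from eventually_happens'[OF ultra_not_bot[OF assms(1)] this]
  show "\<exists>xs\<in>tuples (carr M) \<Gamma>. \<forall>\<theta>\<in>q. xs \<in> solutions M \<Gamma> \<theta>" by blast
next
  have "(\<phi>, b) \<in> ?p \<or> (Neg \<phi>, b) \<in> ?p" if \<phi>: "(\<phi>, b) \<in> param_formulas L A \<Gamma>" for \<phi> b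
  proof (cases "\<forall>\<^sub>F x in U. x \<in> solutions M \<Gamma> (\<phi>, b)")
    case False
    then have "\<forall>\<^sub>F x in U. x \<notin> solutions M \<Gamma> (\<phi>, b)" by (simp only: ultra_not_iff[OF assms(1)])
    with assms(2) have "\<forall>\<^sub>F x in U. x \<in> solutions M \<Gamma> (Neg \<phi>, b)"
      by eventually_elim (auto simp: solutions_def)
    moreover have "(Neg \<phi>, b) \<in> param_formulas L A \<Gamma>"
      using \<phi> by (auto simp: param_formulas_def formulas_def)
    ultimately show ?thesis by blast
  qed (use \<phi> in blast)
  then show "\<forall>(\<phi>, b)\<in>param_formulas L A \<Gamma>. (\<phi>, b) \<in> ?p \<or> (Neg \<phi>, b) \<in> ?p" by blast
qed auto

lemma solutions_iff:
  assumes "\<phi> \<in> formulas L (\<Gamma> @ \<Delta>)" "b \<in> tuples (carr M) \<Delta>"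
  shows "x \<in> solutions M \<Gamma> (\<phi>, b) \<longleftrightarrow> x \<in> tuples (carr M) \<Gamma> \<and> x @ b \<in> solset (\<Gamma> @ \<Delta>) \<phi>"
  using assms by (auto simp: solutions_def solset_def intro: tuples_appendI)

text \<open>The \<phi>-definition of the left translate of U by g, kept as a set: these sets are
  counted, not the formulas defining them.\<close>

definition scheme :: "'s list \<Rightarrow> 'a list monoid \<Rightarrow> 'a list filter \<Rightarrow> 's list \<Rightarrow> ('s, 'f, 'r) fm \<Rightarrow>
    'a list \<Rightarrow> 'a list set" where
  "scheme \<Gamma> G U \<Delta> \<phi> g =
     {b \<in> tuples (carr M) \<Delta>. \<forall>\<^sub>F x in U. (g \<otimes>\<^bsub>G\<^esub> x) @ b \<in> solset (\<Gamma> @ \<Delta>) \<phi>}"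

lemma dpred_translate:
  assumes "definable_group L M \<Gamma> G" "definable L M (\<Gamma> @ \<Delta>) X" "\<Delta> \<in> lists (sorts L)"
  shows "dpred (carr M) (\<lambda>v. v (\<Gamma>, 0) \<in> carrier G \<and> v (\<Gamma>, 1) \<in> carrier G \<and>
    (v (\<Gamma>, 0) \<otimes>\<^bsub>G\<^esub> v (\<Gamma>, 1)) @ v (\<Delta>, 4) \<in> X)"
proof -
  interpret group G by (rule definable_group_group[OF assms(1)])
  note \<Gamma> = definable_group_sorts[OF assms(1)]
  have "dpred (carr M) (\<lambda>v. (v (\<Gamma>, 0) \<in> carrier G \<and> v (\<Gamma>, 1) \<in> carrier G \<and>
      v (\<Gamma>, 2) = v (\<Gamma>, 0) \<otimes>\<^bsub>G\<^esub> v (\<Gamma>, 1)) \<and> v (\<Gamma>, 2) @ v (\<Delta>, 4) \<in> X)"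
    by (intro dpred_conj[OF dpred_mult[OF assms(1)] dpred_atom2[OF assms(2) \<Gamma> assms(3)]])
  from dpred_ex[OF this \<Gamma>, of 2] show ?thesis
    by (rule dpred_cong) (use definable_group_carrier[OF assms(1)] in auto)
qed

text \<open>\<open>left_translate\<close> asks for a formula in p whose solution set is D, the
  preimage of the instance under multiplication by g. Since D is definable, such a formula exists if
  and only if D is U-large.\<close>

lemma left_translate_iff:
  assumes G: "definable_group L M \<Gamma> G" and p: "represents \<Gamma> U p"
    and U: "\<forall>\<^sub>F x in U. x \<in> carrier G" and g: "g \<in> carrier G"
    and \<phi>: "\<phi> \<in> formulas L (\<Gamma> @ \<Delta>)" "\<Delta> \<in> lists (sorts L)" and b: "b \<in> tuples (carr M) \<Delta>"
  shows "(\<phi>, b) \<in> left_translate L M \<Gamma> G g p \<longleftrightarrow> b \<in> scheme \<Gamma> G U \<Delta> \<phi> g"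
proof -
  interpret group G by (rule definable_group_group[OF G])
  note \<Gamma> = definable_group_sorts[OF G] and GT = definable_group_carrier[OF G]
  define D where "D = {x \<in> carrier G. g \<otimes>\<^bsub>G\<^esub> x \<in> solutions M \<Gamma> (\<phi>, b)}"
  have D: "D = {x \<in> tuples (carr M) \<Gamma>. g \<in> carrier G \<and> x \<in> carrier G \<and> (g \<otimes>\<^bsub>G\<^esub> x) @ b \<in> solset (\<Gamma> @ \<Delta>) \<phi>}"
    using GT g m_closed[of g] by (auto simp: D_def solutions_iff[OF \<phi>(1) b])
  have gt: "g \<in> tuples (carr M) \<Gamma>" using g GT by auto
  have "dpred (carr M) (\<lambda>v. g \<in> carrier G \<and> v (\<Gamma>, 1) \<in> carrier G \<and>
    (g \<otimes>\<^bsub>G\<^esub> v (\<Gamma>, 1)) @ b \<in> solset (\<Gamma> @ \<Delta>) \<phi>)"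
    using dpred_const[OF dpred_const[OF dpred_translate[OF G definable_solset[OF \<phi>(1)] \<phi>(2)] \<Gamma> gt gt, of 0] \<phi>(2) b b, of 4]
    by simp
  from dpred_extract1[OF this \<Gamma>] have "definable L M \<Gamma> D" by (simp add: D)
  then obtain \<eta> where \<eta>: "\<eta> \<in> param_formulas L (carr M) \<Gamma>" "D = solutions M \<Gamma> \<eta>"
    by (auto simp: definable_over_def)
  have "(\<phi>, b) \<in> param_formulas L (carr M) \<Gamma>" using \<phi> b by (auto simp: param_formulas_def)
  then have "(\<phi>, b) \<in> left_translate L M \<Gamma> G g p \<longleftrightarrow> (\<exists>\<eta>\<in>p. solutions M \<Gamma> \<eta> = D)"
    by (simp add: left_translate_def D_def)
  also have "\<dots> \<longleftrightarrow> (\<forall>\<^sub>F x in U. x \<in> D)"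
    using \<eta> p[unfolded represents_def] by blast
  also have "\<dots> \<longleftrightarrow> (\<forall>\<^sub>F x in U. (g \<otimes>\<^bsub>G\<^esub> x) @ b \<in> solset (\<Gamma> @ \<Delta>) \<phi>)"
    by (rule eventually_cong[OF U]) (use GT g D in auto)
  finally show ?thesis using b by (simp add: scheme_def)
qed

text \<open>Saturation in terms of definable sets instead of types. In this form it passes from M to
  \<open>M\<^sup>e\<^sup>q\<close> by pulling covers back along the coding of imaginaries.\<close>

definition compact_covers :: "'k rel \<Rightarrow> bool" where
  "compact_covers \<kappa> \<longleftrightarrow> (\<forall>A. (\<forall>s\<in>sorts L. A s \<subseteq> carr M s) \<longrightarrow> small \<kappa> L A \<longrightarrow>
     (\<forall>\<Gamma>\<in>lists (sorts L). \<forall>\<D>. (\<forall>X\<in>\<D>. definable_over L M A \<Gamma> X) \<longrightarrow> tuples (carr M) \<Gamma> \<subseteq> \<Union>\<D> \<longrightarrow>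
       (\<exists>\<D>'\<subseteq>\<D>. finite \<D>' \<and> tuples (carr M) \<Gamma> \<subseteq> \<Union>\<D>')))"

definition tuple_set :: "'s list \<Rightarrow> 'a list \<Rightarrow> 's \<Rightarrow> 'a set" where
  "tuple_set \<Theta> c s = {c ! i | i. i < length \<Theta> \<and> \<Theta> ! i = s}"

lemma tuple_set_tuples: "c \<in> tuples A \<Theta> \<Longrightarrow> c \<in> tuples (tuple_set \<Theta> c) \<Theta>"
  by (auto simp: tuples_iff tuple_set_def)

lemma tuple_set_subset: "c \<in> tuples A \<Theta> \<Longrightarrow> tuple_set \<Theta> c s \<subseteq> A s"
  by (auto simp: tuples_iff tuple_set_def)

lemma finite_tuple_set: "finite (Sigma S (tuple_set \<Theta> c))"
proof (rule finite_subset)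
  show "Sigma S (tuple_set \<Theta> c) \<subseteq> (\<lambda>i. (\<Theta> ! i, c ! i)) ` {..<length \<Theta>}"
    by (auto simp: tuple_set_def)
qed simp

lemma definable_over_finite:
  assumes "definable L M \<Gamma> X"
  obtains A where "finite (Sigma (sorts L) A)" "\<And>s. A s \<subseteq> carr M s" "definable_over L M A \<Gamma> X"
proof -
  obtain \<phi> b \<Theta> where 1: "\<Theta> \<in> lists (sorts L)" "wf_fm L (\<Gamma> @ \<Theta>) \<phi>" "b \<in> tuples (carr M) \<Theta>"
    "X = {xs \<in> tuples (carr M) \<Gamma>. sat M (xs @ b) \<phi>}"
    using definable_overE[OF assms] .
  show thesis
  proof (rule that)
    show "definable_over L M (tuple_set \<Theta> b) \<Gamma> X"
      by (rule definable_overI[OF 1(1,2) tuple_set_tuples[OF 1(3)] 1(4)])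
  qed (use finite_tuple_set tuple_set_subset[OF 1(3)] in auto)
qed

lemma small_union_finite:
  assumes "Card_order \<kappa>" "infinite (Field \<kappa>)" "small \<kappa> L A" "finite (Sigma (sorts L) B)"
  shows "small \<kappa> L (\<lambda>s. A s \<union> B s)"
proof -
  have "|Sigma (sorts L) B| <o \<kappa>"
    using assms by (metis card_of_Field_ordIso finite_ordLess_infinite card_of_Well_order
      card_order_on_well_order_on Field_card_of)
  moreover have "Sigma (sorts L) (\<lambda>s. A s \<union> B s) = Sigma (sorts L) A \<union> Sigma (sorts L) B" by auto
  ultimately show ?thesis
    using assms(3) card_of_Un_ordLess_infinite_Field[OF assms(2,1)] by (simp add: small_def)
qed

text \<open>The elements of G with a given scheme form a set definable over a small set, since the
  scheme is; these sets cover G, and a finite subcover leaves finitely many schemes. Families with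
  parameters are sections of families without.\<close>

lemma dfg_imp_dfg_filter:
  assumes \<kappa>: "Card_order \<kappa>" "infinite (Field \<kappa>)" and cc: "compact_covers \<kappa>"
    and G: "definable_group L M \<Gamma> G" and dfg: "dfg \<kappa> L M \<Gamma> G"
  shows "\<exists>U. dfg_filter \<Gamma> G U"
proof -
  interpret group G by (rule definable_group_group[OF G])
  note \<Gamma> = definable_group_sorts[OF G] and GT = definable_group_carrier[OF G]
  obtain p M\<^sub>0 where p: "p \<in> global_types L M \<Gamma>" "type_on M \<Gamma> (carrier G) p"
    and M0: "elementary_substruc L M\<^sub>0 M" "small \<kappa> L (carr M\<^sub>0)"
    and def: "\<And>g. g \<in> carrier G \<Longrightarrow> definable_type L M (carr M\<^sub>0) \<Gamma> (left_translate L M \<Gamma> G g p)"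
    using dfg by (auto simp: dfg_def)
  have M0M: "carr M\<^sub>0 s \<subseteq> carr M s" if "s \<in> sorts L" for s
    using M0(1) that by (auto simp: elementary_substruc_def)
  obtain U where U: "ultra U" "represents \<Gamma> U p" by (rule type_ultrafilter[OF p(1)])
  have UG: "\<forall>\<^sub>F x in U. x \<in> carrier G"
    using U(2) p(2) by (auto simp: represents_def type_on_def)
  have UT: "\<forall>\<^sub>F x in U. x \<in> tuples (carr M) \<Gamma>" using UG by (rule eventually_mono) (use GT in auto)
  have def0: "definable_over L M (carr M\<^sub>0) \<Delta> (scheme \<Gamma> G U \<Delta> \<phi> g)"
    if "g \<in> carrier G" "\<Delta> \<in> lists (sorts L)" "\<phi> \<in> formulas L (\<Gamma> @ \<Delta>)" for g \<Delta> \<phi>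
  proof -
    have "{b \<in> tuples (carr M) \<Delta>. (\<phi>, b) \<in> left_translate L M \<Gamma> G g p} = scheme \<Gamma> G U \<Delta> \<phi> g"
      using left_translate_iff[OF G U(2) UG that(1,3,2)] by (auto simp: scheme_def)
    then show ?thesis using def[OF that(1), unfolded definable_type_def, rule_format, OF that(2,3)] by simp
  qed
  have instance_eq: "{b \<in> tuples (carr M) \<Delta>. \<forall>\<^sub>F x in U. (g \<otimes>\<^bsub>G\<^esub> x) @ b \<in> X} =
      {b \<in> tuples (carr M) \<Delta>. b @ c \<in> scheme \<Gamma> G U (\<Delta> @ \<Theta>) \<phi> g}"
    if g: "g \<in> carrier G" and c: "c \<in> tuples (carr M) \<Theta>"
      and X: "X = {xs \<in> tuples (carr M) (\<Gamma> @ \<Delta>). sat M (xs @ c) \<phi>}" for g c \<Theta> \<phi> \<Delta> X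
  proof -
    have "(\<forall>\<^sub>F x in U. (g \<otimes>\<^bsub>G\<^esub> x) @ b \<in> X) \<longleftrightarrow>
        (\<forall>\<^sub>F x in U. (g \<otimes>\<^bsub>G\<^esub> x) @ b @ c \<in> solset (\<Gamma> @ \<Delta> @ \<Theta>) \<phi>)"
      if b: "b \<in> tuples (carr M) \<Delta>" for b
    proof (rule eventually_cong[OF UG])
      fix x assume "x \<in> carrier G"
      then have "g \<otimes>\<^bsub>G\<^esub> x \<in> tuples (carr M) \<Gamma>" using g GT by auto
      then show "(g \<otimes>\<^bsub>G\<^esub> x) @ b \<in> X \<longleftrightarrow> (g \<otimes>\<^bsub>G\<^esub> x) @ b @ c \<in> solset (\<Gamma> @ \<Delta> @ \<Theta>) \<phi>"
        using b c X by (simp add: solset_def tuples_appendI)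
    qed
    then show ?thesis using c by (auto simp: scheme_def intro: tuples_appendI)
  qed
  have dfil: "definable_filter \<Gamma> U"
    unfolding definable_filter_def
  proof (intro ballI allI impI)
    fix \<Delta> X assume \<Delta>: "\<Delta> \<in> lists (sorts L)" and X: "definable L M (\<Gamma> @ \<Delta>) X"
    obtain \<phi> c \<Theta> where 1: "\<Theta> \<in> lists (sorts L)" "wf_fm L ((\<Gamma> @ \<Delta>) @ \<Theta>) \<phi>" "c \<in> tuples (carr M) \<Theta>"
      "X = {xs \<in> tuples (carr M) (\<Gamma> @ \<Delta>). sat M (xs @ c) \<phi>}"
      using definable_overE[OF X] .
    \<comment> \<open>Translating by the identity yields the definability of U itself.\<close>
    have "definable_over L M (carr M\<^sub>0) (\<Delta> @ \<Theta>) (scheme \<Gamma> G U (\<Delta> @ \<Theta>) \<phi> \<one>\<^bsub>G\<^esub>)"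
      using 1 \<Delta> by (intro def0) (auto simp: formulas_def)
    then have "definable L M (\<Delta> @ \<Theta>) (scheme \<Gamma> G U (\<Delta> @ \<Theta>) \<phi> \<one>\<^bsub>G\<^esub>)"
      by (rule definable_over_mono) (rule M0M)
    from definable_over_const[OF this 1(3,3,1)]
    have "definable L M \<Delta> {b \<in> tuples (carr M) \<Delta>. \<forall>\<^sub>F x in U. (\<one>\<^bsub>G\<^esub> \<otimes>\<^bsub>G\<^esub> x) @ b \<in> X}"
      unfolding instance_eq[OF one_closed 1(3,4)] .
    moreover have "(\<forall>\<^sub>F x in U. (\<one>\<^bsub>G\<^esub> \<otimes>\<^bsub>G\<^esub> x) @ b \<in> X) \<longleftrightarrow> (\<forall>\<^sub>F x in U. x @ b \<in> X)" for b
      by (rule eventually_cong[OF UG]) simp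
    ultimately show "definable L M \<Delta> {b \<in> tuples (carr M) \<Delta>. \<forall>\<^sub>F x in U. x @ b \<in> X}" by simp
  qed
  have fin0: "finite (scheme \<Gamma> G U \<Delta> \<phi> ` carrier G)"
    if \<Delta>: "\<Delta> \<in> lists (sorts L)" and \<phi>: "\<phi> \<in> formulas L (\<Gamma> @ \<Delta>)" for \<Delta> \<phi>
  proof -
    let ?F = "scheme \<Gamma> G U \<Delta> \<phi>"
    have "dpred (carr M) (\<lambda>v. v (\<Gamma>, 0) \<in> carrier G \<and> (\<forall>\<^sub>F x in U. v (\<Gamma>, 0) \<in> carrier G \<and> x \<in> carrier G \<and>
       (v (\<Gamma>, 0) \<otimes>\<^bsub>G\<^esub> x) @ v (\<Delta>, 4) \<in> solset (\<Gamma> @ \<Delta>) \<phi>))"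
      using dpred_conj[OF dpred_carrier[OF G, of 0]
          dpred_eventually[OF dpred_translate[OF G definable_solset[OF \<phi>] \<Delta>] \<Gamma> dfil UT, of 1]] by simp
    then have "dpred (carr M) (\<lambda>v. v (\<Gamma>, 0) \<in> carrier G \<and> v (\<Delta>, 4) \<in> ?F (v (\<Gamma>, 0)))"
    proof (rule dpred_cong)
      fix v assume "env v"
      then have "v (\<Delta>, 4) \<in> tuples (carr M) \<Delta>" using \<Delta> by (rule envD)
      moreover have "v (\<Gamma>, 0) \<in> carrier G \<Longrightarrow> (\<forall>\<^sub>F x in U. v (\<Gamma>, 0) \<in> carrier G \<and> x \<in> carrier G \<and>
          (v (\<Gamma>, 0) \<otimes>\<^bsub>G\<^esub> x) @ v (\<Delta>, 4) \<in> solset (\<Gamma> @ \<Delta>) \<phi>) \<longleftrightarrow>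
        (\<forall>\<^sub>F x in U. (v (\<Gamma>, 0) \<otimes>\<^bsub>G\<^esub> x) @ v (\<Delta>, 4) \<in> solset (\<Gamma> @ \<Delta>) \<phi>)"
        by (rule eventually_cong[OF UG]) simp
      ultimately show "(v (\<Gamma>, 0) \<in> carrier G \<and> (\<forall>\<^sub>F x in U. v (\<Gamma>, 0) \<in> carrier G \<and> x \<in> carrier G \<and>
          (v (\<Gamma>, 0) \<otimes>\<^bsub>G\<^esub> x) @ v (\<Delta>, 4) \<in> solset (\<Gamma> @ \<Delta>) \<phi>)) \<longleftrightarrow>
        (v (\<Gamma>, 0) \<in> carrier G \<and> v (\<Delta>, 4) \<in> ?F (v (\<Gamma>, 0)))"
        by (auto simp: scheme_def)
    qed
    from dpred_extract2[OF this _ \<Gamma> \<Delta>] 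
    have "definable L M (\<Gamma> @ \<Delta>) {x @ y |x y. x \<in> tuples (carr M) \<Gamma> \<and> y \<in> tuples (carr M) \<Delta> \<and> x \<in> carrier G \<and> y \<in> ?F x}"
      (is "definable L M _ ?E") by simp
    then obtain B where B: "finite (Sigma (sorts L) B)" "\<And>s. B s \<subseteq> carr M s"
      "definable_over L M B (\<Gamma> @ \<Delta>) ?E" by (rule definable_over_finite) (rule that)
    \<comment> \<open>G and its multiplication may be defined with parameters outside
      \<open>M\<^sub>0\<close>; B contains finitely many that suffice for the relation at
      hand.\<close>
    define A where "A s = carr M\<^sub>0 s \<union> B s" for s
    have A: "\<forall>s\<in>sorts L. A s \<subseteq> carr M s" using M0M B(2) by (auto simp: A_def)
    have smallA: "small \<kappa> L A"
      unfolding A_def by (rule small_union_finite[OF \<kappa> M0(2) B(1)])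
    define C where "C S = {x \<in> tuples (carr M) \<Gamma>. \<forall>b\<in>tuples (carr M) \<Delta>. x @ b \<in> ?E \<longleftrightarrow> b \<in> S}" for S
    have defC: "definable_over L M A \<Gamma> (C S)" if "definable_over L M A \<Delta> S" for S
    proof -
      have "dpred A (\<lambda>v. v (\<Gamma>, 0) @ v (\<Delta>, 1) \<in> ?E \<longleftrightarrow> v (\<Delta>, 1) \<in> S)"
        by (rule dpred_iff[OF dpred_atom2[OF definable_over_mono[OF B(3)] \<Gamma> \<Delta>] dpred_atom1[OF that \<Delta>]])
          (auto simp: A_def)
      from dpred_all[OF this \<Delta>, of 1]
      have "dpred A (\<lambda>v. \<forall>b\<in>tuples (carr M) \<Delta>. v (\<Gamma>, 0) @ b \<in> ?E \<longleftrightarrow> b \<in> S)" by (simp only: fun_upd_apply prod.inject simp_thms zero_neq_one if_True if_False refl)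
      from dpred_extract1[OF this \<Gamma>] show ?thesis by (simp add: C_def)
    qed
    \<comment> \<open>The empty set is the section of the relation at tuples outside G; it is added
      so that the whole product of sorts is covered.\<close>
    let ?S = "insert {} (?F ` carrier G)"
    have "definable_over L M A \<Delta> S" if S: "S \<in> ?S" for S
    proof (cases "S = {}")
      case True
      have "definable_over L M A \<Delta> {}"
        by (rule definable_overI[where \<phi> = Bot and \<Theta> = "[]" and b = "[]"]) auto
      then show ?thesis using True by simp
    next
      case False
      then obtain g where "g \<in> carrier G" "S = ?F g" using S by blast
      then show ?thesis using definable_over_mono[OF def0[OF _ \<Delta> \<phi>], of g A] by (auto simp: A_def)
    qed
    then have "\<forall>X\<in>C ` ?S. definable_over L M A \<Gamma> X" using defC by blast
    moreover have E_iff: "x @ b \<in> ?E \<longleftrightarrow> x \<in> carrier G \<and> b \<in> ?F x"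
      if "x \<in> tuples (carr M) \<Gamma>" "b \<in> tuples (carr M) \<Delta>" for x b
      using that by (auto simp: tuples_append_eq_iff[OF that(1)])
    have "tuples (carr M) \<Gamma> \<subseteq> \<Union>(C ` ?S)"
    proof
      fix x assume x: "x \<in> tuples (carr M) \<Gamma>"
      then have "x \<in> C (if x \<in> carrier G then ?F x else {})" using E_iff[OF x] by (simp add: C_def)
      then show "x \<in> \<Union>(C ` ?S)" by (auto split: if_splits)
    qed
    ultimately obtain \<D> where \<D>: "\<D> \<subseteq> C ` ?S" "finite \<D>" "tuples (carr M) \<Gamma> \<subseteq> \<Union>\<D>"
      using cc[unfolded compact_covers_def, rule_format, OF _ smallA \<Gamma>, of "C ` ?S"] A by blast
    then obtain S where S: "S \<subseteq> ?S" "finite S" "\<D> = C ` S" by (metis finite_subset_image)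
    have "?F ` carrier G \<subseteq> S"
    proof (rule image_subsetI)
      fix g assume g: "g \<in> carrier G"
      then have "g \<in> \<Union>(C ` S)" using \<D>(3) S(3) GT by auto
      then obtain s where s: "s \<in> S" "g \<in> C s" by auto
      have "s \<subseteq> tuples (carr M) \<Delta>" using s(1) S(1) by (auto simp: scheme_def)
      moreover have "?F g \<subseteq> tuples (carr M) \<Delta>" by (auto simp: scheme_def)
      moreover have "b \<in> ?F g \<longleftrightarrow> b \<in> s" if "b \<in> tuples (carr M) \<Delta>" for b
        using s(2) that g GT E_iff[of g b] by (auto simp: C_def)
      ultimately have "?F g = s" by blast
      then show "?F g \<in> S" using s(1) by simp
    qed
    then show ?thesis using S(2) finite_subset by blast
  qed
  have "finite ((\<lambda>g. {b \<in> tuples (carr M) \<Delta>. \<forall>\<^sub>F x in U. (g \<otimes>\<^bsub>G\<^esub> x) @ b \<in> X}) ` carrier G)"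
    if \<Delta>: "\<Delta> \<in> lists (sorts L)" and X: "definable L M (\<Gamma> @ \<Delta>) X" for \<Delta> X
  proof -
    obtain \<phi> c \<Theta> where 1: "\<Theta> \<in> lists (sorts L)" "wf_fm L ((\<Gamma> @ \<Delta>) @ \<Theta>) \<phi>" "c \<in> tuples (carr M) \<Theta>"
      "X = {xs \<in> tuples (carr M) (\<Gamma> @ \<Delta>). sat M (xs @ c) \<phi>}"
      using definable_overE[OF X] .
    have "finite (scheme \<Gamma> G U (\<Delta> @ \<Theta>) \<phi> ` carrier G)"
      by (rule fin0) (use \<Delta> 1 in \<open>auto simp: formulas_def\<close>)
    then have "finite ((\<lambda>S. {b \<in> tuples (carr M) \<Delta>. b @ c \<in> S}) ` scheme \<Gamma> G U (\<Delta> @ \<Theta>) \<phi> ` carrier G)"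
      by (rule finite_imageI)
    then show ?thesis
      unfolding image_image by (simp add: instance_eq[OF _ 1(3,4)] cong: image_cong_simp)
  qed
  then show ?thesis using U(1) UG dfil by (auto simp: dfg_filter_def)
qed

end

section \<open>Cardinality of terms and formulas\<close>

locale infinite_cardinal =
  fixes r :: "'k rel"
  assumes Card: "Card_order r" and inf: "infinite (Field r)"
begin

lemma le_subset: "A \<subseteq> B \<Longrightarrow> |B| \<le>o r \<Longrightarrow> |A| \<le>o r"
  using card_of_mono1 ordLeq_transitive by blast

lemma le_image: "|A| \<le>o r \<Longrightarrow> |f ` A| \<le>o r"
  using card_of_image ordLeq_transitive by blast

lemma le_Un: "|A| \<le>o r \<Longrightarrow> |B| \<le>o r \<Longrightarrow> |A \<union> B| \<le>o r"
  using card_of_Un_ordLeq_infinite_Field[OF inf _ _ Card] .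

lemma le_Times: "|A| \<le>o r \<Longrightarrow> |B| \<le>o r \<Longrightarrow> |A \<times> B| \<le>o r"
  using card_of_Times_ordLeq_infinite_Field[OF inf _ _ Card] .

lemma le_UN: "|I| \<le>o r \<Longrightarrow> (\<And>i. i \<in> I \<Longrightarrow> |A i| \<le>o r) \<Longrightarrow> |\<Union>i\<in>I. A i| \<le>o r"
  using card_of_UNION_ordLeq_infinite_Field[OF inf Card] by blast

lemma le_nat: "|UNIV :: nat set| \<le>o r"
  using inf infinite_iff_card_of_nat[of "Field r"] card_of_Field_ordIso[OF Card]
    ordLeq_ordIso_trans by blast

lemma le_finite: "finite A \<Longrightarrow> |A| \<le>o r"
  using le_nat ordLess_imp_ordLeq[OF finite_ordLess_infinite[of "|A|" "|UNIV :: nat set|"]]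
    card_of_Well_order ordLeq_transitive by (metis Field_card_of infinite_UNIV_nat)

lemma le_UN_nat: "(\<And>n :: nat. |A n| \<le>o r) \<Longrightarrow> |\<Union>n. A n| \<le>o r"
  by (rule le_UN[OF le_nat])

lemma le_lists:
  assumes "|A| \<le>o r" shows "|lists A| \<le>o r"
proof -
  have "|{xs \<in> lists A. length xs = n}| \<le>o r" for n
  proof (induction n)
    case 0
    show ?case by (rule le_subset[OF _ le_finite[of "{[]}"]]) auto
  next
    case (Suc n)
    have "{xs \<in> lists A. length xs = Suc n} \<subseteq> (\<lambda>(x, xs). x # xs) ` (A \<times> {xs \<in> lists A. length xs = n})"
      by (force simp: length_Suc_conv)
    then show ?case by (rule le_subset) (intro le_image le_Times assms Suc)
  qed
  then have "|\<Union>n. {xs \<in> lists A. length xs = n}| \<le>o r" by (rule le_UN_nat)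
  then show ?thesis by (rule le_subset[rotated]) auto
qed

text \<open>Stages by size: a compound term is given by its symbol and a list of terms from the
  previous stage, and countably many stages stay within r.\<close>

lemma le_terms:
  assumes "|F| \<le>o r" shows "|{t. set_tm t \<subseteq> F}| \<le>o r"
proof -
  let ?T = "\<lambda>n. {t. set_tm t \<subseteq> F \<and> size t < n}"
  have "|?T n| \<le>o r" for n
  proof (induction n)
    case 0
    show ?case by (rule le_finite) simp
  next
    case (Suc n)
    have "?T (Suc n) \<subseteq> range Var \<union> (\<lambda>(f, ts). Fun f ts) ` (F \<times> lists (?T n))"
    proof
      fix t assume t: "t \<in> ?T (Suc n)"
      show "t \<in> range Var \<union> (\<lambda>(f, ts). Fun f ts) ` (F \<times> lists (?T n))"
      proof (cases t)
        case (Fun f ts)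
        have "size u < n" if "u \<in> set ts" for u
        proof -
          have "size u \<le> size_list size ts" using that by (simp add: size_list_estimation')
          then show ?thesis using t Fun by simp
        qed
        then have "ts \<in> lists (?T n)" using t Fun by auto
        then show ?thesis using t Fun by force
      qed simp
    qed
    then show ?case by (rule le_subset) (intro le_Un le_image le_nat le_Times assms le_lists Suc)
  qed
  then have "|\<Union>n. ?T n| \<le>o r" by (rule le_UN_nat)
  then show ?thesis by (rule le_subset[rotated]) auto
qed

lemma le_fms:
  assumes "|S| \<le>o r" "|F| \<le>o r" "|R| \<le>o r"
  shows "|{\<phi>. set1_fm \<phi> \<subseteq> S \<and> set2_fm \<phi> \<subseteq> F \<and> set3_fm \<phi> \<subseteq> R}| \<le>o r"
proof -
  let ?P = "\<lambda>n. {\<phi>. set1_fm \<phi> \<subseteq> S \<and> set2_fm \<phi> \<subseteq> F \<and> set3_fm \<phi> \<subseteq> R \<and> size \<phi> < n}"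
  let ?T = "{t. set_tm t \<subseteq> F}"
  have "|?P n| \<le>o r" for n
  proof (induction n)
    case 0
    show ?case by (rule le_finite) simp
  next
    case (Suc n)
    have "?P (Suc n) \<subseteq> {Bot} \<union> (\<lambda>(t, u). Eq t u) ` (?T \<times> ?T) \<union>
      (\<lambda>(q, ts). Rel q ts) ` (R \<times> lists ?T) \<union> Neg ` ?P n \<union>
      (\<lambda>(\<phi>, \<psi>). Conj \<phi> \<psi>) ` (?P n \<times> ?P n) \<union> (\<lambda>(s, \<phi>). Ex s \<phi>) ` (S \<times> ?P n)"
    proof
      fix \<phi> assume \<phi>: "\<phi> \<in> ?P (Suc n)"
      show "\<phi> \<in> {Bot} \<union> (\<lambda>(t, u). Eq t u) ` (?T \<times> ?T) \<union>
        (\<lambda>(q, ts). Rel q ts) ` (R \<times> lists ?T) \<union> Neg ` ?P n \<union>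
        (\<lambda>(\<phi>, \<psi>). Conj \<phi> \<psi>) ` (?P n \<times> ?P n) \<union> (\<lambda>(s, \<phi>). Ex s \<phi>) ` (S \<times> ?P n)"
      proof (cases \<phi>)
        case (Rel q ts)
        then have "ts \<in> lists ?T" "q \<in> R" using \<phi> by auto
        then show ?thesis using Rel by force
      qed (use \<phi> in force)+
    qed
    then show ?case
      by (rule le_subset) (intro le_Un le_image le_Times assms le_lists le_terms Suc le_finite finite.intros)
  qed
  then have "|\<Union>n. ?P n| \<le>o r" by (rule le_UN_nat)
  then show ?thesis by (rule le_subset[rotated]) auto
qed

end

text \<open>The context is kept because definition schemes and Skolem functions are indexed by
  formulas in a context, and one formula may be well-formed in many.\<close>

definition sorted_formulas :: "('s, 'f, 'r) lang \<Rightarrow> ('s list \<times> ('s, 'f, 'r) fm) set" where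
  "sorted_formulas L = {(\<Gamma>, \<phi>). \<Gamma> \<in> lists (sorts L) \<and> \<phi> \<in> formulas L \<Gamma>}"

lemma has_sort_funs: "has_sort L \<Gamma> t s \<Longrightarrow> set_tm t \<subseteq> funs L"
proof (induction rule: has_sort.induct)
  case (has_sort_Fun f ts)
  then show ?case by (fastforce simp: list_all2_conv_all_nth in_set_conv_nth)
qed simp

lemma wf_fm_symbols:
  "wf_fm L \<Gamma> \<phi> \<Longrightarrow> set1_fm \<phi> \<subseteq> sorts L \<and> set2_fm \<phi> \<subseteq> funs L \<and> set3_fm \<phi> \<subseteq> rels L"
proof (induction \<phi> arbitrary: \<Gamma>)
  case (Eq t u)
  then show ?case by (auto dest: has_sort_funs)
next
  case (Rel q ts)
  have "set_tm t \<subseteq> funs L" if "t \<in> set ts" for t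
    using that Rel by (auto simp: list_all2_conv_all_nth in_set_conv_nth dest!: has_sort_funs)
  then show ?case using Rel by auto
next
  case (Conj \<phi> \<psi>)
  then show ?case using Conj.IH(1)[of \<Gamma>] Conj.IH(2)[of \<Gamma>] by simp
next
  case (Ex s \<phi>)
  then show ?case using Ex.IH[of "s # \<Gamma>"] by simp
qed auto

lemma (in infinite_cardinal) le_sorted_formulas:
  assumes "|sorts L| \<le>o r" "|funs L| \<le>o r" "|rels L| \<le>o r"
  shows "|sorted_formulas L| \<le>o r"
proof (rule le_subset)
  show "sorted_formulas L \<subseteq> lists (sorts L) \<times>
    {\<phi>. set1_fm \<phi> \<subseteq> sorts L \<and> set2_fm \<phi> \<subseteq> funs L \<and> set3_fm \<phi> \<subseteq> rels L}"
    using wf_fm_symbols by (fastforce simp: sorted_formulas_def formulas_def)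
qed (intro le_Times le_lists le_fms assms)

lemma size_funpow_Neg: "size ((Neg ^^ n) Bot) = Suc n"
  by (induction n) auto

text \<open>\<open>Bot\<close> is a formula in any context over any language, and its iterated
  negations have different sizes.\<close>

lemma infinite_formulas: "infinite (formulas L \<Gamma>)"
proof
  assume "finite (formulas L \<Gamma>)"
  moreover have "(Neg ^^ n) Bot \<in> formulas L \<Gamma>" for n
    by (induction n) (auto simp: formulas_def)
  ultimately have "finite (range (\<lambda>n. (Neg ^^ n) Bot :: ('a, 'b, 'c) fm))"
    by (metis (no_types, lifting) finite_subset image_subsetI)
  moreover have "inj (\<lambda>n. (Neg ^^ n) Bot :: ('a, 'b, 'c) fm)"
    by (rule injI) (metis size_funpow_Neg Suc_inject)
  ultimately show False using finite_imageD infinite_UNIV_nat by blast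
qed

lemma infinite_sorted_formulas: "infinite (sorted_formulas L)"
proof
  assume "finite (sorted_formulas L)"
  then have "finite (snd ` sorted_formulas L)" by (rule finite_imageI)
  moreover have "formulas L [] \<subseteq> snd ` sorted_formulas L" by (force simp: sorted_formulas_def)
  ultimately show False using infinite_formulas finite_subset by blast
qed

lemma infinite_all_formulas: "infinite (all_formulas L)"
proof -
  have "formulas L [] \<subseteq> all_formulas L" unfolding all_formulas_def by blast
  then show ?thesis using infinite_formulas infinite_super by blast
qed

lemma infinite_cardinal_card_of: "infinite S \<Longrightarrow> infinite_cardinal |S|"
  using card_of_Card_order[of S] by (simp add: infinite_cardinal_def Field_card_of)

section \<open>The downward Loewenheim-Skolem theorem\<close>

context fo_structure
begin

definition witness :: "'s \<Rightarrow> ('s, 'f, 'r) fm \<Rightarrow> 'a list \<Rightarrow> 'a" where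
  "witness s \<phi> xs = (SOME x. x \<in> carr M s \<and> sat M (x # xs) \<phi>)"

primrec hull :: "('s \<Rightarrow> 'a set) \<Rightarrow> nat \<Rightarrow> 's \<Rightarrow> 'a set" where
  "hull A 0 = A"
| "hull A (Suc n) = (\<lambda>s. hull A n s \<union> {witness s \<phi> xs | \<phi> \<Gamma> xs. \<Gamma> \<in> lists (sorts L) \<and>
     \<phi> \<in> formulas L (s # \<Gamma>) \<and> xs \<in> tuples (hull A n) \<Gamma> \<and> (\<exists>x\<in>carr M s. sat M (x # xs) \<phi>)})"

lemma witness:
  assumes "\<exists>x\<in>carr M s. sat M (x # xs) \<phi>"
  shows "witness s \<phi> xs \<in> carr M s" "sat M (witness s \<phi> xs # xs) \<phi>"
proof -
  have "witness s \<phi> xs \<in> carr M s \<and> sat M (witness s \<phi> xs # xs) \<phi>"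
    unfolding witness_def by (rule someI_ex) (use assms in blast)
  then show "witness s \<phi> xs \<in> carr M s" "sat M (witness s \<phi> xs # xs) \<phi>" by auto
qed

lemma hull_mono: "m \<le> n \<Longrightarrow> hull A m s \<subseteq> hull A n s"
  by (rule lift_Suc_mono_le[of "\<lambda>n. hull A n s"]) auto

lemma hull_carr: "(\<And>s. s \<in> sorts L \<Longrightarrow> A s \<subseteq> carr M s) \<Longrightarrow> s \<in> sorts L \<Longrightarrow> hull A n s \<subseteq> carr M s"
  by (induction n) (auto intro!: witness(1))

lemma hull_tuple:
  "xs \<in> tuples (\<lambda>s. \<Union>n. hull A n s) \<Gamma> \<Longrightarrow> \<exists>n. xs \<in> tuples (hull A n) \<Gamma>"
proof (induction \<Gamma> arbitrary: xs)
  case (Cons s \<Gamma>)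
  obtain y ys where xs: "xs = y # ys" using Cons.prems by (cases xs) (auto simp: tuples_def)
  with Cons.prems have "y \<in> (\<Union>n. hull A n s)" "ys \<in> tuples (\<lambda>s. \<Union>n. hull A n s) \<Gamma>" by auto
  with Cons.IH obtain m n where mn: "y \<in> hull A m s" "ys \<in> tuples (hull A n) \<Gamma>" by blast
  have "y \<in> hull A (max m n) s" using mn(1) hull_mono[of m "max m n" A s] by auto
  moreover have "ys \<in> tuples (hull A (max m n)) \<Gamma>"
    using mn(2) hull_mono[of n "max m n" A] by (auto simp: tuples_iff)
  ultimately show ?case using xs by auto
qed auto

text \<open>A new witness is determined by its sort, a formula in its context and a finite list of
  old elements; forgetting the sorts of the latter only enlarges the count.\<close>

lemma (in infinite_cardinal) le_hull:
  assumes "fo_structure L M" "|sorts L| \<le>o r" "|sorted_formulas L| \<le>o r" "|Sigma (sorts L) A| \<le>o r"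
  shows "|Sigma (sorts L) (fo_structure.hull L M A n)| \<le>o r"
proof (induction n)
  case 0
  then show ?case using assms by (simp add: fo_structure.hull.simps)
next
  case (Suc n)
  interpret fo_structure L M by (rule assms(1))
  let ?H = "Sigma (sorts L) (hull A n)"
  have "Sigma (sorts L) (hull A (Suc n)) \<subseteq> ?H \<union>
    (\<lambda>(s, (\<Gamma>, \<phi>), xs). (s, witness s \<phi> xs)) ` (sorts L \<times> sorted_formulas L \<times> lists (snd ` ?H))"
  proof
    fix p assume p: "p \<in> Sigma (sorts L) (hull A (Suc n))"
    show "p \<in> ?H \<union>
      (\<lambda>(s, (\<Gamma>, \<phi>), xs). (s, witness s \<phi> xs)) ` (sorts L \<times> sorted_formulas L \<times> lists (snd ` ?H))"
    proof (cases "p \<in> ?H")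
      case False
      then obtain s \<Gamma> \<phi> xs where 1: "s \<in> sorts L" "\<Gamma> \<in> lists (sorts L)" "\<phi> \<in> formulas L (s # \<Gamma>)"
        "xs \<in> tuples (hull A n) \<Gamma>" "p = (s, witness s \<phi> xs)"
        using p by auto
      have "x \<in> snd ` ?H" if x: "x \<in> set xs" for x
      proof -
        obtain i where "i < length \<Gamma>" "x = xs ! i"
          using x 1(4) by (auto simp: in_set_conv_nth tuples_iff)
        then have "(\<Gamma> ! i, x) \<in> ?H" using 1(2,4) by (auto simp: tuples_iff lists_eq_set)
        then show ?thesis by force
      qed
      moreover have "(s # \<Gamma>, \<phi>) \<in> sorted_formulas L"
        using 1 by (auto simp: sorted_formulas_def)
      ultimately have "(s, (s # \<Gamma>, \<phi>), xs) \<in> sorts L \<times> sorted_formulas L \<times> lists (snd ` ?H)"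
        using 1(1) by auto
      then show ?thesis using 1(5) by (intro UnI2 image_eqI[of _ _ "(s, (s # \<Gamma>, \<phi>), xs)"]) auto
    qed simp
  qed
  then show ?case
    by (rule le_subset) (intro le_Un le_image le_Times le_lists assms Suc)
qed

lemma tarski_vaught:
  assumes sub: "\<And>s. s \<in> sorts L \<Longrightarrow> B s \<subseteq> carr M s" and wf: "wf_lang L"
    and closed: "\<And>s \<Gamma> \<phi> xs. s \<in> sorts L \<Longrightarrow> \<Gamma> \<in> lists (sorts L) \<Longrightarrow> wf_fm L (s # \<Gamma>) \<phi> \<Longrightarrow>
      xs \<in> tuples B \<Gamma> \<Longrightarrow> \<exists>x\<in>carr M s. sat M (x # xs) \<phi> \<Longrightarrow> \<exists>x\<in>B s. sat M (x # xs) \<phi>"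
  shows "elementary_substruc L (M\<lparr>carr := B\<rparr>) M"
proof -
  let ?M = "M\<lparr>carr := B\<rparr>"
  have eval: "eval ?M xs t = eval M xs t" for xs t
    by (induction t) (simp_all cong: map_cong)
  then have eval': "eval ?M = eval M" by blast
  have sat: "sat ?M xs \<phi> \<longleftrightarrow> sat M xs \<phi>"
    if "wf_fm L \<Gamma> \<phi>" "\<Gamma> \<in> lists (sorts L)" "xs \<in> tuples B \<Gamma>" for \<Gamma> \<phi> xs
    using that
  proof (induction \<phi> arbitrary: \<Gamma> xs)
    case (Ex s \<phi>)
    have "sat ?M (x # xs) \<phi> \<longleftrightarrow> sat M (x # xs) \<phi>" if "x \<in> B s" for x
      using Ex that by (intro Ex.IH[of "s # \<Gamma>"]) auto
    then have "sat ?M xs (Ex s \<phi>) \<longleftrightarrow> (\<exists>x\<in>B s. sat M (x # xs) \<phi>)" by auto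
    also have "\<dots> \<longleftrightarrow> sat M xs (Ex s \<phi>)"
      using closed[of s \<Gamma> \<phi> xs] sub[of s] Ex.prems by auto
    finally show ?case .
  qed (auto simp: eval')
  have "is_struc L ?M"
    unfolding is_struc_def
  proof (intro conjI ballI)
    fix s assume s: "s \<in> sorts L"
    \<comment> \<open>\<open>Neg Bot\<close> always holds, so its witness shows that B meets the
      sort.\<close>
    then have "\<exists>x\<in>carr M s. sat M [x] (Neg Bot)" using struc by (auto simp: is_struc_def)
    then show "carr ?M s \<noteq> {}" using closed[of s "[]" "Neg Bot" "[]"] s by auto
  next
    fix f xs assume f: "f \<in> funs L" and xs: "xs \<in> tuples (carr ?M) (fst (fun_type L f))"
    define \<Gamma> s where "\<Gamma> = fst (fun_type L f)" and "s = snd (fun_type L f)"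
    have \<Gamma>s: "\<Gamma> \<in> lists (sorts L)" "s \<in> sorts L" using wf f by (auto simp: wf_lang_def \<Gamma>_def s_def)
    \<comment> \<open>Closure of B under f is the witness property for the formula x = f(y), whose
      only solution is the value of f.\<close>
    let ?t = "Fun f (map (\<lambda>i. Var (Suc i)) [0..<length \<Gamma>])"
    let ?\<phi> = "Eq (Var 0) ?t"
    have "has_sort L (s # \<Gamma>) (Var 0) s" using has_sort_Var[of 0 "s # \<Gamma>" L] by simp
    moreover have "has_sort L (s # \<Gamma>) ?t s"
      unfolding s_def
    proof (rule has_sort_Fun[OF f])
      show "list_all2 (has_sort L (snd (fun_type L f) # \<Gamma>)) (map (\<lambda>i. Var (Suc i)) [0..<length \<Gamma>]) (fst (fun_type L f))"
        using has_sort_Var[of "Suc _" "s # \<Gamma>" L] by (auto simp: list_all2_conv_all_nth \<Gamma>_def[symmetric] s_def[symmetric])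
    qed
    ultimately have wf\<phi>: "wf_fm L (s # \<Gamma>) ?\<phi>" using \<Gamma>s by auto
    have xs': "xs \<in> tuples B \<Gamma>" using xs by (simp add: \<Gamma>_def)
    then have "length xs = length \<Gamma>" by (rule tuples_length)
    then have "map (\<lambda>i. (x # xs) ! Suc i) [0..<length \<Gamma>] = xs" for x
      by (metis (no_types, lifting) map_cong map_nth nth_Cons_Suc)
    then have sat\<phi>: "sat M (x # xs) ?\<phi> \<longleftrightarrow> x = fun_int M f xs" for x by (simp add: o_def)
    have "xs \<in> tuples (carr M) \<Gamma>" using xs' \<Gamma>s(1) sub by (rule tuples_mono)
    then have "fun_int M f xs \<in> carr M s" using struc f by (auto simp: is_struc_def \<Gamma>_def s_def)
    then have "\<exists>x\<in>B s. sat M (x # xs) ?\<phi>"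
      using closed[OF \<Gamma>s(2,1) wf\<phi> xs'] sat\<phi> by blast
    then show "fun_int ?M f xs \<in> carr ?M (snd (fun_type L f))" using sat\<phi> by (auto simp: s_def)
  qed
  then show ?thesis using sat sub by (auto simp: elementary_substruc_def formulas_def)
qed

theorem downward_loewenheim_skolem:
  assumes wf: "wf_lang L" and \<kappa>: "Card_order \<kappa>" "infinite (Field \<kappa>)"
    and card: "|sorts L| <o \<kappa>" "|sorted_formulas L| <o \<kappa>"
    and A: "\<And>s. s \<in> sorts L \<Longrightarrow> A s \<subseteq> carr M s" "small \<kappa> L A"
  obtains M\<^sub>0 where "elementary_substruc L M\<^sub>0 M" "small \<kappa> L (carr M\<^sub>0)"
    "\<And>s. A s \<subseteq> carr M\<^sub>0 s"
proof -
  define B where "B s = (\<Union>n. hull A n s)" for s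
  show thesis
  proof
    show "elementary_substruc L (M\<lparr>carr := B\<rparr>) M"
    proof (rule tarski_vaught[OF _ wf])
      show "B s \<subseteq> carr M s" if "s \<in> sorts L" for s
        using hull_carr[OF A(1) that] by (auto simp: B_def)
    next
      fix s \<Gamma> \<phi> xs
      assume 1: "s \<in> sorts L" "\<Gamma> \<in> lists (sorts L)" "wf_fm L (s # \<Gamma>) \<phi>" "xs \<in> tuples B \<Gamma>"
        "\<exists>x\<in>carr M s. sat M (x # xs) \<phi>"
      then obtain n where "xs \<in> tuples (hull A n) \<Gamma>" using hull_tuple[of xs A \<Gamma>] by (auto simp: B_def[abs_def])
      then have "witness s \<phi> xs \<in> hull A (Suc n) s"
        using 1 unfolding hull.simps formulas_def by blast
      then have "witness s \<phi> xs \<in> B s" unfolding B_def by blast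
      then show "\<exists>x\<in>B s. sat M (x # xs) \<phi>" using witness(2)[OF 1(5)] by blast
    qed
    \<comment> \<open>One infinite cardinal strictly below \<kappa> bounds every stage, so the union
      of all stages stays below \<kappa> even if \<kappa> is singular.\<close>
    let ?r = "|sorts L <+> sorted_formulas L <+> Sigma (sorts L) A|"
    interpret infinite_cardinal ?r
      by (rule infinite_cardinal_card_of) (simp add: infinite_sorted_formulas)
    have "|sorts L| \<le>o ?r" by (rule card_of_Plus1)
    moreover have "|sorted_formulas L| \<le>o ?r"
      using card_of_Plus1 card_of_Plus2 ordLeq_transitive by blast
    moreover have "|Sigma (sorts L) A| \<le>o ?r"
      using card_of_Plus2 card_of_Plus2 ordLeq_transitive by blast
    ultimately have "|Sigma (sorts L) (hull A n)| \<le>o ?r" for n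
      by (rule le_hull[OF fo_structure_axioms])
    then have "|\<Union>n. Sigma (sorts L) (hull A n)| \<le>o ?r" by (rule le_UN_nat)
    moreover have "(\<Union>n. Sigma (sorts L) (hull A n)) = Sigma (sorts L) B" by (auto simp: B_def)
    moreover have "?r <o \<kappa>"
      using card A(2) unfolding small_def
      by (intro card_of_Plus_ordLess_infinite_Field[OF \<kappa>(2,1)])
    ultimately show "small \<kappa> L (carr (M\<lparr>carr := B\<rparr>))"
      using ordLeq_ordLess_trans by (auto simp: small_def)
    show "A s \<subseteq> carr (M\<lparr>carr := B\<rparr>) s" for s
    proof -
      have "hull A 0 s \<subseteq> B s" unfolding B_def by blast
      then show ?thesis by simp
    qed
  qed
qed

text \<open>Each pair (\<Delta>, \<phi>) contributes finitely many schemes and each scheme finitely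
  many parameters, so there are at most as many parameters as formulas in context, hence fewer than
  \<kappa>.\<close>

lemma dfg_filter_imp_dfg:
  assumes wf: "wf_lang L" and \<kappa>: "Card_order \<kappa>" "infinite (Field \<kappa>)"
    and card: "|sorts L| <o \<kappa>" "|sorted_formulas L| <o \<kappa>"
    and G: "definable_group L M \<Gamma> G" and U: "dfg_filter \<Gamma> G U"
  shows "dfg \<kappa> L M \<Gamma> G"
proof -
  interpret group G by (rule definable_group_group[OF G])
  note \<Gamma> = definable_group_sorts[OF G] and GT = definable_group_carrier[OF G]
  have ultra: "ultra U" and UG: "\<forall>\<^sub>F x in U. x \<in> carrier G" and dfil: "definable_filter \<Gamma> U"
    using U by (auto simp: dfg_filter_def)
  have UT: "\<forall>\<^sub>F x in U. x \<in> tuples (carr M) \<Gamma>" using UG by (rule eventually_mono) (use GT in auto)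
  define p where "p = {\<theta> \<in> param_formulas L (carr M) \<Gamma>. \<forall>\<^sub>F x in U. x \<in> solutions M \<Gamma> \<theta>}"
  have rep: "represents \<Gamma> U p" by (simp add: represents_def p_def)
  obtain \<theta> where \<theta>: "\<theta> \<in> param_formulas L (carr M) \<Gamma>" "carrier G = solutions M \<Gamma> \<theta>"
    using G by (auto simp: definable_group_def definable_over_def)
  then have "\<theta> \<in> p" using UG by (simp add: p_def)
  then have on: "type_on M \<Gamma> (carrier G) p" unfolding type_on_def using \<theta>(2)[symmetric] by (rule bexI[rotated])
  define I where "I = {(\<Delta>, \<phi>). \<Delta> \<in> lists (sorts L) \<and> \<phi> \<in> formulas L (\<Gamma> @ \<Delta>)}"
  have fin: "finite (scheme \<Gamma> G U \<Delta> \<phi> ` carrier G)" if "(\<Delta>, \<phi>) \<in> I" for \<Delta> \<phi>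
  proof -
    have "definable L M (\<Gamma> @ \<Delta>) (solset (\<Gamma> @ \<Delta>) \<phi>)" using that by (intro definable_solset) (simp add: I_def)
    then show ?thesis using U that unfolding dfg_filter_def scheme_def I_def by blast
  qed
  have def: "definable L M \<Delta> (scheme \<Gamma> G U \<Delta> \<phi> g)" if "(\<Delta>, \<phi>) \<in> I" and g: "g \<in> carrier G" for \<Delta> \<phi> g
  proof -
    have \<Delta>: "\<Delta> \<in> lists (sorts L)" and \<phi>: "\<phi> \<in> formulas L (\<Gamma> @ \<Delta>)" using that by (auto simp: I_def)
    have gt: "g \<in> tuples (carr M) \<Gamma>" using g GT by auto
    have "dpred (carr M) (\<lambda>v. \<forall>\<^sub>F x in U. g \<in> carrier G \<and> x \<in> carrier G \<and>
        (g \<otimes>\<^bsub>G\<^esub> x) @ v (\<Delta>, 4) \<in> solset (\<Gamma> @ \<Delta>) \<phi>)"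
      using dpred_eventually[OF dpred_const[OF dpred_translate[OF G definable_solset[OF \<phi>] \<Delta>] \<Gamma> gt gt, of 0] \<Gamma> dfil UT, of 1]
      by simp
    from dpred_extract1[OF this \<Delta>]
    have "definable L M \<Delta> {b \<in> tuples (carr M) \<Delta>. \<forall>\<^sub>F x in U. g \<in> carrier G \<and> x \<in> carrier G \<and>
        (g \<otimes>\<^bsub>G\<^esub> x) @ b \<in> solset (\<Gamma> @ \<Delta>) \<phi>}" .
    moreover have "(\<forall>\<^sub>F x in U. g \<in> carrier G \<and> x \<in> carrier G \<and> (g \<otimes>\<^bsub>G\<^esub> x) @ b \<in> solset (\<Gamma> @ \<Delta>) \<phi>)
       \<longleftrightarrow> (\<forall>\<^sub>F x in U. (g \<otimes>\<^bsub>G\<^esub> x) @ b \<in> solset (\<Gamma> @ \<Delta>) \<phi>)" for b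
      by (rule eventually_cong[OF UG]) (use g in simp)
    ultimately show ?thesis by (simp add: scheme_def)
  qed
  define ok where "ok \<Delta> S A \<longleftrightarrow> finite (Sigma (sorts L) A) \<and> (\<forall>s. A s \<subseteq> carr M s) \<and>
      definable_over L M A \<Delta> S" for \<Delta> S A
  \<comment> \<open>Parameters are chosen for the scheme as a set, not for the group element:
    elements with the same scheme share them, and this keeps the total small.\<close>
  define par where "par \<Delta> S = (SOME A. ok \<Delta> S A)" for \<Delta> S
  have par: "finite (Sigma (sorts L) (par \<Delta> S)) \<and> (\<forall>s. par \<Delta> S s \<subseteq> carr M s) \<and>
      definable_over L M (par \<Delta> S) \<Delta> S" if S: "definable L M \<Delta> S" for \<Delta> S
  proof -
    obtain A where "finite (Sigma (sorts L) A)" "\<And>s. A s \<subseteq> carr M s" "definable_over L M A \<Delta> S"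
      by (rule definable_over_finite[OF S]) (rule that)
    then have "ok \<Delta> S A" by (simp add: ok_def)
    then have "ok \<Delta> S (par \<Delta> S)" unfolding par_def by (rule someI[of "ok \<Delta> S" A])
    then show ?thesis by (simp add: ok_def)
  qed
  define A where "A s = (\<Union>(\<Delta>, \<phi>)\<in>I. \<Union>S\<in>scheme \<Gamma> G U \<Delta> \<phi> ` carrier G. par \<Delta> S s)" for s
  have A_carr: "A s \<subseteq> carr M s" for s
    unfolding A_def using par[OF def] by blast
  have smallA: "small \<kappa> L A"
  proof -
    interpret infinite_cardinal "|sorted_formulas L|"
      by (rule infinite_cardinal_card_of[OF infinite_sorted_formulas])
    \<comment> \<open>Prefixing the fixed context \<Gamma> is injective and embeds the index set
      into the formulas in context.\<close>
    have "(\<lambda>(\<Delta>, \<phi>). (\<Gamma> @ \<Delta>, \<phi>)) ` I \<subseteq> sorted_formulas L"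
      using \<Gamma> by (auto simp: I_def sorted_formulas_def)
    moreover have "inj_on (\<lambda>(\<Delta>, \<phi>). (\<Gamma> @ \<Delta>, \<phi>)) I" by (auto simp: inj_on_def)
    ultimately have "|I| \<le>o |sorted_formulas L|" using card_of_ordLeq by blast
    then have "|\<Union>i\<in>I. \<Union>S\<in>scheme \<Gamma> G U (fst i) (snd i) ` carrier G. Sigma (sorts L) (par (fst i) S)|
        \<le>o |sorted_formulas L|"
    proof (rule le_UN)
      fix i assume i: "i \<in> I"
      show "|\<Union>S\<in>scheme \<Gamma> G U (fst i) (snd i) ` carrier G. Sigma (sorts L) (par (fst i) S)|
        \<le>o |sorted_formulas L|"
        by (rule le_finite, rule finite_UN_I) (use i fin par def in auto)
    qed
    moreover have "(\<Union>i\<in>I. \<Union>S\<in>scheme \<Gamma> G U (fst i) (snd i) ` carrier G. Sigma (sorts L) (par (fst i) S)) =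
        Sigma (sorts L) A" unfolding A_def case_prod_beta by blast
    ultimately show ?thesis using card(2) ordLeq_ordLess_trans by (auto simp: small_def)
  qed
  obtain M\<^sub>0 where M0: "elementary_substruc L M\<^sub>0 M" "small \<kappa> L (carr M\<^sub>0)" "\<And>s. A s \<subseteq> carr M\<^sub>0 s"
    by (rule downward_loewenheim_skolem[OF wf \<kappa> card A_carr smallA]) (rule that)
  have "definable_type L M (carr M\<^sub>0) \<Gamma> (left_translate L M \<Gamma> G g p)" if g: "g \<in> carrier G" for g
    unfolding definable_type_def
  proof (intro ballI)
    fix \<Delta> \<phi> assume \<Delta>: "\<Delta> \<in> lists (sorts L)" and \<phi>: "\<phi> \<in> formulas L (\<Gamma> @ \<Delta>)"
    then have I: "(\<Delta>, \<phi>) \<in> I" by (simp add: I_def)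
    let ?S = "scheme \<Gamma> G U \<Delta> \<phi> g"
    have "par \<Delta> ?S s \<subseteq> A s" for s using I g by (auto simp: A_def)
    then have "definable_over L M (carr M\<^sub>0) \<Delta> ?S"
      using par[OF def[OF I g]] M0(3) by (meson definable_over_mono order_trans)
    moreover have "{b \<in> tuples (carr M) \<Delta>. (\<phi>, b) \<in> left_translate L M \<Gamma> G g p} = ?S"
      using left_translate_iff[OF G rep UG g \<phi> \<Delta>] by (auto simp: scheme_def)
    ultimately show "definable_over L M (carr M\<^sub>0) \<Delta>
        {b \<in> tuples (carr M) \<Delta>. (\<phi>, b) \<in> left_translate L M \<Gamma> G g p}" by simp
  qed
  then show ?thesis
    unfolding dfg_def using ultrafilter_type[OF ultra UT, of "carr M", folded p_def] on M0 by blast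
qed

end

section \<open>Compactness of the structure of imaginaries\<close>

context fo_structure
begin

text \<open>Without a finite subcover the complements generate a proper filter. An ultrafilter
  refining it gives a complete type over A, and a realization lies outside all members of the
  cover.\<close>

lemma saturated_compact_covers:
  assumes "saturated \<kappa> L M" shows "compact_covers \<kappa>"
  unfolding compact_covers_def
proof (intro allI impI ballI)
  fix A \<Gamma> \<D>
  assume A: "\<forall>s\<in>sorts L. A s \<subseteq> carr M s" "small \<kappa> L A" and \<Gamma>: "\<Gamma> \<in> lists (sorts L)"
    and \<D>: "\<forall>X\<in>\<D>. definable_over L M A \<Gamma> X" "tuples (carr M) \<Gamma> \<subseteq> \<Union>\<D>"
  show "\<exists>\<D>'\<subseteq>\<D>. finite \<D>' \<and> tuples (carr M) \<Gamma> \<subseteq> \<Union>\<D>'"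
  proof (rule ccontr)
    assume no: "\<not> ?thesis"
    have "(INF X\<in>\<D>. principal (tuples (carr M) \<Gamma> - X)) \<noteq> bot"
    proof (rule INF_filter_not_bot)
      fix \<D>' assume "\<D>' \<subseteq> \<D>" "finite \<D>'"
      then obtain x where "x \<in> tuples (carr M) \<Gamma>" "x \<notin> \<Union>\<D>'" using no by blast
      then show "(INF X\<in>\<D>'. principal (tuples (carr M) \<Gamma> - X)) \<noteq> bot"
        using \<open>finite \<D>'\<close> by (auto simp: INF_principal_finite principal_eq_bot_iff)
    qed
    then obtain U where U: "U \<le> (INF X\<in>\<D>. principal (tuples (carr M) \<Gamma> - X))" "ultra U"
      by (rule ultra_exists)
    have UX: "\<forall>\<^sub>F x in U. x \<in> tuples (carr M) \<Gamma> - X" if "X \<in> \<D>" for X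
      using U(1) that by (simp only: le_INF_iff le_principal)
    \<comment> \<open>The cover is nonempty, as the empty family would be a finite subcover; one
      member is needed to see that U concentrates on tuples of the right sorts.\<close>
    obtain X0 where "X0 \<in> \<D>" using no \<D>(2) by blast
    from UX[OF this] have "\<forall>\<^sub>F x in U. x \<in> tuples (carr M) \<Gamma>"
      by (rule eventually_mono) blast
    from assms[unfolded saturated_def, rule_format, OF _ A(2) \<Gamma> ultrafilter_type[OF U(2) this, of A]] A(1)
    obtain x where x: "x \<in> tuples (carr M) \<Gamma>"
      "\<forall>\<theta>\<in>{\<theta> \<in> param_formulas L A \<Gamma>. \<forall>\<^sub>F x in U. x \<in> solutions M \<Gamma> \<theta>}. x \<in> solutions M \<Gamma> \<theta>"
      by blast
    obtain X where X: "X \<in> \<D>" "x \<in> X" using x(1) \<D>(2) by blast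
    then have "definable_over L M A \<Gamma> (tuples (carr M) \<Gamma> - X)"
      using \<D>(1) definable_over_compl by blast
    then obtain \<theta> where "\<theta> \<in> param_formulas L A \<Gamma>" "tuples (carr M) \<Gamma> - X = solutions M \<Gamma> \<theta>"
      by (auto simp: definable_over_def)
    then have "x \<in> tuples (carr M) \<Gamma> - X" using bspec[OF x(2), of \<theta>] UX[OF X(1)] by simp
    then show False using X(2) by simp
  qed
qed

lemma eval_carr:
  assumes "has_sort L \<Gamma> t s" "xs \<in> tuples (carr M) \<Gamma>"
  shows "eval M xs t \<in> carr M s"
  using assms(1)
proof (induction rule: has_sort.induct)
  case (has_sort_Var i)
  then show ?case using assms(2) by (simp add: tuples_iff)
next
  case (has_sort_Fun f ts)
  then have "map (eval M xs) ts \<in> tuples (carr M) (fst (fun_type L f))"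
    by (auto simp: tuples_iff list_all2_conv_all_nth)
  then show ?case using has_sort_Fun(1) struc by (auto simp: is_struc_def)
qed

section \<open>Coding imaginaries by tuples of home sorts\<close>

primrec homes :: "('s, 'f, 'r) eq_sort \<Rightarrow> 's list" where
  "homes (Home s) = [s]"
| "homes (Quot \<Gamma> \<epsilon>) = \<Gamma>"

text \<open>Decoding is the quotient map from a product of home sorts onto a sort of
  \<open>M\<^sup>e\<^sup>q\<close>. A home sort is treated alike, coded by lists of length
  one.\<close>

primrec dec :: "('s, 'f, 'r) eq_sort \<Rightarrow> 'a list \<Rightarrow> 'a eq_elem" where
  "dec (Home s) xs = Real (hd xs)"
| "dec (Quot \<Gamma> \<epsilon>) xs = Imag (fm_rel M \<Gamma> \<epsilon> `` {xs})"

abbreviation "Leq \<equiv> eq_lang L M"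
abbreviation "Meq \<equiv> eq_struc M"

lemma eq_sort_cases:
  assumes "S \<in> sorts Leq"
  obtains s where "S = Home s" "s \<in> sorts L"
  | \<Gamma> \<epsilon> where "S = Quot \<Gamma> \<epsilon>" "(\<Gamma>, \<epsilon>) \<in> equiv_formulas L M"
  using assms by (auto simp: eq_lang_def)

lemma homes_sorts: "S \<in> sorts Leq \<Longrightarrow> homes S \<in> lists (sorts L)"
  by (erule eq_sort_cases) (auto simp: equiv_formulas_def)

lemma tuples_single: "tuples A [s] = (\<lambda>x. [x]) ` A s"
  by (auto simp: tuples_def list_all2_Cons2)

lemma dec_image: "S \<in> sorts Leq \<Longrightarrow> dec S ` tuples (carr M) (homes S) = carr Meq S"
  by (erule eq_sort_cases)
    (auto simp: eq_struc_def tuples_single image_image quotient_def)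

lemma dec_carr: "S \<in> sorts Leq \<Longrightarrow> x \<in> tuples (carr M) (homes S) \<Longrightarrow> dec S x \<in> carr Meq S"
  using dec_image by blast

lemma map_Home_sorts: "\<Gamma> \<in> lists (sorts L) \<Longrightarrow> map Home \<Gamma> \<in> lists (sorts Leq)"
  by (auto simp: eq_lang_def lists_eq_set)

lemma wf_eq_lang:
  assumes "wf_lang L" shows "wf_lang Leq"
  unfolding wf_lang_def
proof (intro conjI ballI)
  fix f assume f: "f \<in> funs Leq"
  have "fst (fun_type Leq f) \<in> lists (sorts Leq) \<and> snd (fun_type Leq f) \<in> sorts Leq"
  proof (cases f)
    case (Base g)
    then have "g \<in> funs L" using f by (auto simp: eq_lang_def)
    then have "fst (fun_type L g) \<in> lists (sorts L)" "snd (fun_type L g) \<in> sorts L"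
      using assms unfolding wf_lang_def by blast+
    moreover have "fun_type Leq f = (map Home (fst (fun_type L g)), Home (snd (fun_type L g)))"
      using Base by (simp add: eq_lang_def)
    moreover have "Home s \<in> sorts Leq \<longleftrightarrow> s \<in> sorts L" for s by (auto simp: eq_lang_def)
    ultimately show ?thesis using map_Home_sorts by simp
  next
    case (Proj \<Gamma> \<epsilon>)
    then have "(\<Gamma>, \<epsilon>) \<in> equiv_formulas L M" using f by (auto simp: eq_lang_def)
    moreover from this have "\<Gamma> \<in> lists (sorts L)" by (simp add: equiv_formulas_def)
    moreover have "fun_type Leq f = (map Home \<Gamma>, Quot \<Gamma> \<epsilon>)" using Proj by (simp add: eq_lang_def)
    moreover have "Quot \<Gamma> \<epsilon> \<in> sorts Leq \<longleftrightarrow> (\<Gamma>, \<epsilon>) \<in> equiv_formulas L M" by (auto simp: eq_lang_def)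
    ultimately show ?thesis using map_Home_sorts by simp
  qed
  then show "fst (fun_type Leq f) \<in> lists (sorts Leq)" "snd (fun_type Leq f) \<in> sorts Leq" by auto
next
  fix q assume "q \<in> rels Leq"
  then have "q \<in> rels L" by (simp add: eq_lang_def)
  then have "rel_type L q \<in> lists (sorts L)" using assms unfolding wf_lang_def by blast
  then show "rel_type Leq q \<in> lists (sorts Leq)" using map_Home_sorts by (simp add: eq_lang_def)
qed

lemma tuples_Home: "xs \<in> tuples (carr Meq) (map Home \<Gamma>) \<longleftrightarrow> (\<exists>ys\<in>tuples (carr M) \<Gamma>. xs = map Real ys)"
proof (induction \<Gamma> arbitrary: xs)
  case (Cons s \<Gamma>)
  show ?case
  proof
    assume "xs \<in> tuples (carr Meq) (map Home (s # \<Gamma>))"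
    then obtain x xs' where 1: "xs = x # xs'" "x \<in> carr Meq (Home s)" "xs' \<in> tuples (carr Meq) (map Home \<Gamma>)"
      by (auto simp: tuples_def list_all2_Cons2)
    then obtain y ys where "x = Real y" "y \<in> carr M s" "ys \<in> tuples (carr M) \<Gamma>" "xs' = map Real ys"
      using Cons by (auto simp: eq_struc_def)
    then show "\<exists>ys\<in>tuples (carr M) (s # \<Gamma>). xs = map Real ys"
      using 1(1) by (intro bexI[of _ "y # ys"]) auto
  next
    assume "\<exists>ys\<in>tuples (carr M) (s # \<Gamma>). xs = map Real ys"
    then obtain y ys where "y \<in> carr M s" "ys \<in> tuples (carr M) \<Gamma>" "xs = Real y # map Real ys"
      by (auto simp: tuples_def list_all2_Cons2)
    then show "xs \<in> tuples (carr Meq) (map Home (s # \<Gamma>))"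
      using Cons by (auto simp: eq_struc_def)
  qed
qed auto

lemma un_Real_map [simp]: "map (un_Real \<circ> Real) xs = xs"
  by (induction xs) auto

lemma struc_eq: "is_struc Leq Meq"
  unfolding is_struc_def
proof (intro conjI ballI)
  fix S assume "S \<in> sorts Leq"
  then show "carr Meq S \<noteq> {}"
    using dec_image[of S] tuples_nonempty[OF homes_sorts[of S]] by auto
next
  fix f xs assume f: "f \<in> funs Leq" and xs: "xs \<in> tuples (carr Meq) (fst (fun_type Leq f))"
  show "fun_int Meq f xs \<in> carr Meq (snd (fun_type Leq f))"
  proof (cases f)
    case (Base g)
    then obtain ys where "ys \<in> tuples (carr M) (fst (fun_type L g))" "xs = map Real ys"
      using xs by (auto simp: eq_lang_def tuples_Home)
    moreover have "g \<in> funs L" using f Base by (auto simp: eq_lang_def)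
    ultimately show ?thesis using struc Base by (auto simp: eq_lang_def eq_struc_def is_struc_def)
  next
    case (Proj \<Gamma> \<epsilon>)
    then obtain ys where "ys \<in> tuples (carr M) \<Gamma>" "xs = map Real ys"
      using xs by (auto simp: eq_lang_def tuples_Home)
    then show ?thesis using Proj by (auto simp: eq_lang_def eq_struc_def quotient_def)
  qed
qed

lemma eval_eq_carr:
  "has_sort Leq \<Gamma> t S \<Longrightarrow> xs \<in> tuples (carr Meq) \<Gamma> \<Longrightarrow> eval Meq xs t \<in> carr Meq S"
  by (rule fo_structure.eval_carr[OF fo_structure.intro[OF struc_eq]])

text \<open>A variable (S, n) of \<open>M\<^sup>e\<^sup>q\<close> is simulated by
  (\<open>homes S\<close>, n). Different sorts may have the same home sorts, so freshness is always
  a matter of the number n.\<close>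

definition edec :: "('s list \<times> nat \<Rightarrow> 'a list) \<Rightarrow> (('s, 'f, 'r) eq_sort \<times> nat) list \<Rightarrow> 'a eq_elem list" where
  "edec v ks = map (\<lambda>(S, n). dec S (v (homes S, n))) ks"

lemma edec_Cons [simp]: "edec v ((S, n) # ks) = dec S (v (homes S, n)) # edec v ks"
  and edec_append: "edec v (ks @ ks') = edec v ks @ edec v ks'"
  by (simp_all add: edec_def)

lemma edec_upd: "n \<notin> snd ` set ks \<Longrightarrow> edec (v((\<Gamma>, n) := x)) ks = edec v ks"
  by (force simp: edec_def)

lemma edec_tuples:
  "env v \<Longrightarrow> fst ` set ks \<subseteq> sorts Leq \<Longrightarrow> edec v ks \<in> tuples (carr Meq) (map fst ks)"
proof (induction ks)
  case (Cons k ks)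
  obtain S n where k: "k = (S, n)" by (cases k)
  then have "S \<in> sorts Leq" using Cons.prems by simp
  then have "dec S (v (homes S, n)) \<in> carr Meq S"
    by (intro dec_carr envD[OF Cons.prems(1)] homes_sorts)
  then show ?case using Cons k by simp
qed (simp add: edec_def)

lemma fresh_var: "\<exists>n. n \<notin> snd ` set ks \<union> {a, b :: nat}"
  using ex_new_if_finite[of "snd ` set ks \<union> {a, b}"] by auto

lemma definable_formula:
  assumes "wf_fm L \<Gamma> \<phi>" "\<And>xs. xs \<in> tuples (carr M) \<Gamma> \<Longrightarrow> xs \<in> X \<longleftrightarrow> sat M xs \<phi>" "X \<subseteq> tuples (carr M) \<Gamma>"
  shows "definable_over L M A \<Gamma> X"
  by (rule definable_overI[where \<Theta> = "[]" and b = "[]" and \<phi> = \<phi>]) (use assms in auto)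

lemma dpred_formula:
  assumes "wf_fm L (concat (map fst ks)) \<phi>" "set ks \<subseteq> vars"
  shows "dpred A (\<lambda>v. sat M (concat (map v ks)) \<phi>)"
proof -
  have "definable_over L M A (concat (map fst ks)) {xs \<in> tuples (carr M) (concat (map fst ks)). sat M xs \<phi>}"
    by (rule definable_formula[OF assms(1)]) auto
  from dpred_atom[OF this assms(2)] show ?thesis
    by (rule dpred_cong) (use val_tuples[OF _ assms(2)] in \<open>auto simp: val_def ctx_def\<close>)
qed

lemma env_length: "env v \<Longrightarrow> \<Gamma> \<in> lists (sorts L) \<Longrightarrow> length (v (\<Gamma>, n)) = length \<Gamma>"
  using envD tuples_length by blast

text \<open>Two codes decode to the same element if and only if they are equal, for a home sort, or
  \<epsilon>-equivalent, for a quotient; both conditions are parameter-free, so A is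
  arbitrary.\<close>

lemma dpred_dec_eq:
  assumes S: "S \<in> sorts Leq"
  shows "dpred A (\<lambda>v. dec S (v (homes S, m)) = dec S (v (homes S, n)))"
  using S
proof (cases rule: eq_sort_cases)
  case (1 s)
  have "dpred A (\<lambda>v. sat M (concat (map v [([s], m), ([s], n)])) (Eq (Var 0) (Var 1)))"
    using 1(2) has_sort_Var[of 0 "[s, s]" L] has_sort_Var[of 1 "[s, s]" L]
    by (intro dpred_formula) auto
  then show ?thesis
  proof (rule dpred_cong)
    fix v assume "env v"
    then have "length (v ([s], i)) = Suc 0" for i using env_length[of v "[s]"] 1(2) by simp
    from this[of m] this[of n] obtain x y where "v ([s], m) = [x]" "v ([s], n) = [y]"
      by (auto simp: length_Suc_conv)
    then show "sat M (concat (map v [([s], m), ([s], n)])) (Eq (Var 0) (Var 1)) \<longleftrightarrow>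
        dec S (v (homes S, m)) = dec S (v (homes S, n))"
      by (simp add: 1(1))
  qed
next
  case (2 \<Gamma> \<epsilon>)
  then have \<Gamma>: "\<Gamma> \<in> lists (sorts L)" and \<epsilon>: "wf_fm L (\<Gamma> @ \<Gamma>) \<epsilon>"
    and equiv: "equiv (tuples (carr M) \<Gamma>) (fm_rel M \<Gamma> \<epsilon>)"
    by (auto simp: equiv_formulas_def formulas_def)
  have "dpred A (\<lambda>v. sat M (concat (map v [(\<Gamma>, m), (\<Gamma>, n)])) \<epsilon>)"
    using \<Gamma> \<epsilon> by (intro dpred_formula) auto
  then show ?thesis
  proof (rule dpred_cong)
    fix v assume v: "env v"
    note t = envD[OF v \<Gamma>, of m] envD[OF v \<Gamma>, of n]
    have "dec S (v (homes S, m)) = dec S (v (homes S, n)) \<longleftrightarrow> (v (\<Gamma>, m), v (\<Gamma>, n)) \<in> fm_rel M \<Gamma> \<epsilon>"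
      using eq_equiv_class_iff[OF equiv t] equiv_class_eq_iff[OF equiv] t by (auto simp: 2(1))
    then show "sat M (concat (map v [(\<Gamma>, m), (\<Gamma>, n)])) \<epsilon> \<longleftrightarrow>
        dec S (v (homes S, m)) = dec S (v (homes S, n))"
      using t by (simp add: fm_rel_def)
  qed
qed

lemma dpred_nth:
  assumes "\<Gamma> \<in> lists (sorts L)" "i < length \<Gamma>"
  shows "dpred A (\<lambda>v. v (\<Gamma>, p) ! i = hd (v ([\<Gamma> ! i], q)))"
proof -
  have s: "\<Gamma> ! i \<in> sorts L" using assms by (auto simp: lists_eq_set)
  have "has_sort L (\<Gamma> @ [\<Gamma> ! i]) (Var i) (\<Gamma> ! i)" "has_sort L (\<Gamma> @ [\<Gamma> ! i]) (Var (length \<Gamma>)) (\<Gamma> ! i)"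
    using has_sort_Var[of i "\<Gamma> @ [\<Gamma> ! i]" L] has_sort_Var[of "length \<Gamma>" "\<Gamma> @ [\<Gamma> ! i]" L] assms(2)
    by (auto simp: nth_append)
  then have "dpred A (\<lambda>v. sat M (concat (map v [(\<Gamma>, p), ([\<Gamma> ! i], q)])) (Eq (Var i) (Var (length \<Gamma>))))"
    using assms(1) s by (intro dpred_formula) auto
  then show ?thesis
  proof (rule dpred_cong)
    fix v assume v: "env v"
    have "length (v (\<Gamma>, p)) = length \<Gamma>" "length (v ([\<Gamma> ! i], q)) = Suc 0"
      using env_length[OF v assms(1)] env_length[OF v, of "[\<Gamma> ! i]"] s by auto
    then show "sat M (concat (map v [(\<Gamma>, p), ([\<Gamma> ! i], q)])) (Eq (Var i) (Var (length \<Gamma>))) \<longleftrightarrow>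
        v (\<Gamma>, p) ! i = hd (v ([\<Gamma> ! i], q))"
      using assms(2) by (auto simp: nth_append length_Suc_conv)
  qed
qed

lemma map_nth_append: "length ys = n \<Longrightarrow> map ((!) (ys @ zs)) [0..<n] = ys"
  by (auto intro!: nth_equalityI simp: nth_append)

lemma has_sort_vars:
  "list_all2 (has_sort L (\<Gamma> @ \<Delta>)) (map Var [0..<length \<Gamma>]) \<Gamma>"
  unfolding list_all2_conv_all_nth
proof (intro conjI allI impI)
  fix i assume "i < length (map Var [0..<length \<Gamma>])"
  then show "has_sort L (\<Gamma> @ \<Delta>) (map Var [0..<length \<Gamma>] ! i) (\<Gamma> ! i)"
    using has_sort_Var[of i "\<Gamma> @ \<Delta>" L] by (simp add: nth_append)
qed simp

lemma dpred_fun: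
  assumes "wf_lang L" "f \<in> funs L" "fst (fun_type L f) = \<Gamma>" "snd (fun_type L f) = s"
  shows "dpred A (\<lambda>v. fun_int M f (v (\<Gamma>, p)) = hd (v ([s], n)))"
proof -
  have \<Gamma>: "\<Gamma> \<in> lists (sorts L)" and s: "s \<in> sorts L"
    using assms unfolding wf_lang_def by auto
  have "has_sort L (\<Gamma> @ [s]) (Fun f (map Var [0..<length \<Gamma>])) s"
    using has_sort_Fun[OF assms(2), of "\<Gamma> @ [s]" "map Var [0..<length \<Gamma>]"] assms(3,4) has_sort_vars
    by auto
  moreover have "has_sort L (\<Gamma> @ [s]) (Var (length \<Gamma>)) s"
    using has_sort_Var[of "length \<Gamma>" "\<Gamma> @ [s]" L] by simp
  ultimately have "dpred A (\<lambda>v. sat M (concat (map v [(\<Gamma>, p), ([s], n)]))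
      (Eq (Fun f (map Var [0..<length \<Gamma>])) (Var (length \<Gamma>))))"
    using \<Gamma> s by (intro dpred_formula) auto
  then show ?thesis
  proof (rule dpred_cong)
    fix v assume v: "env v"
    have len: "length (v (\<Gamma>, p)) = length \<Gamma>" by (rule env_length[OF v \<Gamma>])
    have "length (v ([s], n)) = Suc 0" using env_length[OF v, of "[s]"] s by simp
    then obtain y where y: "v ([s], n) = [y]" by (auto simp: length_Suc_conv)
    have "(v (\<Gamma>, p) @ [y]) ! length \<Gamma> = y" by (metis len nth_append_length)
    with y map_nth_append[OF len, of "[y]"] show "sat M (concat (map v [(\<Gamma>, p), ([s], n)])) (Eq (Fun f (map Var [0..<length \<Gamma>])) (Var (length \<Gamma>))) \<longleftrightarrow>
        fun_int M f (v (\<Gamma>, p)) = hd (v ([s], n))"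
      by (simp add: o_def)
  qed
qed

lemma dpred_rel:
  assumes "wf_lang L" "q \<in> rels L" "rel_type L q = \<Gamma>"
  shows "dpred A (\<lambda>v. rel_int M q (v (\<Gamma>, p)))"
proof -
  have \<Gamma>: "\<Gamma> \<in> lists (sorts L)" using assms unfolding wf_lang_def by auto
  have "dpred A (\<lambda>v. sat M (concat (map v [(\<Gamma>, p)])) (Rel q (map Var [0..<length \<Gamma>])))"
    using \<Gamma> assms has_sort_vars[of \<Gamma> "[]"] by (intro dpred_formula) auto
  then show ?thesis
  proof (rule dpred_cong)
    fix v assume v: "env v"
    show "sat M (concat (map v [(\<Gamma>, p)])) (Rel q (map Var [0..<length \<Gamma>])) \<longleftrightarrow> rel_int M q (v (\<Gamma>, p))"
      using map_nth_append[OF env_length[OF v \<Gamma>], of p "[]"] by (simp add: o_def)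
  qed
qed

lemma dpred_args:
  assumes \<Gamma>: "\<Gamma> \<in> lists (sorts L)" and len: "length ts = length \<Gamma>"
    and ts: "\<And>i n. i < length \<Gamma> \<Longrightarrow> dpred A (\<lambda>v. eval Meq (edec v ks) (ts ! i) = dec (Home (\<Gamma> ! i)) (v ([\<Gamma> ! i], n)))"
  shows "dpred A (\<lambda>v. map (eval Meq (edec v ks)) ts = map Real (v (\<Gamma>, p)))"
proof -
  obtain q where q: "q \<notin> snd ` set ks \<union> {p, p}" using fresh_var by blast
  have "dpred A (\<lambda>v. \<forall>i\<in>{..<length \<Gamma>}. \<exists>x\<in>tuples (carr M) [\<Gamma> ! i].
      eval Meq (edec v ks) (ts ! i) = dec (Home (\<Gamma> ! i)) x \<and> v (\<Gamma>, p) ! i = hd x)"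
  proof (rule dpred_ball_finite)
    fix i assume i: "i \<in> {..<length \<Gamma>}"
    then have s: "[\<Gamma> ! i] \<in> lists (sorts L)" using \<Gamma> by (auto simp: lists_eq_set)
    have "dpred A (\<lambda>v. eval Meq (edec v ks) (ts ! i) = dec (Home (\<Gamma> ! i)) (v ([\<Gamma> ! i], q)) \<and>
        v (\<Gamma>, p) ! i = hd (v ([\<Gamma> ! i], q)))"
      using i by (intro dpred_conj ts dpred_nth[OF \<Gamma>]) auto
    from dpred_ex[OF this s, of q]
    show "dpred A (\<lambda>v. \<exists>x\<in>tuples (carr M) [\<Gamma> ! i].
        eval Meq (edec v ks) (ts ! i) = dec (Home (\<Gamma> ! i)) x \<and> v (\<Gamma>, p) ! i = hd x)"
      by (rule dpred_cong) (use q in \<open>simp add: edec_upd\<close>)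
  qed simp
  then show ?thesis
  proof (rule dpred_cong)
    fix v assume v: "env v"
    have vt: "v (\<Gamma>, p) \<in> tuples (carr M) \<Gamma>" by (rule envD[OF v \<Gamma>])
    have "(\<exists>x\<in>tuples (carr M) [\<Gamma> ! i]. eval Meq (edec v ks) (ts ! i) = dec (Home (\<Gamma> ! i)) x \<and>
        v (\<Gamma>, p) ! i = hd x) \<longleftrightarrow> eval Meq (edec v ks) (ts ! i) = Real (v (\<Gamma>, p) ! i)"
      if "i < length \<Gamma>" for i
      using vt that by (auto simp: tuples_single tuples_iff)
    then show "(\<forall>i\<in>{..<length \<Gamma>}. \<exists>x\<in>tuples (carr M) [\<Gamma> ! i].
        eval Meq (edec v ks) (ts ! i) = dec (Home (\<Gamma> ! i)) x \<and> v (\<Gamma>, p) ! i = hd x) \<longleftrightarrow>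
        map (eval Meq (edec v ks)) ts = map Real (v (\<Gamma>, p))"
      using len tuples_length[OF vt] by (auto simp: list_eq_iff_nth_eq)
  qed
qed

text \<open>A term of \<open>M\<^sup>e\<^sup>q\<close> need not correspond to a term of M, so its
  graph is translated instead. All arguments of symbols are real and are bound as one tuple y; a
  projection applied to y has y itself as a code of its value.\<close>

lemma dpred_eq_term:
  assumes wf: "wf_lang L" and ks: "fst ` set ks \<subseteq> sorts Leq"
    and t: "has_sort Leq (map fst ks) t S"
  shows "dpred A (\<lambda>v. eval Meq (edec v ks) t = dec S (v (homes S, n)))"
  using t
proof (induction arbitrary: n rule: has_sort.induct)
  case (has_sort_Var i)
  let ?S = "fst (ks ! i)"
  have "?S \<in> sorts Leq" using ks has_sort_Var by auto
  from dpred_dec_eq[OF this, of A "snd (ks ! i)" n] show ?case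
    using has_sort_Var by (simp add: edec_def split_beta)
next
  case (has_sort_Fun f ts)
  obtain p where p: "p \<notin> snd ` set ks \<union> {n, n}" using fresh_var by blast
  define \<Gamma> where "\<Gamma> = (case f of Base g \<Rightarrow> fst (fun_type L g) | Proj \<Gamma> \<epsilon> \<Rightarrow> \<Gamma>)"
  have \<Gamma>: "\<Gamma> \<in> lists (sorts L)" "fst (fun_type Leq f) = map Home \<Gamma>"
    using has_sort_Fun(1) wf
    by (auto simp: \<Gamma>_def eq_lang_def equiv_formulas_def wf_lang_def split: eq_fun.splits)
  have len: "length ts = length \<Gamma>" using has_sort_Fun(2) \<Gamma>(2) by (auto dest: list_all2_lengthD)
  have sorts_ts: "has_sort Leq (map fst ks) (ts ! i) (Home (\<Gamma> ! i))" if "i < length \<Gamma>" for i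
    using has_sort_Fun(2) \<Gamma>(2) that by (auto simp: list_all2_conv_all_nth)
  have args: "dpred A (\<lambda>v. map (eval Meq (edec v ks)) ts = map Real (v (\<Gamma>, p)))"
  proof (rule dpred_args[OF \<Gamma>(1) len])
    fix i m assume "i < length \<Gamma>"
    then show "dpred A (\<lambda>v. eval Meq (edec v ks) (ts ! i) = dec (Home (\<Gamma> ! i)) (v ([\<Gamma> ! i], m)))"
      using has_sort_Fun(2) \<Gamma>(2) by (auto simp: list_all2_conv_all_nth)
  qed
  define S where "S = snd (fun_type Leq f)"
  have graph: "dpred A (\<lambda>v. fun_int Meq f (map Real (v (\<Gamma>, p))) = dec S (v (homes S, n)))"
  proof (cases f)
    case (Base g)
    then have g: "g \<in> funs L" "fst (fun_type L g) = \<Gamma>" "S = Home (snd (fun_type L g))"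
      using has_sort_Fun(1) by (auto simp: \<Gamma>_def S_def eq_lang_def)
    then show ?thesis
      using dpred_fun[OF wf g(1,2), of "snd (fun_type L g)" A p n] Base by (simp add: eq_struc_def)
  next
    case (Proj \<Gamma>' \<epsilon>)
    then have "\<Gamma>' = \<Gamma>" "S = Quot \<Gamma> \<epsilon>" "S \<in> sorts Leq"
      using has_sort_Fun(1) by (auto simp: \<Gamma>_def S_def eq_lang_def)
    then show ?thesis using dpred_dec_eq[of S A p n] Proj by (simp add: eq_struc_def)
  qed
  from dpred_ex[OF dpred_conj[OF args graph] \<Gamma>(1), of p]
  have "dpred A (\<lambda>v. \<exists>y\<in>tuples (carr M) \<Gamma>. map (eval Meq (edec v ks)) ts = map Real y \<and>
      fun_int Meq f (map Real y) = dec S (v (homes S, n)))"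
    by (rule dpred_cong) (use p in \<open>simp add: edec_upd\<close>)
  then show ?case
    unfolding S_def[symmetric]
  proof (rule dpred_cong)
    fix v assume v: "env v"
    have "map (eval Meq (edec v ks)) ts \<in> tuples (carr Meq) (map Home \<Gamma>)"
      using eval_eq_carr[OF sorts_ts edec_tuples[OF v ks]] len by (auto simp: tuples_iff)
    then obtain y where "y \<in> tuples (carr M) \<Gamma>" "map (eval Meq (edec v ks)) ts = map Real y"
      by (auto simp: tuples_Home)
    then show "(\<exists>y\<in>tuples (carr M) \<Gamma>. map (eval Meq (edec v ks)) ts = map Real y \<and>
      fun_int Meq f (map Real y) = dec S (v (homes S, n))) \<longleftrightarrow>
      eval Meq (edec v ks) (Fun f ts) = dec S (v (homes S, n))"
      by auto
  qed
qed

text \<open>Since \<open>dec S\<close> is onto, a quantifier over S becomes a quantifier over the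
  home sorts; atomic formulas are reduced to graphs of terms.\<close>

lemma dpred_eq_formula:
  assumes wf: "wf_lang L" and "fst ` set ks \<subseteq> sorts Leq" and "wf_fm Leq (map fst ks) \<phi>"
  shows "dpred A (\<lambda>v. sat Meq (edec v ks) \<phi>)"
  using assms(2,3)
proof (induction \<phi> arbitrary: ks)
  case Bot
  then show ?case by (simp add: dpred_const_prop)
next
  case (Eq t u)
  then obtain S where S: "S \<in> sorts Leq" "has_sort Leq (map fst ks) t S" "has_sort Leq (map fst ks) u S"
    by auto
  obtain n where n: "n \<notin> snd ` set ks \<union> {0, 0}" using fresh_var by blast
  note tm = dpred_eq_term[OF wf Eq.prems(1)]
  from dpred_ex[OF dpred_conj[OF tm[OF S(2), of A n] tm[OF S(3), of A n]] homes_sorts[OF S(1)], of n]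
  have "dpred A (\<lambda>v. \<exists>x\<in>tuples (carr M) (homes S). eval Meq (edec v ks) t = dec S x \<and> eval Meq (edec v ks) u = dec S x)"
    by (rule dpred_cong) (use n in \<open>simp add: edec_upd\<close>)
  then show ?case
  proof (rule dpred_cong)
    fix v assume v: "env v"
    have "eval Meq (edec v ks) t \<in> dec S ` tuples (carr M) (homes S)"
      using eval_eq_carr[OF S(2) edec_tuples[OF v Eq.prems(1)]] by (simp add: dec_image[OF S(1)])
    then show "(\<exists>x\<in>tuples (carr M) (homes S). eval Meq (edec v ks) t = dec S x \<and> eval Meq (edec v ks) u = dec S x) \<longleftrightarrow>
        sat Meq (edec v ks) (Eq t u)"
      by auto
  qed
next
  case (Rel q ts)
  define \<Gamma> where "\<Gamma> = rel_type L q"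
  have q: "q \<in> rels L" and ts: "list_all2 (has_sort Leq (map fst ks)) ts (map Home \<Gamma>)"
    using Rel.prems(2) by (auto simp: eq_lang_def \<Gamma>_def)
  have \<Gamma>: "\<Gamma> \<in> lists (sorts L)" using wf q unfolding wf_lang_def \<Gamma>_def by auto
  have len: "length ts = length \<Gamma>" using ts by (auto dest: list_all2_lengthD)
  have sorts_ts: "has_sort Leq (map fst ks) (ts ! i) (Home (\<Gamma> ! i))" if "i < length \<Gamma>" for i
    using ts that by (auto simp: list_all2_conv_all_nth)
  obtain p where p: "p \<notin> snd ` set ks \<union> {0, 0}" using fresh_var by blast
  have "dpred A (\<lambda>v. map (eval Meq (edec v ks)) ts = map Real (v (\<Gamma>, p)))"
    using dpred_eq_term[OF wf Rel.prems(1) sorts_ts] by (intro dpred_args[OF \<Gamma> len]) simp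
  from dpred_ex[OF dpred_conj[OF this dpred_rel[OF wf q \<Gamma>_def[symmetric], of A p]] \<Gamma>, of p]
  have "dpred A (\<lambda>v. \<exists>y\<in>tuples (carr M) \<Gamma>. map (eval Meq (edec v ks)) ts = map Real y \<and> rel_int M q y)"
    by (rule dpred_cong) (use p in \<open>simp add: edec_upd\<close>)
  then show ?case
  proof (rule dpred_cong)
    fix v assume v: "env v"
    have "map (eval Meq (edec v ks)) ts \<in> tuples (carr Meq) (map Home \<Gamma>)"
      using eval_eq_carr[OF sorts_ts edec_tuples[OF v Rel.prems(1)]] len by (auto simp: tuples_iff)
    then obtain y where y: "y \<in> tuples (carr M) \<Gamma>" "map (eval Meq (edec v ks)) ts = map Real y"
      by (auto simp: tuples_Home)
    have "(map Real y = map Real z) = (y = z)" for z :: "'a list"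
      by (simp add: inj_map_eq_map inj_def)
    then show "(\<exists>y\<in>tuples (carr M) \<Gamma>. map (eval Meq (edec v ks)) ts = map Real y \<and> rel_int M q y) \<longleftrightarrow>
        sat Meq (edec v ks) (Rel q ts)"
      using y by (simp add: eq_struc_def)
  qed
next
  case (Neg \<phi>)
  then show ?case using dpred_neg[of A "\<lambda>v. sat Meq (edec v ks) \<phi>"] by simp
next
  case (Conj \<phi> \<psi>)
  then show ?case using dpred_conj[of A "\<lambda>v. sat Meq (edec v ks) \<phi>" "\<lambda>v. sat Meq (edec v ks) \<psi>"] by simp
next
  case (Ex S \<phi>)
  then have S: "S \<in> sorts Leq" by simp
  obtain n where n: "n \<notin> snd ` set ks \<union> {0, 0}" using fresh_var by blast
  have "dpred A (\<lambda>v. sat Meq (edec v ((S, n) # ks)) \<phi>)" using Ex by (intro Ex.IH) auto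
  from dpred_ex[OF this homes_sorts[OF S], of n]
  show ?case
    by (rule dpred_cong) (use n in \<open>simp add: edec_upd dec_image[OF S, symmetric]\<close>)
qed

end

context fo_structure
begin

lemma val_inj:
  assumes "env v" "env w" "set ks \<subseteq> vars" "val v ks = val w ks" "k \<in> set ks"
  shows "v k = w k"
  using assms(3-5)
proof (induction ks)
  case (Cons j ks)
  then have j: "j \<in> vars" by simp
  then have "v j \<in> tuples (carr M) (fst j)" "w j \<in> tuples (carr M) (fst j)"
    using assms(1,2) unfolding env_def by blast+
  from tuples_append_eq_iff[OF this] Cons.prems(2) have "v j = w j" "val v ks = val w ks"
    by (auto simp: val_ctx)
  then show ?case using Cons by auto
qed simp

text \<open>One parameter at a time is turned into a fresh variable, and this variable is then fixed
  at a code of the parameter.\<close>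

lemma dpred_eq_param:
  assumes wf: "wf_lang L" and b: "b \<in> tuples B \<Theta>" "\<Theta> \<in> lists (sorts Leq)"
    and rep: "\<And>S a. S \<in> sorts Leq \<Longrightarrow> a \<in> B S \<Longrightarrow> rep S a \<in> tuples A (homes S) \<and>
      rep S a \<in> tuples (carr M) (homes S) \<and> dec S (rep S a) = a"
    and ks: "fst ` set ks \<subseteq> sorts Leq" and \<phi>: "wf_fm Leq (map fst ks @ \<Theta>) \<phi>"
  shows "dpred A (\<lambda>v. sat Meq (edec v ks @ b) \<phi>)"
  using b ks \<phi>
proof (induction \<Theta> arbitrary: ks b)
  case Nil
  then show ?case using dpred_eq_formula[OF wf] by simp
next
  case (Cons S \<Theta>)
  then have S: "S \<in> sorts Leq" by simp
  obtain a b' where b: "b = a # b'" "a \<in> B S" "b' \<in> tuples B \<Theta>"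
    using Cons.prems(1) by (auto simp: tuples_def list_all2_Cons2)
  obtain n where n: "n \<notin> snd ` set ks \<union> {0, 0}" using fresh_var by blast
  have "dpred A (\<lambda>v. sat Meq (edec v (ks @ [(S, n)]) @ b') \<phi>)"
    using Cons.prems b S by (intro Cons.IH) auto
  from dpred_const[OF this homes_sorts[OF S], of "rep S a" n] rep[OF S b(2)]
  show ?case using n b(1) by (simp add: edec_append edec_upd) (simp add: edec_def)
qed

text \<open>Members of a cover pull back to sets of codes, definable over codes of the parameters. A
  finite subcover there yields one of \<open>M\<^sup>e\<^sup>q\<close> because every tuple of
  imaginaries has a code.\<close>

theorem eq_compact_covers:
  assumes wf: "wf_lang L" and \<kappa>: "Card_order \<kappa>" "infinite (Field \<kappa>)" "|all_formulas L| <o \<kappa>"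
    and sat: "saturated \<kappa> L M"
  shows "fo_structure.compact_covers Leq Meq \<kappa>"
proof -
  interpret E: fo_structure Leq Meq by unfold_locales (rule struc_eq)
  show ?thesis
    unfolding E.compact_covers_def
  proof (intro allI impI ballI)
    fix B \<Gamma> \<D>
    assume B: "\<forall>S\<in>sorts Leq. B S \<subseteq> carr Meq S" "small \<kappa> Leq B" and \<Gamma>: "\<Gamma> \<in> lists (sorts Leq)"
      and \<D>: "\<forall>X\<in>\<D>. definable_over Leq Meq B \<Gamma> X" "tuples (carr Meq) \<Gamma> \<subseteq> \<Union>\<D>"
    define rep where "rep S a = (SOME x. x \<in> tuples (carr M) (homes S) \<and> dec S x = a)" for S a
    have rep: "rep S a \<in> tuples (carr M) (homes S)" "dec S (rep S a) = a"
      if "S \<in> sorts Leq" "a \<in> carr Meq S" for S a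
    proof -
      have "a \<in> dec S ` tuples (carr M) (homes S)" using dec_image[OF that(1)] that(2) by simp
      then have "\<exists>x. x \<in> tuples (carr M) (homes S) \<and> dec S x = a" by auto
      from someI_ex[OF this] show "rep S a \<in> tuples (carr M) (homes S)" "dec S (rep S a) = a"
        by (auto simp: rep_def)
    qed
    define A where "A s = (\<Union>(S, a)\<in>Sigma (sorts Leq) B. tuple_set (homes S) (rep S a) s)" for s
    have A: "\<forall>s\<in>sorts L. A s \<subseteq> carr M s"
      using tuple_set_subset[OF rep(1)] B(1) unfolding A_def by blast
    have smallA: "small \<kappa> L A"
    proof -
      \<comment> \<open>Each parameter has a code of finite length; the second summand makes the
        bound infinite and leaves it below \<kappa>.\<close>
      let ?r = "|Sigma (sorts Leq) B <+> all_formulas L|"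
      interpret infinite_cardinal ?r
        by (rule infinite_cardinal_card_of) (simp add: infinite_all_formulas)
      have "|\<Union>(S, a)\<in>Sigma (sorts Leq) B. Sigma (sorts L) (tuple_set (homes S) (rep S a))| \<le>o ?r"
        by (rule le_UN[OF card_of_Plus1]) (auto intro: le_finite[OF finite_tuple_set])
      moreover have "(\<Union>(S, a)\<in>Sigma (sorts Leq) B. Sigma (sorts L) (tuple_set (homes S) (rep S a))) =
          Sigma (sorts L) A" unfolding A_def case_prod_beta by blast
      moreover have "?r <o \<kappa>"
        using B(2) \<kappa>(3) unfolding small_def by (rule card_of_Plus_ordLess_infinite_Field[OF \<kappa>(2,1)])
      ultimately show ?thesis using ordLeq_ordLess_trans by (auto simp: small_def)
    qed
    have rep_A: "rep S a \<in> tuples A (homes S) \<and> rep S a \<in> tuples (carr M) (homes S) \<and> dec S (rep S a) = a"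
      if "S \<in> sorts Leq" "a \<in> B S" for S a
    proof -
      have a: "a \<in> carr Meq S" using that B(1) by blast
      have "tuple_set (homes S) (rep S a) s \<subseteq> A s" for s using that unfolding A_def by blast
      then have "rep S a \<in> tuples A (homes S)"
        using tuple_set_tuples[OF rep(1)[OF that(1) a]] by (auto simp: tuples_iff)
      then show ?thesis using rep[OF that(1) a] by simp
    qed
    \<comment> \<open>Coordinates are named by their positions, which keeps the variables distinct
      even if home sorts coincide.\<close>
    define ks where "ks = zip \<Gamma> [0..<length \<Gamma>]"
    have ks: "map fst ks = \<Gamma>" "map snd ks = [0..<length \<Gamma>]" by (simp_all add: ks_def)
    have ks_sorts: "fst ` set ks \<subseteq> sorts Leq" using \<Gamma> ks(1) by (metis in_listsD list.set_map subsetI)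
    define hk where "hk = map (\<lambda>(S, n). (homes S, n)) ks"
    have "map snd hk = map snd ks" by (auto simp: hk_def)
    then have hk_dist: "distinct hk" using ks(2) distinct_map[of snd hk] by simp
    have hk_vars: "set hk \<subseteq> vars"
      using ks_sorts homes_sorts by (fastforce simp: hk_def)
    define pull where "pull X = {val v hk | v. env v \<and> edec v ks \<in> X}" for X
    have edec_cong: "edec v ks = edec w ks" if "env v" "env w" "val v hk = val w hk" for v w
    proof -
      have "v (homes S, n) = w (homes S, n)" if "(S, n) \<in> set ks" for S n
      proof (rule val_inj[OF \<open>env v\<close> \<open>env w\<close> hk_vars \<open>val v hk = val w hk\<close>])
        show "(homes S, n) \<in> set hk" using that by (force simp: hk_def)
      qed
      then show ?thesis by (auto simp: edec_def)
    qed
    have pull_iff: "val v hk \<in> pull X \<longleftrightarrow> edec v ks \<in> X" if v: "env v" for v X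
    proof
      assume "val v hk \<in> pull X"
      then obtain w where "env w" "edec w ks \<in> X" "val v hk = val w hk" by (auto simp: pull_def)
      then show "edec v ks \<in> X" using edec_cong[OF v] by simp
    qed (use v in \<open>auto simp: pull_def\<close>)
    have "definable_over L M A (ctx hk) (pull X)" if X: "X \<in> \<D>" for X
    proof -
      obtain \<phi> b \<Theta> where 1: "\<Theta> \<in> lists (sorts Leq)" "wf_fm Leq (\<Gamma> @ \<Theta>) \<phi>" "b \<in> tuples B \<Theta>"
        "X = {xs \<in> tuples (carr Meq) \<Gamma>. sat Meq (xs @ b) \<phi>}"
        using E.definable_overE[OF \<D>(1)[rule_format, OF X]] .
      have "dpred A (\<lambda>v. sat Meq (edec v ks @ b) \<phi>)"
        by (rule dpred_eq_param[OF wf 1(3,1) rep_A ks_sorts]) (simp_all add: ks 1(2))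
      then show ?thesis
      proof (rule dpred_extract[OF _ hk_dist hk_vars])
        show "pull X \<subseteq> tuples (carr M) (ctx hk)" using val_tuples[OF _ hk_vars] by (auto simp: pull_def)
        fix v assume v: "env v"
        show "sat Meq (edec v ks @ b) \<phi> \<longleftrightarrow> val v hk \<in> pull X"
          using edec_tuples[OF v ks_sorts] by (simp add: pull_iff[OF v] 1(4) ks)
      qed
    qed
    moreover have "tuples (carr M) (ctx hk) \<subseteq> \<Union>(pull ` \<D>)"
    proof
      fix z assume "z \<in> tuples (carr M) (ctx hk)"
      then obtain v where v: "env v" "val v hk = z" using val_surj[OF hk_dist] by blast
      then obtain X where "X \<in> \<D>" "edec v ks \<in> X"
        using edec_tuples[OF v(1) ks_sorts] \<D>(2) by (auto simp: ks)
      then show "z \<in> \<Union>(pull ` \<D>)" using pull_iff[OF v(1)] v(2) by auto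
    qed
    ultimately obtain \<E> where "\<E> \<subseteq> pull ` \<D>" "finite \<E>" "tuples (carr M) (ctx hk) \<subseteq> \<Union>\<E>"
      using saturated_compact_covers[OF sat, unfolded compact_covers_def, rule_format,
        OF _ smallA ctx_sorts[OF hk_vars], of "pull ` \<D>"] A by blast
    then obtain \<D>' where \<D>': "\<D>' \<subseteq> \<D>" "finite \<D>'" "tuples (carr M) (ctx hk) \<subseteq> \<Union>(pull ` \<D>')"
      by (metis finite_subset_image)
    have "tuples (carr Meq) \<Gamma> \<subseteq> \<Union>\<D>'"
    proof
      fix y assume y: "y \<in> tuples (carr Meq) \<Gamma>"
      obtain v0 where v0: "env v0" using env_exists by blast
      define v where "v k = (if k \<in> set hk then rep (\<Gamma> ! snd k) (y ! snd k) else v0 k)" for k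
      have hk_iff: "k \<in> set hk \<longleftrightarrow> (\<exists>i<length \<Gamma>. k = (homes (\<Gamma> ! i), i))" for k
        by (force simp: hk_def ks_def set_zip)
      have rep_y: "rep (\<Gamma> ! i) (y ! i) \<in> tuples (carr M) (homes (\<Gamma> ! i))" "dec (\<Gamma> ! i) (rep (\<Gamma> ! i) (y ! i)) = y ! i"
        if "i < length \<Gamma>" for i
      proof -
        have "\<Gamma> ! i \<in> sorts Leq" using \<Gamma> that nth_mem by fast
        moreover have "y ! i \<in> carr Meq (\<Gamma> ! i)" using y that by (simp add: tuples_iff)
        ultimately show "rep (\<Gamma> ! i) (y ! i) \<in> tuples (carr M) (homes (\<Gamma> ! i))"
          "dec (\<Gamma> ! i) (rep (\<Gamma> ! i) (y ! i)) = y ! i" by (fact rep)+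
      qed
      have v: "env v"
        unfolding env_def
      proof
        fix k assume "k \<in> vars"
        then have "v0 k \<in> tuples (carr M) (fst k)" using v0 unfolding env_def by blast
        then show "v k \<in> tuples (carr M) (fst k)" using rep_y unfolding v_def by (auto simp: hk_iff)
      qed
      have "edec v ks = y"
      proof (rule nth_equalityI)
        show "length (edec v ks) = length y" using y by (simp add: edec_def ks_def tuples_iff)
        fix i assume "i < length (edec v ks)"
        then have i: "i < length \<Gamma>" by (simp add: edec_def ks_def)
        then have "(homes (\<Gamma> ! i), i) \<in> set hk" using hk_iff by blast
        then show "edec v ks ! i = y ! i" using i rep_y(2) by (simp add: edec_def ks_def v_def)
      qed
      moreover obtain X where "X \<in> \<D>'" "val v hk \<in> pull X"
        using \<D>'(3) val_tuples[OF v hk_vars] by auto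
      ultimately show "y \<in> \<Union>\<D>'" using pull_iff[OF v] by auto
    qed
    then show "\<exists>\<D>'\<subseteq>\<D>. finite \<D>' \<and> tuples (carr Meq) \<Gamma> \<subseteq> \<Union>\<D>'" using \<D>' by blast
  qed
qed

text \<open>Each symbol is recovered from a formula that contains it, so the bound on the number of
  formulas in \<open>monster\<close> bounds the language too.\<close>

lemma all_formulas_symbols:
  assumes "wf_lang L"
  shows "|sorts L| \<le>o |all_formulas L|" "|funs L| \<le>o |all_formulas L|" "|rels L| \<le>o |all_formulas L|"
proof -
  have "Ex s Bot \<in> all_formulas L" if "s \<in> sorts L" for s
    using that by (auto simp: all_formulas_def formulas_def intro!: bexI[of _ "[]"])
  then have "(\<lambda>s. Ex s Bot) ` sorts L \<subseteq> all_formulas L" by blast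
  moreover have "inj_on (\<lambda>s. Ex s Bot) (sorts L)" by (auto simp: inj_on_def)
  ultimately show "|sorts L| \<le>o |all_formulas L|" using card_of_ordLeq by blast
  define t where "t f = Fun f (map Var [0..<length (fst (fun_type L f))])" for f
  have "Eq (t f) (t f) \<in> all_formulas L" if f: "f \<in> funs L" for f
  proof -
    have "fst (fun_type L f) \<in> lists (sorts L)" "snd (fun_type L f) \<in> sorts L"
      using assms f unfolding wf_lang_def by blast+
    moreover have "has_sort L (fst (fun_type L f)) (t f) (snd (fun_type L f))"
      unfolding t_def using has_sort_Fun[OF f] has_sort_vars[of "fst (fun_type L f)" "[]"] by simp
    ultimately show ?thesis unfolding all_formulas_def formulas_def by auto
  qed
  then have "(\<lambda>f. Eq (t f) (t f)) ` funs L \<subseteq> all_formulas L" by blast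
  moreover have "inj_on (\<lambda>f. Eq (t f) (t f)) (funs L)" by (auto simp: inj_on_def t_def)
  ultimately show "|funs L| \<le>o |all_formulas L|" using card_of_ordLeq by blast
  define u :: "'r \<Rightarrow> ('s, 'f, 'r) fm" where "u q = Rel q (map Var [0..<length (rel_type L q)])" for q
  have "u q \<in> all_formulas L" if q: "q \<in> rels L" for q
  proof -
    have "rel_type L q \<in> lists (sorts L)" using assms q unfolding wf_lang_def by blast
    moreover have "wf_fm L (rel_type L q) (u q)"
      using q has_sort_vars[of "rel_type L q" "[]"] by (simp add: u_def)
    ultimately show ?thesis unfolding all_formulas_def formulas_def by blast
  qed
  then have "u ` rels L \<subseteq> all_formulas L" by blast
  moreover have "inj_on u (rels L)" by (auto simp: inj_on_def u_def)
  ultimately show "|rels L| \<le>o |all_formulas L|" using card_of_ordLeq by blast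
qed

text \<open>The new sorts and projections are indexed by contexts and formulas of L, so imaginaries
  do not enlarge the language beyond the number of formulas.\<close>

lemma eq_lang_card:
  assumes "wf_lang L"
  shows "|sorts Leq| \<le>o |all_formulas L|" "|sorted_formulas Leq| \<le>o |all_formulas L|"
proof -
  interpret infinite_cardinal "|all_formulas L|"
    by (rule infinite_cardinal_card_of[OF infinite_all_formulas])
  note sym = all_formulas_symbols[OF assms]
  have "equiv_formulas L M \<subseteq> lists (sorts L) \<times> all_formulas L"
  proof clarify
    fix \<Gamma> \<epsilon> assume "(\<Gamma>, \<epsilon>) \<in> equiv_formulas L M"
    then have "\<Gamma> \<in> lists (sorts L)" "\<Gamma> @ \<Gamma> \<in> lists (sorts L)" "\<epsilon> \<in> formulas L (\<Gamma> @ \<Gamma>)"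
      by (auto simp: equiv_formulas_def)
    then show "\<Gamma> \<in> lists (sorts L) \<and> \<epsilon> \<in> all_formulas L" unfolding all_formulas_def by blast
  qed
  then have ef: "|equiv_formulas L M| \<le>o |all_formulas L|"
    by (rule le_subset) (intro le_Times le_lists sym card_of_refl[THEN ordIso_imp_ordLeq])
  show S: "|sorts Leq| \<le>o |all_formulas L|"
    unfolding eq_lang_def by (simp, intro le_Un le_image sym ef)
  have F: "|funs Leq| \<le>o |all_formulas L|"
    unfolding eq_lang_def by (simp, intro le_Un le_image sym ef)
  have R: "|rels Leq| \<le>o |all_formulas L|" using sym(3) by (simp add: eq_lang_def)
  show "|sorted_formulas Leq| \<le>o |all_formulas L|" by (rule le_sorted_formulas[OF S F R])
qed

end

section \<open>Extensions of interpretable groups with definable f-generics\<close>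

lemma (in fo_structure) dfg_extension_theorem:
  assumes wf: "wf_lang L" and \<kappa>: "Card_order \<kappa>" "infinite (Field \<kappa>)"
    and card: "|sorts L| <o \<kappa>" "|sorted_formulas L| <o \<kappa>" and cc: "compact_covers \<kappa>"
    and N: "definable_group L M \<Gamma>N N" and G: "definable_group L M \<Gamma>G G" and H: "definable_group L M \<Gamma>H H"
    and \<iota>: "definable_map L M \<Gamma>N \<Gamma>G (carrier N) \<iota>" and \<pi>: "definable_map L M \<Gamma>G \<Gamma>H (carrier G) \<pi>"
    and seq: "short_exact_sequence H G N \<pi> \<iota>"
    and "dfg \<kappa> L M \<Gamma>N N" "dfg \<kappa> L M \<Gamma>H H"
  shows "dfg \<kappa> L M \<Gamma>G G"
proof -
  obtain V R where V: "dfg_filter \<Gamma>N N V" and R: "dfg_filter \<Gamma>H H R"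
    using dfg_imp_dfg_filter[OF \<kappa> cc] N H assms(13,14) by blast
  have hom: "\<pi> \<in> hom G H" "\<pi> ` carrier G = carrier H" "\<iota> \<in> hom N G" "kernel G H \<pi> = \<iota> ` carrier N"
    using seq by (auto simp: short_exact_sequence_iff epi_def mon_def)
  \<comment> \<open>Preimages of R-large sets meet G because \<pi> is onto H; W is any ultrafilter
    refining them within G.\<close>
  have "inf (filtercomap \<pi> R) (principal (carrier G)) \<noteq> bot"
  proof
    assume "inf (filtercomap \<pi> R) (principal (carrier G)) = bot"
    then have "eventually (\<lambda>g. g \<notin> carrier G) (filtercomap \<pi> R)"
      by (simp add: trivial_limit_def eventually_inf_principal)
    then obtain Q where Q: "\<forall>\<^sub>F h in R. Q h" "\<And>g. Q (\<pi> g) \<Longrightarrow> g \<notin> carrier G"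
      by (auto simp: eventually_filtercomap)
    have "\<forall>\<^sub>F h in R. h \<in> carrier H" "R \<noteq> bot" using R by (auto simp: dfg_filter_def ultra_not_bot)
    then obtain h where "h \<in> carrier H" "Q h"
      using eventually_happens'[OF _ eventually_conj[OF Q(1)], of "\<lambda>h. h \<in> carrier H"] by blast
    then have "h \<in> \<pi> ` carrier G" using hom(2) by simp
    then show False using Q(2) \<open>Q h\<close> by auto
  qed
  then obtain W where W: "W \<le> inf (filtercomap \<pi> R) (principal (carrier G))" "ultra W"
    by (rule ultra_exists)
  interpret dfg_extension L M \<Gamma>N \<Gamma>G \<Gamma>H N G H \<iota> \<pi> V R W
  proof unfold_locales
    show "\<forall>\<^sub>F g in W. g \<in> carrier G"
      using W(1) by (simp add: le_principal)
    fix Q assume "\<forall>\<^sub>F h in R. Q h"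
    then have "\<forall>\<^sub>F g in filtercomap \<pi> R. Q (\<pi> g)" by (rule eventually_filtercomapI)
    then show "\<forall>\<^sub>F g in W. Q (\<pi> g)" using W(1) by (meson filter_leD le_inf_iff)
  qed (fact N G H \<iota> \<pi> hom V R W)+
  from dfg_filter_extension show ?thesis
    using dfg_filter_imp_dfg[OF wf \<kappa> card G] by blast
qed

theorem theoremB6:
  fixes L :: "('s, 'f, 'r) lang"
    and T :: "('s, 'f, 'r) fm set"
    and M :: "('s, 'f, 'r, 'a) struc"
    and \<kappa> :: "'k rel"
    and \<Gamma>N \<Gamma>G \<Gamma>H :: "('s, 'f, 'r) eq_sort list"
    and N G H :: "'a eq_elem list monoid"
    and \<iota> \<pi> :: "'a eq_elem list \<Rightarrow> 'a eq_elem list"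
  assumes "wf_lang L"
    and "complete_theory L T"
    and "is_model L T M"
    and "monster \<kappa> L M"
    and "interpretable_group L M \<Gamma>N N"
    and "interpretable_group L M \<Gamma>G G"
    and "interpretable_group L M \<Gamma>H H"
    and "interpretable_map L M \<Gamma>N \<Gamma>G (carrier N) \<iota>"
    and "interpretable_map L M \<Gamma>G \<Gamma>H (carrier G) \<pi>"
    and "short_exact_sequence H G N \<pi> \<iota>"
    and "has_dfg \<kappa> L M \<Gamma>N N"
    and "has_dfg \<kappa> L M \<Gamma>H H"
  shows "has_dfg \<kappa> L M \<Gamma>G G"
proof -
  note wf = assms(1) and mon = assms(4)[unfolded monster_def]
  interpret fo_structure L M by unfold_locales (use assms(3) in \<open>simp add: is_model_def\<close>)
  interpret E: fo_structure "eq_lang L M" "eq_struc M" by unfold_locales (rule struc_eq)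
  have "|all_formulas L| \<le>o |Field \<kappa>|"
    using mon card_of_Field_ordIso ordLess_imp_ordLeq ordIso_symmetric ordLeq_ordIso_trans by blast
  then have inf: "infinite (Field \<kappa>)"
    using infinite_all_formulas card_of_ordLeq_infinite by blast
  have card: "|sorts (eq_lang L M)| <o \<kappa>" "|sorted_formulas (eq_lang L M)| <o \<kappa>"
    using eq_lang_card[OF wf] mon ordLeq_ordLess_trans by blast+
  have cc: "E.compact_covers \<kappa>" using eq_compact_covers[OF wf _ inf] mon by blast
  show ?thesis
    unfolding has_dfg_def
    by (rule E.dfg_extension_theorem[OF wf_eq_lang[OF wf] mon[THEN conjunct1] inf card cc
      assms(5-7)[unfolded interpretable_group_def] assms(8,9)[unfolded interpretable_map_def]
      assms(10) assms(11,12)[unfolded has_dfg_def]])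
qed

end
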